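(* Let $(\mathcal{M},\nabla)$ be a smooth affine connection space whose connection is symmetric (torsion-free), let $R$ be its curvature tensor and let $m\in\mathcal{M}$. For sufficiently small vectors $u,v\in T_m\mathcal{M}$ (so that all points below lie in a sufficiently small convex normal neighborhood of $m$), let $p=\exp_m(-v)$ and $q=\exp_m(v)$, so that $m$ is the midpoint of the geodesic segment $[p,q]$. Let $u_p=\Pi_m^p u\in T_p\mathcal{M}$, and let $u_q\in T_q\mathcal{M}$ be the result of one step of pole ladder applied to $u_p$ along $[p,q]$, that is, $p'=\exp_p(u_p)$, $q'=\exp_m(-\log_m(p'))$ and $u_q=-\log_q(q')$. Let $u'=\Pi_q^m u_q\in T_m\mathcal{M}$. Then the error of the pole ladder step is $$u'-u=\frac{1}{12}\Big( (\nabla_v R)(u,v)(5u-2v)+(\nabla_u R)(u,v)(v-2u)\Big)+O\big((\|u\|+\|v\|)^5\big)$$ as $(u,v)\to(0,0)$ in $T_m\mathcal{M}\times T_m\mathcal{M}$, where $R$ and $\nabla R$ are evaluated at $m$ and $\|\cdot\|$ is an arbitrary norm on $T_m\mathcal{M}$.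
   Context: An affine connection space $(\mathcal{M},\nabla)$ is a smooth manifold with a smooth affine connection on its tangent bundle. $\exp_x$ is the exponential map of $\nabla$ at $x$. In a sufficiently small convex normal neighborhood of $m$, any two points $x,y$ are joined by a unique geodesic segment $[x,y]$ contained in the neighborhood; $\log_x(y)\in T_x\mathcal{M}$ is the initial velocity at $x$ of this geodesic parametrized on $[0,1]$ (the local inverse of $\exp_x$), and $\Pi_x^y:T_x\mathcal{M}\to T_y\mathcal{M}$ is the parallel transport along it. The curvature tensor is $R(X,Y)Z=\nabla_X\nabla_Y Z-\nabla_Y\nabla_X Z-\nabla_{[X,Y]}Z$, and $(\nabla_a R)(b,c)d$ denotes the covariant derivative of the tensor $R$ in the direction $a$, evaluated on $b,c,d$. *)

theory Defs
  imports "HOL-Analysis.Analysis" "HOL-Library.Function_Algebras"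
begin

text \<open>
  Pointwise real vector space structure on functions; tangent vectors and vector fields below
  are functions, and their linear operations are the pointwise ones.
\<close>

instantiation "fun" :: (type, real_vector) real_vector
begin

definition scaleR_fun :: "real \<Rightarrow> ('a \<Rightarrow> 'b) \<Rightarrow> 'a \<Rightarrow> 'b"
  where "scaleR_fun r f = (\<lambda>x. r *\<^sub>R f x)"

instance
  by standard (auto simp: scaleR_fun_def plus_fun_def fun_eq_iff algebra_simps)

end

primrec Ck_on ::
    "nat \<Rightarrow> 'e::real_normed_vector set \<Rightarrow> ('e \<Rightarrow> 'f::real_normed_vector) \<Rightarrow> bool" where
  "Ck_on 0 S f \<longleftrightarrow> continuous_on S f"
| "Ck_on (Suc k) S f \<longleftrightarrow>
     (\<forall>x\<in>S. f differentiable (at x)) \<and>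
     (\<forall>h. Ck_on k S (\<lambda>x. frechet_derivative f (at x) h))"

text \<open>Only used on open sets.\<close>

definition smooth_on ::
    "'e::real_normed_vector set \<Rightarrow> ('e \<Rightarrow> 'f::real_normed_vector) \<Rightarrow> bool" where
  "smooth_on S f \<longleftrightarrow> (\<forall>k. Ck_on k S f)"

text \<open>A chart is a pair of its domain and its coordinate map; the map is arbitrary off the domain.\<close>

type_synonym ('a, 'e) chart = "'a set \<times> ('a \<Rightarrow> 'e)"

abbreviation cdom :: "('a, 'e) chart \<Rightarrow> 'a set" where "cdom c \<equiv> fst c"
abbreviation cmap :: "('a, 'e) chart \<Rightarrow> 'a \<Rightarrow> 'e" where "cmap c \<equiv> snd c"
abbreviation cimage :: "('a, 'e) chart \<Rightarrow> 'e set" where "cimage c \<equiv> cmap c ` cdom c"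

definition cinv :: "('a, 'e) chart \<Rightarrow> 'e \<Rightarrow> 'a" where
  "cinv c = inv_into (cdom c) (cmap c)"

text \<open>
  The manifold is the whole (Hausdorff, second countable) type \<open>'a\<close>; the atlas need not be maximal.
\<close>

definition smooth_atlas ::
    "('a::{t2_space, second_countable_topology}, 'e::euclidean_space) chart set \<Rightarrow> bool" where
  "smooth_atlas A \<longleftrightarrow>
     (\<Union>c\<in>A. cdom c) = UNIV \<and>
     (\<forall>c\<in>A. open (cdom c) \<and> open (cimage c) \<and>
        homeomorphism (cdom c) (cimage c) (cmap c) (cinv c)) \<and>
     (\<forall>c\<in>A. \<forall>d\<in>A. smooth_on (cmap c ` (cdom c \<inter> cdom d)) (cmap d \<circ> cinv c))"

definition smooth_fun ::
    "('a, 'e::euclidean_space) chart set \<Rightarrow> ('a \<Rightarrow> real) \<Rightarrow> bool" where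
  "smooth_fun A f \<longleftrightarrow> (\<forall>c\<in>A. smooth_on (cimage c) (f \<circ> cinv c))"

text \<open>
  A tangent vector at \<open>x\<close> is the family of its components in all charts around \<open>x\<close>, related by
  the differentials of the chart changes. It is padded with \<open>0\<close> at all other arguments, so that
  the tangent space is a linear subspace of the function space.
\<close>

type_synonym ('a, 'e) tvec = "('a, 'e) chart \<Rightarrow> 'e"

definition tangent_space ::
    "('a, 'e::euclidean_space) chart set \<Rightarrow> 'a \<Rightarrow> ('a, 'e) tvec set" where
  "tangent_space A x = {v.
     (\<forall>c\<in>A. \<forall>d\<in>A. x \<in> cdom c \<inter> cdom d \<longrightarrow>
        v d = frechet_derivative (cmap d \<circ> cinv c) (at (cmap c x)) (v c)) \<and>
     (\<forall>c. \<not> (c \<in> A \<and> x \<in> cdom c) \<longrightarrow> v c = 0)}"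

definition norm_on :: "'v::real_vector set \<Rightarrow> ('v \<Rightarrow> real) \<Rightarrow> bool" where
  "norm_on V N \<longleftrightarrow>
     (\<forall>v\<in>V. 0 \<le> N v \<and> (N v = 0 \<longleftrightarrow> v = 0)) \<and>
     (\<forall>r. \<forall>v\<in>V. N (r *\<^sub>R v) = \<bar>r\<bar> * N v) \<and>
     (\<forall>v\<in>V. \<forall>w\<in>V. N (v + w) \<le> N v + N w)"

type_synonym ('a, 'e) vfield = "'a \<Rightarrow> ('a, 'e) tvec"

definition vrep ::
    "('a, 'e::euclidean_space) chart \<Rightarrow> ('a, 'e) vfield \<Rightarrow> 'e \<Rightarrow> 'e" where
  "vrep c X y = X (cinv c y) c"

definition smooth_vfields ::
    "('a, 'e::euclidean_space) chart set \<Rightarrow> ('a, 'e) vfield set" where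
  "smooth_vfields A = {X. (\<forall>x. X x \<in> tangent_space A x) \<and>
                          (\<forall>c\<in>A. smooth_on (cimage c) (vrep c X))}"

text \<open>The function \<open>X f\<close>; its value does not depend on the selected chart.\<close>

definition vfield_apply ::
    "('a, 'e::euclidean_space) chart set \<Rightarrow> ('a, 'e) vfield \<Rightarrow> ('a \<Rightarrow> real) \<Rightarrow> 'a \<Rightarrow> real" where
  "vfield_apply A X f x =
     (let c = (SOME c. c \<in> A \<and> x \<in> cdom c)
      in frechet_derivative (f \<circ> cinv c) (at (cmap c x)) (X x c))"

text \<open>\<open>[X, Y]\<close> has components \<open>DY(X) - DX(Y)\<close> in each chart, i.e. \<open>[X, Y] f = X (Y f) - Y (X f)\<close>.\<close>

definition lie_bracket ::
    "('a, 'e::euclidean_space) chart set \<Rightarrow> ('a, 'e) vfield \<Rightarrow> ('a, 'e) vfield \<Rightarrow> ('a, 'e) vfield" where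
  "lie_bracket A X Y x c =
     (if c \<in> A \<and> x \<in> cdom c
      then frechet_derivative (vrep c Y) (at (cmap c x)) (X x c)
         - frechet_derivative (vrep c X) (at (cmap c x)) (Y x c)
      else 0)"

type_synonym ('a, 'e) connection = "('a, 'e) vfield \<Rightarrow> ('a, 'e) vfield \<Rightarrow> ('a, 'e) vfield"

definition affine_connection ::
    "('a, 'e::euclidean_space) chart set \<Rightarrow> ('a, 'e) connection \<Rightarrow> bool" where
  "affine_connection A nabla \<longleftrightarrow>
     (\<forall>X\<in>smooth_vfields A. \<forall>Y\<in>smooth_vfields A. nabla X Y \<in> smooth_vfields A) \<and>
     (\<forall>X\<in>smooth_vfields A. \<forall>X'\<in>smooth_vfields A. \<forall>Y\<in>smooth_vfields A.
        nabla (X + X') Y = nabla X Y + nabla X' Y) \<and>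
     (\<forall>X\<in>smooth_vfields A. \<forall>Y\<in>smooth_vfields A. \<forall>Y'\<in>smooth_vfields A.
        nabla X (Y + Y') = nabla X Y + nabla X Y') \<and>
     (\<forall>f. smooth_fun A f \<longrightarrow> (\<forall>X\<in>smooth_vfields A. \<forall>Y\<in>smooth_vfields A.
        nabla (\<lambda>x. f x *\<^sub>R X x) Y = (\<lambda>x. f x *\<^sub>R nabla X Y x) \<and>
        nabla X (\<lambda>x. f x *\<^sub>R Y x) = (\<lambda>x. vfield_apply A X f x *\<^sub>R Y x + f x *\<^sub>R nabla X Y x)))"

definition torsion_free ::
    "('a, 'e::euclidean_space) chart set \<Rightarrow> ('a, 'e) connection \<Rightarrow> bool" where
  "torsion_free A nabla \<longleftrightarrow>
     (\<forall>X\<in>smooth_vfields A. \<forall>Y\<in>smooth_vfields A. nabla X Y - nabla Y X = lie_bracket A X Y)"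

definition curvature ::
    "('a, 'e::euclidean_space) chart set \<Rightarrow> ('a, 'e) connection \<Rightarrow>
     ('a, 'e) vfield \<Rightarrow> ('a, 'e) vfield \<Rightarrow> ('a, 'e) vfield \<Rightarrow> ('a, 'e) vfield" where
  "curvature A nabla X Y Z =
     nabla X (nabla Y Z) - nabla Y (nabla X Z) - nabla (lie_bracket A X Y) Z"

definition cov_curvature ::
    "('a, 'e::euclidean_space) chart set \<Rightarrow> ('a, 'e) connection \<Rightarrow> ('a, 'e) vfield \<Rightarrow>
     ('a, 'e) vfield \<Rightarrow> ('a, 'e) vfield \<Rightarrow> ('a, 'e) vfield \<Rightarrow> ('a, 'e) vfield" where
  "cov_curvature A nabla W X Y Z =
     nabla W (curvature A nabla X Y Z) - curvature A nabla (nabla W X) Y Z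
     - curvature A nabla X (nabla W Y) Z - curvature A nabla X Y (nabla W Z)"

text \<open>
  \<open>(\<nabla>\<^sub>a R)(b, c) d\<close> for tangent vectors at \<open>x\<close>: by tensoriality, the common value at \<open>x\<close> for all
  smooth vector fields extending \<open>a, b, c, d\<close>.
\<close>

definition cov_curvature_at ::
    "('a, 'e::euclidean_space) chart set \<Rightarrow> ('a, 'e) connection \<Rightarrow> 'a \<Rightarrow>
     ('a, 'e) tvec \<Rightarrow> ('a, 'e) tvec \<Rightarrow> ('a, 'e) tvec \<Rightarrow> ('a, 'e) tvec \<Rightarrow> ('a, 'e) tvec" where
  "cov_curvature_at A nabla x a b c d =
     (THE z. \<exists>W\<in>smooth_vfields A. \<exists>X\<in>smooth_vfields A. \<exists>Y\<in>smooth_vfields A. \<exists>Z\<in>smooth_vfields A.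
        W x = a \<and> X x = b \<and> Y x = c \<and> Z x = d \<and> z = cov_curvature A nabla W X Y Z x)"

text \<open>
  In a chart, \<open>\<nabla>\<^sub>X Y = DY(X) + \<Gamma>(X, Y)\<close>; hence \<open>\<Gamma>(a, b)\<close> at \<open>x\<close> is the common value of
  \<open>\<nabla>\<^sub>X Y - DY(X)\<close> over all smooth fields \<open>X, Y\<close> with components \<open>a, b\<close> at \<open>x\<close>.
\<close>

definition christoffel ::
    "('a, 'e::euclidean_space) chart set \<Rightarrow> ('a, 'e) connection \<Rightarrow> ('a, 'e) chart \<Rightarrow>
     'a \<Rightarrow> 'e \<Rightarrow> 'e \<Rightarrow> 'e" where
  "christoffel A nabla c x a b =
     (THE w. \<exists>X\<in>smooth_vfields A. \<exists>Y\<in>smooth_vfields A.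
        X x c = a \<and> Y x c = b \<and>
        w = nabla X Y x c - frechet_derivative (vrep c Y) (at (cmap c x)) a)"

text \<open>
  Curves are parametrized by an interval \<open>S\<close>, with one-sided derivatives at its end points. The
  continuity assumption guarantees that near \<open>t\<close> the curve stays in every chart around \<open>\<gamma> t\<close>.
\<close>

definition differentiable_curve ::
    "('a::topological_space, 'e::euclidean_space) chart set \<Rightarrow> real set \<Rightarrow> (real \<Rightarrow> 'a) \<Rightarrow> bool" where
  "differentiable_curve A S \<gamma> \<longleftrightarrow>
     continuous_on S \<gamma> \<and>
     (\<forall>t\<in>S. \<forall>c\<in>A. \<gamma> t \<in> cdom c \<longrightarrow> (cmap c \<circ> \<gamma>) differentiable (at t within S))"

definition velocity ::
    "('a, 'e::euclidean_space) chart set \<Rightarrow> real set \<Rightarrow> (real \<Rightarrow> 'a) \<Rightarrow> real \<Rightarrow> ('a, 'e) tvec" where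
  "velocity A S \<gamma> t c =
     (if c \<in> A \<and> \<gamma> t \<in> cdom c then vector_derivative (cmap c \<circ> \<gamma>) (at t within S) else 0)"

definition differentiable_along ::
    "('a, 'e::euclidean_space) chart set \<Rightarrow> real set \<Rightarrow> (real \<Rightarrow> 'a) \<Rightarrow>
     (real \<Rightarrow> ('a, 'e) tvec) \<Rightarrow> bool" where
  "differentiable_along A S \<gamma> V \<longleftrightarrow>
     (\<forall>t\<in>S. V t \<in> tangent_space A (\<gamma> t) \<and>
        (\<forall>c\<in>A. \<gamma> t \<in> cdom c \<longrightarrow> (\<lambda>s. V s c) differentiable (at t within S)))"

definition cov_deriv_along ::
    "('a, 'e::euclidean_space) chart set \<Rightarrow> ('a, 'e) connection \<Rightarrow> real set \<Rightarrow> (real \<Rightarrow> 'a) \<Rightarrow>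
     (real \<Rightarrow> ('a, 'e) tvec) \<Rightarrow> real \<Rightarrow> ('a, 'e) tvec" where
  "cov_deriv_along A nabla S \<gamma> V t c =
     (if c \<in> A \<and> \<gamma> t \<in> cdom c
      then vector_derivative (\<lambda>s. V s c) (at t within S)
         + christoffel A nabla c (\<gamma> t) (velocity A S \<gamma> t c) (V t c)
      else 0)"

definition parallel_along ::
    "('a, 'e::euclidean_space) chart set \<Rightarrow> ('a, 'e) connection \<Rightarrow> real set \<Rightarrow> (real \<Rightarrow> 'a) \<Rightarrow>
     (real \<Rightarrow> ('a, 'e) tvec) \<Rightarrow> bool" where
  "parallel_along A nabla S \<gamma> V \<longleftrightarrow>
     differentiable_along A S \<gamma> V \<and> (\<forall>t\<in>S. cov_deriv_along A nabla S \<gamma> V t = 0)"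

text \<open>
  Twice differentiable solutions of the geodesic equation are automatically smooth.
\<close>

definition geodesic ::
    "('a::topological_space, 'e::euclidean_space) chart set \<Rightarrow> ('a, 'e) connection \<Rightarrow>
     real set \<Rightarrow> (real \<Rightarrow> 'a) \<Rightarrow> bool" where
  "geodesic A nabla S \<gamma> \<longleftrightarrow>
     differentiable_curve A S \<gamma> \<and> parallel_along A nabla S \<gamma> (velocity A S \<gamma>)"

text \<open>The exponential map at \<open>x\<close> is only meaningful on its domain \<open>exp_domain A nabla x\<close>.\<close>

definition exp_domain ::
    "('a::topological_space, 'e::euclidean_space) chart set \<Rightarrow> ('a, 'e) connection \<Rightarrow>
     'a \<Rightarrow> ('a, 'e) tvec set" where
  "exp_domain A nabla x =
     {w. \<exists>\<gamma>. geodesic A nabla {0..1} \<gamma> \<and> \<gamma> 0 = x \<and> velocity A {0..1} \<gamma> 0 = w}"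

definition exp_map ::
    "('a::topological_space, 'e::euclidean_space) chart set \<Rightarrow> ('a, 'e) connection \<Rightarrow>
     'a \<Rightarrow> ('a, 'e) tvec \<Rightarrow> 'a" where
  "exp_map A nabla x w =
     (THE y. \<exists>\<gamma>. geodesic A nabla {0..1} \<gamma> \<and> \<gamma> 0 = x \<and> velocity A {0..1} \<gamma> 0 = w \<and> \<gamma> 1 = y)"

definition geodesic_segment ::
    "('a::topological_space, 'e::euclidean_space) chart set \<Rightarrow> ('a, 'e) connection \<Rightarrow> 'a set \<Rightarrow>
     'a \<Rightarrow> 'a \<Rightarrow> (real \<Rightarrow> 'a) \<Rightarrow> bool" where
  "geodesic_segment A nabla U x y \<gamma> \<longleftrightarrow>
     geodesic A nabla {0..1} \<gamma> \<and> \<gamma> ` {0..1} \<subseteq> U \<and> \<gamma> 0 = x \<and> \<gamma> 1 = y"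

text \<open>
  The property of a convex normal neighborhood on which the logarithm and parallel transport rest.
  Every convex normal neighborhood in the usual sense has it, so a statement about all \<open>U\<close> with
  this property covers all of those.
\<close>

definition convex_neighborhood ::
    "('a::topological_space, 'e::euclidean_space) chart set \<Rightarrow> ('a, 'e) connection \<Rightarrow>
     'a \<Rightarrow> 'a set \<Rightarrow> bool" where
  "convex_neighborhood A nabla m U \<longleftrightarrow>
     open U \<and> m \<in> U \<and>
     (\<forall>x\<in>U. \<forall>y\<in>U.
        (\<exists>\<gamma>. geodesic_segment A nabla U x y \<gamma>) \<and>
        (\<forall>\<gamma> \<gamma>'. geodesic_segment A nabla U x y \<gamma> \<longrightarrow> geodesic_segment A nabla U x y \<gamma>' \<longrightarrow>
           (\<forall>t\<in>{0..1}. \<gamma> t = \<gamma>' t)))"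

definition log_map ::
    "('a::topological_space, 'e::euclidean_space) chart set \<Rightarrow> ('a, 'e) connection \<Rightarrow> 'a set \<Rightarrow>
     'a \<Rightarrow> 'a \<Rightarrow> ('a, 'e) tvec" where
  "log_map A nabla U x y =
     (THE w. \<exists>\<gamma>. geodesic_segment A nabla U x y \<gamma> \<and> velocity A {0..1} \<gamma> 0 = w)"

definition transport ::
    "('a::topological_space, 'e::euclidean_space) chart set \<Rightarrow> ('a, 'e) connection \<Rightarrow> 'a set \<Rightarrow>
     'a \<Rightarrow> 'a \<Rightarrow> ('a, 'e) tvec \<Rightarrow> ('a, 'e) tvec" where
  "transport A nabla U x y w =
     (THE z. \<exists>\<gamma> V. geodesic_segment A nabla U x y \<gamma> \<and>
        parallel_along A nabla {0..1} \<gamma> V \<and> V 0 = w \<and> V 1 = z)"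

end

theory Submission
  imports Defs
begin

text \<open>
  Write \<open>h(v, u)\<close> for the logarithm at \<open>m\<close> of the point that is reached from \<open>exp\<^sub>m v\<close> with the parallel
  translate of \<open>u\<close> as initial velocity. Since \<open>q'\<close> is opposite to \<open>p'\<close>, a step of the pole ladder
  satisfies \<open>h(v, -u') = -h(-v, u)\<close>. If \<open>h(v, u) = v + u + h\<^sub>3(v, u) + h\<^sub>4(v, u) + O(5)\<close> with homogeneous
  \<open>h\<^sub>k\<close> of degree \<open>k\<close>, the cubic terms cancel by parity and \<open>u' - u = 2 h\<^sub>4(v, -u) + O(5)\<close>.

  The expansion of \<open>h\<close> follows from comparing the geodesic and transport equations with polynomial curves
  in coordinates whose Christoffel tensor \<open>G\<close> vanishes at \<open>m\<close>: up to order four only the terms that are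
  linear in the derivatives \<open>D\<close> and \<open>S\<close> of order one and two of \<open>G\<close> at \<open>m\<close> survive, and
  \<open>(\<nabla>\<^sub>a R)(b, c) d = S(a, b)(c, d) - S(a, c)(b, d)\<close> at \<open>m\<close>. The remainders are estimated uniformly along the
  curves, so that differentiability of \<open>exp\<close> or \<open>log\<close> in the initial data is not needed: solutions exist by
  contraction, and they are unique by Gronwall's inequality and the assumption on \<open>U\<close>.
\<close>

text \<open>The parity argument needs a bootstrap: adding the two expansions leaves
  \<open>h3 v (- u') - h3 v (- u)\<close>, which is negligible only once \<open>u' - u\<close> is
  known to be of order four. Terms quadratic in \<open>G\<close> drop out because
  \<open>G z z' z'\<close> is already cubic: a geodesic leaves its tangent line only by O(3), and
  inserting that deviation into \<open>G\<close> changes it by O(5). On the manifold side the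
  obstacle is that the notions are definite descriptions and that a connection acts on global fields
  only. Locality of \<open>nabla\<close> therefore has to be extracted with cut-off fields, and each
  point of the ladder is produced by exhibiting an explicit coordinate curve. Such a curve is
  identified with \<open>exp_map\<close> by uniqueness of geodesics among all curves of the
  manifold, and with \<open>log_map\<close> and \<open>transport\<close> by uniqueness of segments
  inside \<open>U\<close>; hence all curves have to be kept in \<open>U\<close>. Torsion-freeness
  enters first through the coordinates: a quadratic substitution can only remove a symmetric
  Christoffel tensor. Multilinear families are handled through their values on a basis, so no norm
  on a space of linear maps is used.\<close>

abbreviation FD :: "('a::real_normed_vector \<Rightarrow> 'b::real_normed_vector) \<Rightarrow> 'a \<Rightarrow> 'a \<Rightarrow> 'b" where
  "FD f x \<equiv> frechet_derivative f (at x)"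

lemma norm_diff_le: "norm a \<le> r \<Longrightarrow> norm b \<le> s \<Longrightarrow> norm (a - b) \<le> r + s"
  by (rule order_trans[OF norm_triangle_ineq4 add_mono])

section \<open>Calculus of Frechet derivatives\<close>

lemma FD_I: "(f has_derivative f') (at x) \<Longrightarrow> FD f x = f'"
  by (metis frechet_derivative_at)

lemma FD_has_derivative: "f differentiable at x \<Longrightarrow> (f has_derivative FD f x) (at x)"
  using frechet_derivative_works by blast

lemma FD_cong:
  assumes "open S" "x \<in> S" "\<And>y. y \<in> S \<Longrightarrow> f y = g y"
  shows "FD f x = FD g x"
proof -
  have "(f has_derivative f') (at x) \<longleftrightarrow> (g has_derivative f') (at x)" for f'
    using has_derivative_transform_within_open[OF _ assms(1,2), of f f' UNIV g]
      has_derivative_transform_within_open[OF _ assms(1,2), of g f' UNIV f] assms(3) by auto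
  then show ?thesis unfolding frechet_derivative_def by simp
qed

lemma linear_FD: "f differentiable at x \<Longrightarrow> linear (FD f x)"
  by (rule linear_frechet_derivative)

lemma FD_add: "f differentiable at x \<Longrightarrow> g differentiable at x \<Longrightarrow>
    FD (\<lambda>y. f y + g y) x h = FD f x h + FD g x h"
  by (subst FD_I[OF has_derivative_add[OF FD_has_derivative FD_has_derivative]]) auto

lemma FD_scaleR: "f differentiable at x \<Longrightarrow> FD (\<lambda>y. r *\<^sub>R f y) x h = r *\<^sub>R FD f x h"
  by (subst FD_I[OF has_derivative_scaleR_right[OF FD_has_derivative]]) auto

lemma FD_comp:
  assumes "g differentiable at x" "f differentiable at (g x)"
  shows "((\<lambda>y. f (g y)) has_derivative (\<lambda>h. FD f (g x) (FD g x h))) (at x)"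
  using diff_chain_at[OF FD_has_derivative[OF assms(1)] FD_has_derivative[OF assms(2)]]
  by (simp add: o_def)

text \<open>Differentiation in the base point keeps linearity in the fibre argument. This is why the
  derivatives of Christoffel tensors and of differentials of chart changes are multilinear.\<close>

lemma linear_FD_arg:
  fixes L :: "'e::real_normed_vector \<Rightarrow> 'b::real_normed_vector \<Rightarrow> 'c::real_normed_vector"
  assumes "open S" "x \<in> S" "\<And>z. z \<in> S \<Longrightarrow> linear (L z)" "\<And>a. (\<lambda>z. L z a) differentiable (at x)"
  shows "linear (\<lambda>b. FD (\<lambda>z. L z b) x h)"
proof (rule linearI)
  show "FD (\<lambda>z. L z (b1 + b2)) x h = FD (\<lambda>z. L z b1) x h + FD (\<lambda>z. L z b2) x h" for b1 b2
    using FD_add[OF assms(4) assms(4)]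
      FD_cong[OF assms(1,2), of "\<lambda>z. L z (b1 + b2)" "\<lambda>z. L z b1 + L z b2"] linear_add[OF assms(3)] by auto
  show "FD (\<lambda>z. L z (r *\<^sub>R b)) x h = r *\<^sub>R FD (\<lambda>z. L z b) x h" for r b
    using FD_scaleR[OF assms(4)]
      FD_cong[OF assms(1,2), of "\<lambda>z. L z (r *\<^sub>R b)" "\<lambda>z. r *\<^sub>R L z b"] linear_scale[OF assms(3)] by auto
qed

section \<open>Smooth functions\<close>

text \<open>\<open>Ck_on\<close> is defined through \<open>frechet_derivative\<close>; these rules
  allow any explicit formula for the derivative to be used in its place on an open set.\<close>

lemma
  assumes "open S" and D: "\<And>x. x \<in> S \<Longrightarrow> (f has_derivative f' x) (at x)"
  shows Ck_on_SucI: "(\<And>h. Ck_on k S (\<lambda>x. f' x h)) \<Longrightarrow> Ck_on (Suc k) S f"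
    and Ck_on_Suc_iff: "Ck_on (Suc k) S f \<longleftrightarrow> (\<forall>h. Ck_on k S (\<lambda>x. f' x h))"
proof -
  have c: "Ck_on k S g" if "Ck_on k S f" "\<And>x. x \<in> S \<Longrightarrow> f x = g x"
    for k and f g :: "'a \<Rightarrow> 'b"
    using that
  proof (induction k arbitrary: f g)
    case 0
    then show ?case by (auto cong: continuous_on_cong)
  next
    case (Suc k)
    have "g differentiable at x" if "x \<in> S" for x
      using has_derivative_transform_within_open[OF FD_has_derivative assms(1) that, of f g]
        Suc.prems that by (auto intro!: differentiableI)
    moreover have "Ck_on k S (\<lambda>x. FD g x h)" for h
      by (rule Suc.IH[of "\<lambda>x. FD f x h"])
        (use Suc.prems FD_cong[OF assms(1), of _ f g] in auto)
    ultimately show ?case by simp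
  qed
  have "FD f x = f' x" if "x \<in> S" for x using FD_I[OF D[OF that]] .
  then have e: "Ck_on k S (\<lambda>x. FD f x h) \<longleftrightarrow> Ck_on k S (\<lambda>x. f' x h)" for k h
    using c[of k "\<lambda>x. FD f x h" "\<lambda>x. f' x h"] c[of k "\<lambda>x. f' x h" "\<lambda>x. FD f x h"] by auto
  have d: "\<forall>x\<in>S. f differentiable at x" using D unfolding differentiable_def by blast
  show "(\<And>h. Ck_on k S (\<lambda>x. f' x h)) \<Longrightarrow> Ck_on (Suc k) S f" using d e by simp
  show "Ck_on (Suc k) S f \<longleftrightarrow> (\<forall>h. Ck_on k S (\<lambda>x. f' x h))" using d e by simp
qed

lemma Ck_on_cong:
  assumes "open S" "\<And>x. x \<in> S \<Longrightarrow> f x = g x"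
  shows "Ck_on k S f \<longleftrightarrow> Ck_on k S g"
proof (cases k)
  case 0
  then show ?thesis using assms by (auto cong: continuous_on_cong)
next
  case (Suc j)
  have d: "f differentiable at x \<longleftrightarrow> g differentiable at x" if "x \<in> S" for x
    using has_derivative_transform_within_open[OF _ assms(1) that, of f _ UNIV g]
        has_derivative_transform_within_open[OF _ assms(1) that, of g _ UNIV f] assms(2)
    unfolding differentiable_def by (metis (no_types, lifting))
  have "Ck_on (Suc j) S g \<longleftrightarrow> (\<forall>h. Ck_on j S (\<lambda>x. FD f x h))"
    if "\<forall>x\<in>S. g differentiable at x"
  proof (rule Ck_on_Suc_iff[OF assms(1)])
    fix x assume x: "x \<in> S"
    show "(g has_derivative FD f x) (at x)"
      using FD_has_derivative[of g x] that x FD_cong[OF assms(1) x assms(2)] by simp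
  qed
  then show ?thesis using d Suc by auto
qed

lemma Ck_on_Suc_imp: "Ck_on (Suc k) S f \<Longrightarrow> Ck_on k S f"
proof (induction k arbitrary: f)
  case 0
  then show ?case
    by (auto intro!: continuous_at_imp_continuous_on differentiable_imp_continuous_within)
next
  case (Suc k)
  then show ?case by (metis Ck_on.simps(2))
qed

lemma Ck_on_subset: "Ck_on k S f \<Longrightarrow> T \<subseteq> S \<Longrightarrow> Ck_on k T f"
  by (induction k arbitrary: f) (auto intro: continuous_on_subset)

lemma Ck_on_local:
  assumes "\<And>x. x \<in> S \<Longrightarrow> \<exists>T. open T \<and> x \<in> T \<and> Ck_on k T f"
  shows "Ck_on k S f"
  using assms
proof (induction k arbitrary: f)
  case 0
  then show ?case
    by (metis Ck_on.simps(1) continuous_at_imp_continuous_on continuous_on_eq_continuous_at)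
next
  case (Suc k)
  then show ?case by (metis Ck_on.simps(2))
qed

lemma Ck_on_const [simp]: "Ck_on k S (\<lambda>x. c)"
  by (induction k arbitrary: c) auto

lemma Ck_on_bounded_linear:
  assumes "bounded_linear L" "open S"
  shows "Ck_on k S f \<Longrightarrow> Ck_on k S (\<lambda>x. L (f x))"
proof (induction k arbitrary: f)
  case 0
  then show ?case by (auto intro: bounded_linear.continuous_on[OF assms(1)])
next
  case (Suc k)
  show ?case
    by (rule Ck_on_SucI[OF assms(2), where f' = "\<lambda>x h. L (FD f x h)"])
      (use Suc in \<open>auto intro!: bounded_linear.has_derivative[OF assms(1)] FD_has_derivative\<close>)
qed

lemma Ck_on_id: "open S \<Longrightarrow> Ck_on k S (\<lambda>x. x)"
  by (cases k) auto

lemma Ck_on_add: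
  assumes "open S"
  shows "Ck_on k S f \<Longrightarrow> Ck_on k S g \<Longrightarrow> Ck_on k S (\<lambda>x. f x + g x)"
proof (induction k arbitrary: f g)
  case 0
  then show ?case by (auto intro: continuous_intros)
next
  case (Suc k)
  show ?case
    by (rule Ck_on_SucI[OF assms(1), where f' = "\<lambda>x h. FD f x h + FD g x h"])
      (use Suc in \<open>auto intro!: has_derivative_add FD_has_derivative\<close>)
qed

lemma Ck_on_bilinear:
  assumes "bounded_bilinear B" "open S"
  shows "Ck_on k S f \<Longrightarrow> Ck_on k S g \<Longrightarrow> Ck_on k S (\<lambda>x. B (f x) (g x))"
proof (induction k arbitrary: f g)
  case 0
  then show ?case by (auto intro: bounded_bilinear.continuous_on[OF assms(1)])
next
  case (Suc k)
  note c = Ck_on_Suc_imp[OF Suc.prems(1)] Ck_on_Suc_imp[OF Suc.prems(2)]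
  show ?case
    by (rule Ck_on_SucI[OF assms(2), where f' = "\<lambda>x h. B (f x) (FD g x h) + B (FD f x h) (g x)"])
      (use Suc c in \<open>auto intro!: bounded_bilinear.FDERIV[OF assms(1)] FD_has_derivative Ck_on_add assms(2)\<close>)
qed

lemmas Ck_on_scaleR = Ck_on_bilinear[OF bounded_bilinear_scaleR]
lemmas Ck_on_mult = Ck_on_bilinear[OF bounded_bilinear_mult]
lemmas Ck_on_inner = Ck_on_bilinear[OF bounded_bilinear_inner]

lemma Ck_on_minus: "open S \<Longrightarrow> Ck_on k S f \<Longrightarrow> Ck_on k S (\<lambda>x. - f x)"
  by (rule Ck_on_bounded_linear[OF bounded_linear_minus[OF bounded_linear_ident]])

lemma Ck_on_diff: "open S \<Longrightarrow> Ck_on k S f \<Longrightarrow> Ck_on k S g \<Longrightarrow> Ck_on k S (\<lambda>x. f x - g x)"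
  using Ck_on_add[of S k f "\<lambda>x. - g x"] Ck_on_minus[of S k g] by simp

lemma Ck_on_sum: "open S \<Longrightarrow> (\<And>i. i \<in> I \<Longrightarrow> Ck_on k S (f i)) \<Longrightarrow> Ck_on k S (\<lambda>x. \<Sum>i\<in>I. f i x)"
  by (induction I rule: infinite_finite_induct) (auto intro!: Ck_on_add)

lemma linear_sum_Basis: "linear L \<Longrightarrow> L a = (\<Sum>b\<in>Basis. (a \<bullet> b) *\<^sub>R L b)"
  for a :: "'a::euclidean_space"
  by (subst (1) euclidean_representation[symmetric, of a]) (simp add: linear_sum linear_scale)

text \<open>Expanding \<open>X z\<close> in the basis leaves finitely many fixed arguments.
  Regularity of a family of linear maps can thus be stated argument by argument throughout.\<close>

lemma Ck_on_family:
  fixes X :: "'e::real_normed_vector \<Rightarrow> 'b::euclidean_space"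
  assumes "open S" "\<And>z. z \<in> S \<Longrightarrow> linear (L z)" "\<And>b. Ck_on k S (\<lambda>z. L z b)" "Ck_on k S X"
  shows "Ck_on k S (\<lambda>z. L z (X z))"
proof -
  have "Ck_on k S (\<lambda>z. \<Sum>b\<in>Basis. (X z \<bullet> b) *\<^sub>R L z b)"
    by (intro Ck_on_sum Ck_on_scaleR Ck_on_inner assms) auto
  also have "?this \<longleftrightarrow> ?thesis"
    by (rule Ck_on_cong[OF assms(1)]) (use linear_sum_Basis[OF assms(2)] in auto)
  finally show ?thesis .
qed

text \<open>The product rule for a linear map applied to a vector when both depend on the point,
  again by expansion in the basis.\<close>

lemma has_derivative_family:
  fixes X :: "'e::real_normed_vector \<Rightarrow> 'b::euclidean_space"
  assumes S: "open S" "x \<in> S" and lin: "\<And>z. z \<in> S \<Longrightarrow> linear (L z)"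
    and L: "\<And>b. (\<lambda>z. L z b) differentiable (at x)"
    and X: "(X has_derivative X') (at x)"
  shows "((\<lambda>z. L z (X z)) has_derivative (\<lambda>h. FD (\<lambda>z. L z (X x)) x h + L x (X' h))) (at x)"
proof -
  have 1: "((\<lambda>z. \<Sum>b\<in>Basis. (a z \<bullet> b) *\<^sub>R L z b) has_derivative
      (\<lambda>h. \<Sum>b\<in>Basis. (a x \<bullet> b) *\<^sub>R FD (\<lambda>z. L z b) x h + (a' h \<bullet> b) *\<^sub>R L x b)) (at x)"
    if "(a has_derivative a') (at x)" for a a'
    by (intro has_derivative_sum has_derivative_scaleR has_derivative_inner_left that
        FD_has_derivative L)
  have 2: "((\<lambda>z. L z (a z)) has_derivative
      (\<lambda>h. \<Sum>b\<in>Basis. (a x \<bullet> b) *\<^sub>R FD (\<lambda>z. L z b) x h + (a' h \<bullet> b) *\<^sub>R L x b)) (at x)"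
    if "(a has_derivative a') (at x)" for a a'
    by (rule has_derivative_transform_within_open[OF 1[OF that] S])
       (simp add: linear_sum_Basis[OF lin])
  \<comment> \<open>The case of a constant field identifies the first half of the sum.\<close>
  have 3: "FD (\<lambda>z. L z (X x)) x h = (\<Sum>b\<in>Basis. (X x \<bullet> b) *\<^sub>R FD (\<lambda>z. L z b) x h)" for h
    using FD_I[OF 2[OF has_derivative_const[of "X x"]]] by (simp add: fun_eq_iff)
  have 4: "L x a = (\<Sum>b\<in>Basis. (a \<bullet> b) *\<^sub>R L x b)" for a
    by (rule linear_sum_Basis[OF lin[OF S(2)]])
  show ?thesis using 2[OF X] unfolding 3 4[of "X' _"] by (simp add: sum.distrib)
qed

text \<open>By the chain rule the derivative is the linear family \<open>FD f (g x)\<close> applied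
  to \<open>FD g x h\<close>, so the induction step is an instance of
  \<open>Ck_on_family\<close>.\<close>

lemma Ck_on_comp:
  fixes g :: "'a::real_normed_vector \<Rightarrow> 'b::euclidean_space"
  assumes "open S" "g ` S \<subseteq> T"
  shows "Ck_on k T f \<Longrightarrow> Ck_on k S g \<Longrightarrow> Ck_on k S (\<lambda>x. f (g x))"
proof (induction k arbitrary: f)
  case 0
  then show ?case using assms by (auto intro: continuous_on_compose2)
next
  case (Suc k)
  have D: "g differentiable at x" "f differentiable at (g x)" if "x \<in> S" for x
    using Suc.prems that assms by auto
  show ?case
  proof (rule Ck_on_SucI[OF assms(1) FD_comp[OF D]])
    show "Ck_on k S (\<lambda>x. FD f (g x) (FD g x h))" for h
    proof (rule Ck_on_family[OF assms(1) linear_FD[OF D(2)]])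
      show "Ck_on k S (\<lambda>z. FD f (g z) b)" for b
        using Suc.IH[of "\<lambda>y. FD f y b"] Suc.prems Ck_on_Suc_imp by auto
    qed (use Suc.prems in auto)
  qed auto
qed

text \<open>With \<open>b = M x a\<close> one has
  \<open>M z a - M x a = - M z (L z b - L x b)\<close>. The uniform bound \<open>K\<close> turns
  this first into continuity and then into the derivative \<open>- M x (L' (M x a))\<close>; the
  formula expresses the derivative through \<open>M\<close> itself, which drives the induction on
  \<open>k\<close>.\<close>

lemma Ck_on_inverse_family:
  fixes L M :: "'e::euclidean_space \<Rightarrow> 'b::euclidean_space \<Rightarrow> 'b"
  assumes S: "open S" and lin: "\<And>z. z \<in> S \<Longrightarrow> linear (L z)" "\<And>z. z \<in> S \<Longrightarrow> linear (M z)"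
    and inv: "\<And>z a. z \<in> S \<Longrightarrow> M z (L z a) = a" "\<And>z a. z \<in> S \<Longrightarrow> L z (M z a) = a"
    and bound: "\<And>z a. z \<in> S \<Longrightarrow> norm (M z a) \<le> K * norm a"
    and L: "\<And>k a. Ck_on k S (\<lambda>z. L z a)"
  shows "Ck_on k S (\<lambda>z. M z a)"
proof -
  have dL: "(\<lambda>z. L z a) differentiable at x" if "x \<in> S" for x a
    using L[of "Suc 0" a] that by auto
  have K: "K \<ge> 0" if "x \<in> S" for x
    using bound[OF that, of "SOME i. i \<in> Basis"] norm_ge_zero[of "M x (SOME i. i \<in> Basis)"]
      norm_some_Basis by (metis mult.right_neutral order_trans)
  have deriv: "((\<lambda>z. M z a) has_derivative (\<lambda>h. - M x (FD (\<lambda>z. L z (M x a)) x h))) (at x)"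
    if x: "x \<in> S" for x a
  proof -
    have eq: "M z a - M x a = - M z (L z (M x a) - L x (M x a))" if "z \<in> S" for z a
      using inv that x linear_diff[OF lin(2)[OF that]] by simp
    have cont: "((\<lambda>z. M z b) \<longlongrightarrow> M x b) (at x)" for b
    proof (rule Lim_transform_within_open[OF _ S x])
      have "((\<lambda>z. L z (M x b)) \<longlongrightarrow> L x (M x b)) (at x)"
        using differentiable_imp_continuous_within[OF dL[OF x]] by (simp add: continuous_within)
      then have l0: "((\<lambda>z. K * norm (L z (M x b) - L x (M x b))) \<longlongrightarrow> K * norm (L x (M x b) - L x (M x b))) (at x)"
        by (intro tendsto_intros)
      have ev: "eventually (\<lambda>z. z \<in> S) (at x)" using S x by (metis eventually_at_topological)
      have "((\<lambda>z. M z b - M x b) \<longlongrightarrow> 0) (at x)"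
        by (rule Lim_null_comparison[OF _ l0[simplified]], rule eventually_mono[OF ev])
          (metis eq bound norm_minus_cancel)
      then show "((\<lambda>z. M z b) \<longlongrightarrow> M x b) (at x)" by (simp add: LIM_zero_cancel)
    qed auto
    let ?b = "M x a"
    let ?L' = "FD (\<lambda>z. L z ?b) x"
    have bl: "bounded_linear ?L'" using dL[OF x] FD_has_derivative has_derivative_bounded_linear by blast
    have dl: "((\<lambda>z. L z ?b) has_derivative ?L') (at x)" using dL[OF x] FD_has_derivative by blast
    have lm: "linear (M x)" using lin x by auto
    show ?thesis
      unfolding has_derivative_iff_norm
    proof (intro conjI)
      show "bounded_linear (\<lambda>h. - M x (?L' h))"
        using bounded_linear_minus[OF bounded_linear_compose[OF _ bl, of "M x"]] lm
        by (simp add: linear_conv_bounded_linear)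
      have "((\<lambda>y. norm ((1 / norm (y - x)) *\<^sub>R (L y ?b - L x ?b - ?L' (y - x)))) \<longlongrightarrow> 0) (at x)"
        using dl unfolding has_derivative_iff_norm by simp
      then have A: "((\<lambda>y. K * norm ((1 / norm (y - x)) *\<^sub>R (L y ?b - L x ?b - ?L' (y - x)))) \<longlongrightarrow> K * 0) (at x)"
        by (intro tendsto_intros)
      obtain C where C: "\<And>h. norm (?L' h) \<le> C * norm h"
        using bounded_linear.bounded[OF bl] by (metis mult.commute)
      have B: "((\<lambda>y. \<Sum>b\<in>Basis. C * norm (M y b - M x b)) \<longlongrightarrow> (\<Sum>b\<in>(Basis::'b set). C * norm (M x b - M x b))) (at x)"
        by (intro tendsto_intros cont)
      have AB: "((\<lambda>y. K * norm ((1 / norm (y - x)) *\<^sub>R (L y ?b - L x ?b - ?L' (y - x))) +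
         (\<Sum>b\<in>Basis. C * norm (M y b - M x b))) \<longlongrightarrow> 0) (at x)"
        using tendsto_add[OF A B] by simp
      have ev: "eventually (\<lambda>z. z \<in> S \<and> z \<noteq> x) (at x)"
        using S x unfolding eventually_at_topological by blast
      \<comment> \<open>The error splits into \<open>M y\<close> applied to the linearization error
        of \<open>L\<close>, controlled by \<open>K\<close>, and \<open>M y - M x\<close> applied to
        the linear part. The latter is estimated on basis vectors because \<open>M\<close> is only
        known to converge argumentwise.\<close>
      have "norm ((1 / norm (y - x)) *\<^sub>R (M y a - M x a - - M x (?L' (y - x)))) \<le>
         K * norm ((1 / norm (y - x)) *\<^sub>R (L y ?b - L x ?b - ?L' (y - x))) +
         (\<Sum>b\<in>Basis. C * norm (M y b - M x b))" if y: "y \<in> S \<and> y \<noteq> x" for y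
      proof -
        let ?h = "y - x"
        let ?n = "1 / norm ?h"
        have ly: "linear (M y)" using lin y by auto
        have scaled: "?n *\<^sub>R W = - M y (?n *\<^sub>R Q) - ?n *\<^sub>R R" if "W = - M y Q - R" for W Q R
          using that by (simp add: linear_scale[OF ly] scaleR_diff_right)
        have "M y a - M x a - - M x (?L' ?h) = - M y (L y ?b - L x ?b - ?L' ?h) - (M y (?L' ?h) - M x (?L' ?h))"
          using eq[of y a] y by (simp add: linear_diff[OF ly])
        then have "?n *\<^sub>R (M y a - M x a - - M x (?L' ?h)) =
            - M y (?n *\<^sub>R (L y ?b - L x ?b - ?L' ?h)) - ?n *\<^sub>R (M y (?L' ?h) - M x (?L' ?h))"
          by (rule scaled)
        then have "norm (?n *\<^sub>R (M y a - M x a - - M x (?L' ?h))) \<le>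
           norm (M y (?n *\<^sub>R (L y ?b - L x ?b - ?L' ?h))) + norm (?n *\<^sub>R (M y (?L' ?h) - M x (?L' ?h)))"
          by (metis norm_minus_cancel norm_triangle_ineq4)
        also have "\<dots> \<le> K * norm (?n *\<^sub>R (L y ?b - L x ?b - ?L' ?h)) + (\<Sum>b\<in>Basis. C * norm (M y b - M x b))"
        proof (rule add_mono)
          show "norm (M y (?n *\<^sub>R (L y ?b - L x ?b - ?L' ?h))) \<le> K * norm (?n *\<^sub>R (L y ?b - L x ?b - ?L' ?h))"
            using bound y by blast
          have "M y (?L' ?h) - M x (?L' ?h) = (\<Sum>b\<in>Basis. (?L' ?h \<bullet> b) *\<^sub>R (M y b - M x b))"
            using linear_sum_Basis[OF ly, of "?L' ?h"] linear_sum_Basis[OF lm, of "?L' ?h"]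
            by (simp add: scaleR_diff_right sum_subtractf)
          then have "norm (?n *\<^sub>R (M y (?L' ?h) - M x (?L' ?h))) =
              ?n * norm (\<Sum>b\<in>Basis. (?L' ?h \<bullet> b) *\<^sub>R (M y b - M x b))" by simp
          also have "\<dots> \<le> ?n * (\<Sum>b\<in>Basis. (C * norm ?h) * norm (M y b - M x b))"
          proof (intro mult_left_mono sum_norm_le)
            fix b :: 'b assume "b \<in> Basis"
            then have "\<bar>?L' ?h \<bullet> b\<bar> \<le> C * norm ?h" using Basis_le_norm C order_trans by blast
            then show "norm ((?L' ?h \<bullet> b) *\<^sub>R (M y b - M x b)) \<le> C * norm ?h * norm (M y b - M x b)"
              by (simp add: mult_right_mono)
          qed auto
          also have "\<dots> = (\<Sum>b\<in>Basis. C * norm (M y b - M x b))"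
          proof -
            have "?n * (C * norm ?h * w) = C * w" for w using y by simp
            then show ?thesis unfolding sum_distrib_left by (intro sum.cong refl)
          qed
          finally show "norm (?n *\<^sub>R (M y (?L' ?h) - M x (?L' ?h))) \<le> (\<Sum>b\<in>Basis. C * norm (M y b - M x b))" .
        qed
        finally show ?thesis .
      qed
      then have "((\<lambda>y. (1 / norm (y - x)) *\<^sub>R (M y a - M x a - - M x (?L' (y - x)))) \<longlongrightarrow> 0) (at x)"
        by (intro Lim_null_comparison[OF eventually_mono[OF ev] AB])
      then have "((\<lambda>y. norm ((1 / norm (y - x)) *\<^sub>R (M y a - M x a - - M x (?L' (y - x))))) \<longlongrightarrow> 0) (at x)"
        by (rule tendsto_norm_zero)
      then show "((\<lambda>y. norm (M y a - M x a - - M x (?L' (y - x))) / norm (y - x)) \<longlongrightarrow> 0) (at x)"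
        by simp
    qed
  qed
  show ?thesis
  proof (induction k arbitrary: a)
    case 0
    show ?case using deriv
      by (auto intro!: continuous_at_imp_continuous_on has_derivative_continuous)
  next
    case (Suc k)
    show ?case
    proof (rule Ck_on_SucI[OF S deriv])
      fix h
      have "Ck_on k S (\<lambda>x. FD (\<lambda>z. L z (M x a)) x h)"
      proof (rule Ck_on_family[OF S, where L = "\<lambda>x b. FD (\<lambda>z. L z b) x h"])
        show "linear (\<lambda>b. FD (\<lambda>z. L z b) x h)" if "x \<in> S" for x
          by (rule linear_FD_arg[OF S that lin(1) dL[OF that]])
        show "Ck_on k S (\<lambda>z. FD (\<lambda>z. L z b) z h)" for b using L[of "Suc k" b] by simp
        show "Ck_on k S (\<lambda>x. M x a)" by (rule Suc.IH)
      qed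
      then have "Ck_on k S (\<lambda>x. M x (FD (\<lambda>z. L z (M x a)) x h))"
        by (rule Ck_on_family[OF S lin(2) Suc.IH, rotated -1])
      then show "Ck_on k S (\<lambda>x. - M x (FD (\<lambda>z. L z (M x a)) x h))"
        by (rule Ck_on_minus[OF S])
    qed
  qed
qed

text \<open>The second difference \<open>?\<Delta> t h k\<close> is symmetric in \<open>h\<close>
  and \<open>k\<close>, and divided by the square of \<open>t\<close> it tends to
  \<open>?A h k\<close>.\<close>

lemma symmetric_second_derivative:
  fixes f :: "'a::real_normed_vector \<Rightarrow> 'b::real_normed_vector"
  assumes "Ck_on 2 S f" "open S" "x \<in> S"
  shows "FD (\<lambda>y. FD f y k) x h = FD (\<lambda>y. FD f y h) x k"
proof -
  have df: "f differentiable at y" if "y \<in> S" for y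
    using assms(1) that by (auto simp: numeral_2_eq_2)
  have dd: "(\<lambda>y. FD f y k) differentiable at x" for k
    using assms by (auto simp: numeral_2_eq_2)
  let ?A = "\<lambda>h k. FD (\<lambda>y. FD f y k) x h"
  let ?\<Delta> = "\<lambda>t h k. f (x + t *\<^sub>R h + t *\<^sub>R k) - f (x + t *\<^sub>R h) - f (x + t *\<^sub>R k) + f x"
  have key: "\<exists>d>0. \<forall>t. 0 < t \<and> t < d \<longrightarrow>
      norm (?\<Delta> t h k - t\<^sup>2 *\<^sub>R ?A h k) \<le> e * t\<^sup>2" if e: "e > 0" for e h k
  proof -
    \<comment> \<open>The factor 2 pays for the two linearization errors in \<open>?Q\<close>; the 1
      keeps the divisor positive.\<close>
    let ?n = "2 * (norm h + norm k) + 1"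
    let ?e = "e / ?n"
    have n: "?n > 0" by (intro add_nonneg_pos mult_nonneg_nonneg add_nonneg_nonneg) auto
    have e': "?e > 0" using e n by simp
    obtain r where r: "r > 0" "ball x r \<subseteq> S" using assms openE by blast
    obtain d where d: "d > 0" "\<And>y. norm (y - x) < d \<Longrightarrow>
        norm (FD f y k - FD f x k - ?A (y - x) k) \<le> ?e * norm (y - x)"
      using FD_has_derivative[OF dd[of k]] e' unfolding has_derivative_at_alt by meson
    let ?d = "min d r / ?n"
    show ?thesis
    proof (intro exI conjI allI impI)
      show "?d > 0" using d r n by simp
      fix t :: real assume t: "0 < t \<and> t < ?d"
      then have tn: "t * ?n < min d r" using n by (simp add: field_simps)
      have small: "norm (a *\<^sub>R h + b *\<^sub>R k) \<le> t * (norm h + norm k) \<and> norm (a *\<^sub>R h + b *\<^sub>R k) < min d r"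
        if "0 \<le> a" "a \<le> t" "0 \<le> b" "b \<le> t" for a b
      proof -
        have "norm (a *\<^sub>R h + b *\<^sub>R k) \<le> a * norm h + b * norm k"
          using norm_triangle_ineq[of "a *\<^sub>R h" "b *\<^sub>R k"] that by simp
        also have "\<dots> \<le> t * (norm h + norm k)"
          using mult_right_mono[OF that(2) norm_ge_zero[of h]] mult_right_mono[OF that(4) norm_ge_zero[of k]]
          by (simp add: algebra_simps)
        finally have 1: "norm (a *\<^sub>R h + b *\<^sub>R k) \<le> t * (norm h + norm k)" .
        have "t * (norm h + norm k) \<le> t * ?n" using t by (intro mult_left_mono) auto
        with 1 tn show ?thesis by linarith
      qed
      have lA: "linear (\<lambda>h. ?A h k)" by (rule linear_FD[OF dd])
      \<comment> \<open>\<open>\<phi> t - \<phi> 0\<close> is the second difference minus its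
        expected value, so the mean value inequality in the single variable \<open>s\<close>
        suffices.\<close>
      define \<phi> where "\<phi> = (\<lambda>s. f (x + t *\<^sub>R h + s *\<^sub>R k) - f (x + s *\<^sub>R k) - (s * t) *\<^sub>R ?A h k)"
      have inS: "x + (a *\<^sub>R h + b *\<^sub>R k) \<in> S" if "0 \<le> a" "a \<le> t" "0 \<le> b" "b \<le> t" for a b
        using small[OF that] r(2) by (auto simp: dist_norm subset_iff mem_ball norm_minus_commute)
      have d\<phi>: "(\<phi> has_derivative (\<lambda>\<sigma>. \<sigma> *\<^sub>R (FD f (x + (t *\<^sub>R h + s *\<^sub>R k)) k - FD f (x + (0 *\<^sub>R h + s *\<^sub>R k)) k - t *\<^sub>R ?A h k))) (at s within {0..t})"
        if "s \<in> {0..t}" for s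
      proof -
        have g: "((\<lambda>s. f (x + a *\<^sub>R h + s *\<^sub>R k)) has_derivative (\<lambda>\<sigma>. FD f (x + a *\<^sub>R h + s *\<^sub>R k) (\<sigma> *\<^sub>R k))) (at s within {0..t})"
          if "0 \<le> a" "a \<le> t" for a
        proof -
          have "f differentiable at (x + a *\<^sub>R h + s *\<^sub>R k)"
            using df[OF inS[of a s]] that \<open>s \<in> {0..t}\<close> by (simp add: add.assoc)
          moreover have "((\<lambda>s. x + a *\<^sub>R h + s *\<^sub>R k) has_derivative (\<lambda>\<sigma>. \<sigma> *\<^sub>R k)) (at s within {0..t})"
            by (auto intro!: derivative_eq_intros)
          ultimately show ?thesis
            using has_derivative_compose[where g = f, OF _ FD_has_derivative] by blast
        qed
        have g': "((\<lambda>s. (s * t) *\<^sub>R ?A h k) has_derivative (\<lambda>\<sigma>. \<sigma> *\<^sub>R (t *\<^sub>R ?A h k))) (at s within {0..t})"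
          by (auto intro!: derivative_eq_intros simp: algebra_simps)
        have sc: "FD f (x + a *\<^sub>R h + s *\<^sub>R k) (\<sigma> *\<^sub>R k) = \<sigma> *\<^sub>R FD f (x + (a *\<^sub>R h + s *\<^sub>R k)) k"
          if "0 \<le> a" "a \<le> t" for a \<sigma>
          using linear_scale[OF linear_FD[OF df[OF inS[of a s]]]] that \<open>s \<in> {0..t}\<close> by (simp add: add.assoc)
        have "(\<phi> has_derivative (\<lambda>\<sigma>. FD f (x + t *\<^sub>R h + s *\<^sub>R k) (\<sigma> *\<^sub>R k) - FD f (x + 0 *\<^sub>R h + s *\<^sub>R k) (\<sigma> *\<^sub>R k) - \<sigma> *\<^sub>R (t *\<^sub>R ?A h k))) (at s within {0..t})"
          unfolding \<phi>_def using has_derivative_diff[OF has_derivative_diff[OF g[of t] g[of 0]] g'] t by simp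
        then show ?thesis
          using sc[of t] sc[of 0] t by (simp add: scaleR_diff_right)
      qed
      have "norm (\<phi> t - \<phi> 0) \<le> (e * t) * norm (t - 0)"
      proof (rule differentiable_bound[OF convex_real_interval(5) d\<phi>])
        fix s assume s: "s \<in> {0..t}"
        let ?Q = "FD f (x + (t *\<^sub>R h + s *\<^sub>R k)) k - FD f (x + (0 *\<^sub>R h + s *\<^sub>R k)) k - t *\<^sub>R ?A h k"
        have b: "norm (FD f (x + (a *\<^sub>R h + s *\<^sub>R k)) k - FD f x k - ?A (a *\<^sub>R h + s *\<^sub>R k) k) \<le> ?e * (t * (norm h + norm k))"
          if "0 \<le> a" "a \<le> t" for a
        proof -
          note sm = small[of a s, OF that] s
          have "norm (FD f (x + (a *\<^sub>R h + s *\<^sub>R k)) k - FD f x k - ?A (a *\<^sub>R h + s *\<^sub>R k) k) \<le> ?e * norm (a *\<^sub>R h + s *\<^sub>R k)"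
            using d(2)[of "x + (a *\<^sub>R h + s *\<^sub>R k)"] sm by simp
          also have "\<dots> \<le> ?e * (t * (norm h + norm k))" using sm e' by (intro mult_left_mono) auto
          finally show ?thesis .
        qed
        have "?A (t *\<^sub>R h + s *\<^sub>R k) k - ?A (0 *\<^sub>R h + s *\<^sub>R k) k = t *\<^sub>R ?A h k"
          by (simp only: linear_add[OF lA] linear_scale[OF lA]) simp
        then have Qe: "?Q = (FD f (x + (t *\<^sub>R h + s *\<^sub>R k)) k - FD f x k - ?A (t *\<^sub>R h + s *\<^sub>R k) k)
           - (FD f (x + (0 *\<^sub>R h + s *\<^sub>R k)) k - FD f x k - ?A (0 *\<^sub>R h + s *\<^sub>R k) k)"
          by (simp add: algebra_simps)
        have "norm ?Q \<le> ?e * (t * (norm h + norm k)) + ?e * (t * (norm h + norm k))"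
          unfolding Qe by (rule norm_diff_le[OF b b]) (use t in auto)
        also have "\<dots> = ?e * (t * (2 * (norm h + norm k)))" by algebra
        also have "\<dots> \<le> ?e * (t * ?n)" using e' t by (intro mult_left_mono) auto
        also have "\<dots> = e * t" using n by simp
        finally have Q: "norm ?Q \<le> e * t" .
        show "onorm (\<lambda>\<sigma>. \<sigma> *\<^sub>R ?Q) \<le> e * t"
        proof (rule onorm_bound)
          show "0 \<le> e * t" using e t by simp
          show "norm (\<sigma> *\<^sub>R ?Q) \<le> e * t * norm \<sigma>" for \<sigma> :: real
            using mult_left_mono[OF Q abs_ge_zero[of \<sigma>]] by (simp add: mult.commute)
        qed
      qed (use t in auto)
      moreover have "\<phi> t - \<phi> 0 = ?\<Delta> t h k - t\<^sup>2 *\<^sub>R ?A h k"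
        by (simp add: \<phi>_def power2_eq_square algebra_simps)
      ultimately show "norm (?\<Delta> t h k - t\<^sup>2 *\<^sub>R ?A h k) \<le> e * t\<^sup>2"
        using t by (simp add: power2_eq_square mult.assoc)
    qed
  qed
  have "norm (?A h k - ?A k h) \<le> e" if e: "e > 0" for e
  proof -
    have e2: "e / 2 > 0" using e by simp
    obtain d1 where d1: "d1 > 0" "\<And>t. 0 < t \<and> t < d1 \<Longrightarrow> norm (?\<Delta> t h k - t\<^sup>2 *\<^sub>R ?A h k) \<le> e / 2 * t\<^sup>2"
      using key[OF e2, of h k] by auto
    obtain d2 where d2: "d2 > 0" "\<And>t. 0 < t \<and> t < d2 \<Longrightarrow> norm (?\<Delta> t k h - t\<^sup>2 *\<^sub>R ?A k h) \<le> e / 2 * t\<^sup>2"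
      using key[OF e2, of k h] by auto
    define t where "t = min d1 d2 / 2"
    have t: "0 < t \<and> t < d1" "0 < t \<and> t < d2" using d1(1) d2(1) by (auto simp: t_def)
    have "t\<^sup>2 *\<^sub>R (?A h k - ?A k h) = (?\<Delta> t k h - t\<^sup>2 *\<^sub>R ?A k h) - (?\<Delta> t h k - t\<^sup>2 *\<^sub>R ?A h k)"
      by (simp add: algebra_simps)
    then have "norm (t\<^sup>2 *\<^sub>R (?A h k - ?A k h)) \<le> e / 2 * t\<^sup>2 + e / 2 * t\<^sup>2"
      using norm_diff_le[OF d2(2)[OF t(2)] d1(2)[OF t(1)]] by simp
    then have "t\<^sup>2 * norm (?A h k - ?A k h) \<le> t\<^sup>2 * e" by (simp add: mult.commute)
    then show ?thesis using t by (simp add: mult_le_cancel_left_pos)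
  qed
  then have "\<not> 0 < norm (?A h k - ?A k h)" using dense by (metis not_le)
  then show ?thesis by simp
qed

lemma smooth_on_Ck: "smooth_on S f \<Longrightarrow> Ck_on k S f"
  by (simp add: smooth_on_def)

lemma smooth_on_differentiable: "smooth_on S f \<Longrightarrow> x \<in> S \<Longrightarrow> f differentiable (at x)"
  using smooth_on_Ck[of S f "Suc 0"] by simp

lemma smooth_on_FD: "smooth_on S f \<Longrightarrow> smooth_on S (\<lambda>x. FD f x h)"
  unfolding smooth_on_def by (metis Ck_on.simps(2))

lemma smooth_on_continuous: "smooth_on S f \<Longrightarrow> continuous_on S f"
  using smooth_on_Ck[of S f 0] by simp

lemma smooth_on_subset: "smooth_on S f \<Longrightarrow> T \<subseteq> S \<Longrightarrow> smooth_on T f"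
  unfolding smooth_on_def by (blast intro: Ck_on_subset)

lemma smooth_on_cong: "open S \<Longrightarrow> (\<And>x. x \<in> S \<Longrightarrow> f x = g x) \<Longrightarrow> smooth_on S f \<longleftrightarrow> smooth_on S g"
  unfolding smooth_on_def using Ck_on_cong by blast

lemma smooth_on_local:
  "(\<And>x. x \<in> S \<Longrightarrow> \<exists>T. open T \<and> x \<in> T \<and> smooth_on T f) \<Longrightarrow> smooth_on S f"
  unfolding smooth_on_def by (metis Ck_on_local)

lemma smooth_on_const [simp]: "smooth_on S (\<lambda>x. c)"
  by (simp add: smooth_on_def)

lemma smooth_on_id: "open S \<Longrightarrow> smooth_on S (\<lambda>x. x)"
  by (simp add: smooth_on_def Ck_on_id)

lemma smooth_on_bounded_linear:
  "bounded_linear L \<Longrightarrow> open S \<Longrightarrow> smooth_on S f \<Longrightarrow> smooth_on S (\<lambda>x. L (f x))"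
  by (simp add: smooth_on_def Ck_on_bounded_linear)

lemma smooth_on_add: "open S \<Longrightarrow> smooth_on S f \<Longrightarrow> smooth_on S g \<Longrightarrow> smooth_on S (\<lambda>x. f x + g x)"
  by (simp add: smooth_on_def Ck_on_add)

lemma smooth_on_diff: "open S \<Longrightarrow> smooth_on S f \<Longrightarrow> smooth_on S g \<Longrightarrow> smooth_on S (\<lambda>x. f x - g x)"
  by (simp add: smooth_on_def Ck_on_diff)

lemma smooth_on_scaleR:
  "open S \<Longrightarrow> smooth_on S f \<Longrightarrow> smooth_on S g \<Longrightarrow> smooth_on S (\<lambda>x. f x *\<^sub>R g x)"
  by (simp add: smooth_on_def Ck_on_scaleR)

lemma smooth_on_mult:
  fixes f g :: "'a::real_normed_vector \<Rightarrow> real"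
  shows "open S \<Longrightarrow> smooth_on S f \<Longrightarrow> smooth_on S g \<Longrightarrow> smooth_on S (\<lambda>x. f x * g x)"
  by (simp add: smooth_on_def Ck_on_mult)

lemma smooth_on_inner:
  "open S \<Longrightarrow> smooth_on S f \<Longrightarrow> smooth_on S g \<Longrightarrow> smooth_on S (\<lambda>x. f x \<bullet> g x)"
  by (simp add: smooth_on_def Ck_on_inner)

lemma smooth_on_sum:
  "open S \<Longrightarrow> (\<And>i. i \<in> I \<Longrightarrow> smooth_on S (f i)) \<Longrightarrow> smooth_on S (\<lambda>x. \<Sum>i\<in>I. f i x)"
  by (simp add: smooth_on_def Ck_on_sum)

lemma smooth_on_comp:
  fixes g :: "'a::real_normed_vector \<Rightarrow> 'b::euclidean_space"
  shows "open S \<Longrightarrow> g ` S \<subseteq> T \<Longrightarrow> smooth_on T f \<Longrightarrow> smooth_on S g \<Longrightarrow> smooth_on S (\<lambda>x. f (g x))"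
  unfolding smooth_on_def using Ck_on_comp by blast

lemma smooth_on_family:
  fixes X :: "'e::real_normed_vector \<Rightarrow> 'b::euclidean_space"
  shows "open S \<Longrightarrow> (\<And>z. z \<in> S \<Longrightarrow> linear (L z)) \<Longrightarrow> (\<And>b. smooth_on S (\<lambda>z. L z b)) \<Longrightarrow>
    smooth_on S X \<Longrightarrow> smooth_on S (\<lambda>z. L z (X z))"
  unfolding smooth_on_def using Ck_on_family[of S L _ X] by simp

lemma smooth_on_inverse:
  fixes g :: "'a::real_normed_vector \<Rightarrow> real"
  assumes "open S" "smooth_on S g" and nz: "\<And>x. x \<in> S \<Longrightarrow> g x \<noteq> 0"
  shows "smooth_on S (\<lambda>x. inverse (g x))"
proof -
  have "Ck_on k S (\<lambda>x. inverse (g x))" for k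
  proof (induction k)
    case 0
    show ?case using smooth_on_continuous[OF assms(2)] nz by (auto intro: continuous_intros)
  next
    case (Suc k)
    have "Ck_on k S (\<lambda>x. (inverse (g x) * FD g x h) * inverse (g x))" for h
      by (intro Ck_on_mult assms(1) Suc smooth_on_Ck smooth_on_FD assms(2))
    then have *: "Ck_on k S (\<lambda>x. - ((inverse (g x) * FD g x h) * inverse (g x)))" for h
      by (rule Ck_on_minus[OF assms(1)])
    show ?case
    proof (rule Ck_on_SucI[OF assms(1) _ *])
      fix x assume x: "x \<in> S"
      show "((\<lambda>x. inverse (g x)) has_derivative (\<lambda>h. - (inverse (g x) * FD g x h * inverse (g x)))) (at x)"
        by (rule Deriv.has_derivative_inverse[OF nz[OF x] FD_has_derivative[OF smooth_on_differentiable[OF assms(2) x]]])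
    qed
  qed
  then show ?thesis by (simp add: smooth_on_def)
qed

section \<open>Bump functions\<close>

text \<open>The flat functions \<open>inverse t ^ n * exp (- inverse t)\<close>, continued by 0, are
  closed under differentiation up to linear combinations; one induction then makes all of them
  smooth. At 0 the substitution x = 1/h turns the difference quotient into
  \<open>x ^ Suc n / exp x\<close>.\<close>

lemma flat_derivative:
  fixes f :: "nat \<Rightarrow> real \<Rightarrow> real"
  assumes f_def: "f = (\<lambda>n t. if t > 0 then inverse t ^ n * exp (- inverse t) else 0)"
  shows "(f n has_real_derivative f (n + 2) t - n * f (n + 1) t) (at t)"
proof -
  consider "t > 0" | "t < 0" | "t = 0" by linarith
  then show ?thesis
  proof cases
    case 1
    have "((\<lambda>t. inverse t ^ n * exp (- inverse t)) has_real_derivative f (n + 2) t - n * f (n + 1) t) (at t)"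
    proof -
      have d1: "((\<lambda>t. inverse t ^ n) has_real_derivative - (n * inverse t ^ (n + 1))) (at t)"
      proof (cases n)
        case (Suc j)
        then show ?thesis
          using DERIV_power_Suc[OF DERIV_inverse[of t UNIV], of j] 1 by (simp add: algebra_simps)
      qed simp
      have d2: "((\<lambda>t. exp (- inverse t)) has_real_derivative exp (- inverse t) * inverse t ^ 2) (at t)"
        using 1 by (auto intro!: derivative_eq_intros simp: power2_eq_square)
      show ?thesis using DERIV_mult[OF d1 d2] 1 by (simp add: f_def algebra_simps power2_eq_square)
    qed
    then show ?thesis
      by (rule has_field_derivative_transform_within_open[where S = "{0<..}"]) (use 1 in \<open>auto simp: f_def\<close>)
  next
    case 2
    have "((\<lambda>t. 0) has_real_derivative f (n + 2) t - n * f (n + 1) t) (at t)" using 2 by (simp add: f_def)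
    then show ?thesis
      by (rule has_field_derivative_transform_within_open[where S = "{..<0}"]) (use 2 in \<open>auto simp: f_def\<close>)
  next
    case 3
    have "((\<lambda>x::real. x ^ Suc n / exp x) \<longlongrightarrow> 0) at_top" by (rule tendsto_power_div_exp_0)
    then have "((\<lambda>h. inverse h ^ Suc n / exp (inverse h)) \<longlongrightarrow> 0) (at_right (0::real))"
      by (rule filterlim_compose[OF _ filterlim_inverse_at_top_right])
    then have r: "((\<lambda>h. (f n (0 + h) - f n 0) / h) \<longlongrightarrow> 0) (at_right 0)"
      by (rule Lim_transform_eventually)
        (auto simp: f_def eventually_at_right_field exp_minus field_simps intro!: exI[of _ 1])
    have dd: "(f n has_real_derivative D) (at 0) \<longleftrightarrow> ((\<lambda>h. (f n (0 + h) - f n 0) / h) \<longlongrightarrow> D) (at 0)" for D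
      by (rule DERIV_def)
    have l: "((\<lambda>h. (f n (0 + h) - f n 0) / h) \<longlongrightarrow> 0) (at_left 0)"
      by (rule Lim_transform_eventually[OF tendsto_const])
        (auto simp: f_def eventually_at_left_field intro!: exI[of _ "-1"])
    have "(f n has_real_derivative 0) (at 0)" unfolding dd by (rule filterlim_split_at[OF l r])
    moreover have "f (n + 2) t - n * f (n + 1) t = 0" using 3 by (simp add: f_def)
    ultimately show ?thesis using 3 by simp
  qed
qed

lemma smooth_step: "\<exists>\<rho>::real \<Rightarrow> real. smooth_on UNIV \<rho> \<and> (\<forall>t\<le>0. \<rho> t = 0) \<and> (\<forall>t\<ge>1. \<rho> t = 1)"
proof -
  define f :: "nat \<Rightarrow> real \<Rightarrow> real" where f_def: "f = (\<lambda>n t. if t > 0 then inverse t ^ n * exp (- inverse t) else 0)"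
  have "Ck_on k UNIV (f n)" for k n
  proof (induction k arbitrary: n)
    case 0
    have "isCont (f n) t" for t by (rule DERIV_isCont[OF flat_derivative[OF f_def]])
    then show ?case by (simp add: continuous_at_imp_continuous_on)
  next
    case (Suc k)
    show ?case
    proof (rule Ck_on_SucI[OF open_UNIV])
      show "(f n has_derivative (\<lambda>h. (f (n + 2) x - n * f (n + 1) x) * h)) (at x)" for x
        using flat_derivative[OF f_def, of n x] unfolding has_field_derivative_def by simp
      show "Ck_on k UNIV (\<lambda>x. (f (n + 2) x - n * f (n + 1) x) * h)" for h
        by (intro Ck_on_mult Ck_on_diff Ck_on_const Suc open_UNIV)
    qed
  qed
  then have sf: "smooth_on UNIV (f 0)" by (simp add: smooth_on_def)
  have sc: "smooth_on UNIV (\<lambda>t. f 0 (1 - t))"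
    by (rule smooth_on_comp[OF open_UNIV subset_UNIV sf])
      (intro smooth_on_diff smooth_on_const smooth_on_id open_UNIV)
  have pos: "f 0 t + f 0 (1 - t) > 0" for t
    by (cases "t > 0"; cases "1 - t > 0") (auto simp: f_def add_pos_pos)
  \<comment> \<open>The quotient works because \<open>f 0\<close> vanishes to the left of 0 while
    the denominator is positive everywhere.\<close>
  have "smooth_on UNIV (\<lambda>t. f 0 t * inverse (f 0 t + f 0 (1 - t)))"
    by (intro smooth_on_mult smooth_on_inverse smooth_on_add sf sc open_UNIV) (metis pos less_irrefl)
  moreover have "f 0 t * inverse (f 0 t + f 0 (1 - t)) = 0" if "t \<le> 0" for t
    using that by (simp add: f_def)
  moreover have "f 0 t * inverse (f 0 t + f 0 (1 - t)) = 1" if "t \<ge> 1" for t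
    using that by (simp add: f_def)
  ultimately show ?thesis by blast
qed

text \<open>The argument of the step function is 2 minus the squared distance over the squared
  radius: at least 1 on the inner ball and at most -2 outside the outer one. The squared distance is
  used because it is smooth at the centre.\<close>

lemma smooth_bump:
  fixes x0 :: "'e::euclidean_space"
  assumes "r > 0"
  shows "\<exists>b::'e \<Rightarrow> real. smooth_on UNIV b \<and> (\<forall>x\<in>ball x0 r. b x = 1) \<and> (\<forall>x. x \<notin> ball x0 (2 * r) \<longrightarrow> b x = 0)"
proof -
  obtain \<rho> :: "real \<Rightarrow> real" where \<rho>: "smooth_on UNIV \<rho>" "\<forall>t\<le>0. \<rho> t = 0" "\<forall>t\<ge>1. \<rho> t = 1"
    using smooth_step by blast
  let ?b = "\<lambda>x. \<rho> (2 - inverse (r\<^sup>2) * ((x - x0) \<bullet> (x - x0)))"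
  have i: "(x - x0) \<bullet> (x - x0) = (dist x0 x)\<^sup>2" for x
    unfolding dist_norm by (metis norm_minus_commute power2_norm_eq_inner)
  show ?thesis
  proof (intro exI[of _ ?b] conjI ballI allI impI)
    show "smooth_on UNIV ?b"
      by (rule smooth_on_comp[OF open_UNIV subset_UNIV \<rho>(1)])
        (intro smooth_on_diff smooth_on_mult smooth_on_inner smooth_on_const smooth_on_id open_UNIV)
    show "?b x = 1" if "x \<in> ball x0 r" for x
    proof -
      have "(dist x0 x)\<^sup>2 \<le> r\<^sup>2" using that by (intro power_mono) auto
      then have "inverse (r\<^sup>2) * (dist x0 x)\<^sup>2 \<le> 1" using assms by (simp add: field_simps)
      then show ?thesis using \<rho>(3) unfolding i by simp
    qed
    show "?b x = 0" if "x \<notin> ball x0 (2 * r)" for x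
    proof -
      have "(2 * r)\<^sup>2 \<le> (dist x0 x)\<^sup>2" using that assms by (intro power_mono) auto
      then have "4 * r\<^sup>2 \<le> (dist x0 x)\<^sup>2" by (simp add: power_mult_distrib)
      then have "2 * r\<^sup>2 \<le> (dist x0 x)\<^sup>2" using zero_le_power2[of r] by linarith
      then have "inverse (r\<^sup>2) * (dist x0 x)\<^sup>2 \<ge> 2" using assms by (simp add: field_simps)
      then show ?thesis using \<rho>(2) unfolding i by simp
    qed
  qed
qed

section \<open>Bounds and Taylor expansion\<close>

text \<open>Bounds on pairs of basis vectors sum up to a bound uniform in the index. The weight
  \<open>g\<close> is free so that the same lemma gives boundedness, Lipschitz estimates (indexed by
  pairs of points) and Taylor remainders (weight \<open>norm z ^ 3\<close>).\<close>

lemma bilinear_family_bound: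
  fixes F :: "'i \<Rightarrow> 'a::euclidean_space \<Rightarrow> 'b::euclidean_space \<Rightarrow> 'c::real_normed_vector"
  assumes lin: "\<And>i. i \<in> I \<Longrightarrow> bilinear (F i)"
    and bd: "\<And>a b. a \<in> Basis \<Longrightarrow> b \<in> Basis \<Longrightarrow> \<exists>C. \<forall>i\<in>I. norm (F i a b) \<le> C * g i"
    and g: "\<And>i. i \<in> I \<Longrightarrow> 0 \<le> g i"
  shows "\<exists>C\<ge>0. \<forall>i\<in>I. \<forall>a b. norm (F i a b) \<le> C * g i * norm a * norm b"
proof -
  obtain C where C: "\<And>a b i. a \<in> Basis \<Longrightarrow> b \<in> Basis \<Longrightarrow> i \<in> I \<Longrightarrow> norm (F i a b) \<le> C a b * g i"
    using bd by metis
  let ?C = "\<Sum>a\<in>Basis. \<Sum>b\<in>Basis. \<bar>C a b\<bar>"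
  show ?thesis
  proof (intro exI[of _ ?C] conjI ballI allI)
    show "?C \<ge> 0" by (intro sum_nonneg) auto
    fix i a b assume i: "i \<in> I"
    have l1: "linear (\<lambda>x. F i x b)" and l2: "linear (F i x)" for x b
      using lin[OF i] unfolding bilinear_def by auto
    have "F i a b = (\<Sum>x\<in>Basis. (a \<bullet> x) *\<^sub>R F i x b)" by (rule linear_sum_Basis[OF l1])
    also have "\<dots> = (\<Sum>x\<in>Basis. (a \<bullet> x) *\<^sub>R (\<Sum>y\<in>Basis. (b \<bullet> y) *\<^sub>R F i x y))"
      by (subst linear_sum_Basis[OF l2, of _ b]) simp
    finally have e: "F i a b = (\<Sum>x\<in>Basis. (a \<bullet> x) *\<^sub>R (\<Sum>y\<in>Basis. (b \<bullet> y) *\<^sub>R F i x y))" .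
    have "norm (F i a b) \<le> (\<Sum>x\<in>Basis. norm a * (\<Sum>y\<in>Basis. norm b * (\<bar>C x y\<bar> * g i)))"
      unfolding e
    proof (rule sum_norm_le)
      fix x :: 'a assume x: "x \<in> Basis"
      have "norm (\<Sum>y\<in>Basis. (b \<bullet> y) *\<^sub>R F i x y) \<le> (\<Sum>y\<in>Basis. norm b * (\<bar>C x y\<bar> * g i))"
      proof (rule sum_norm_le)
        fix y :: 'b assume y: "y \<in> Basis"
        have "norm (F i x y) \<le> \<bar>C x y\<bar> * g i"
          using C[OF x y i] g[OF i] by (meson abs_ge_self mult_right_mono order_trans)
        then show "norm ((b \<bullet> y) *\<^sub>R F i x y) \<le> norm b * (\<bar>C x y\<bar> * g i)"
          unfolding norm_scaleR by (intro mult_mono Basis_le_norm y) auto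
      qed
      then show "norm ((a \<bullet> x) *\<^sub>R (\<Sum>y\<in>Basis. (b \<bullet> y) *\<^sub>R F i x y)) \<le> norm a * (\<Sum>y\<in>Basis. norm b * (\<bar>C x y\<bar> * g i))"
        unfolding norm_scaleR by (intro mult_mono Basis_le_norm x) auto
    qed
    also have "\<dots> = ?C * g i * norm a * norm b"
      by (simp add: sum_distrib_left sum_distrib_right mult_ac)
    finally show "norm (F i a b) \<le> ?C * g i * norm a * norm b" .
  qed
qed

lemma FD_bound:
  fixes f :: "'e::euclidean_space \<Rightarrow> 'b::real_normed_vector"
  assumes "Ck_on 1 S f" "compact K" "K \<subseteq> S"
  shows "\<exists>C\<ge>0. \<forall>y\<in>K. \<forall>h. norm (FD f y h) \<le> C * norm h"
proof -
  have lin: "linear (FD f y)" if "y \<in> K" for y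
    using assms that by (auto intro!: linear_FD)
  have "\<exists>C. \<forall>y\<in>K. norm (FD f y b) \<le> C" for b
  proof -
    have "continuous_on K (\<lambda>y. FD f y b)" using assms by (auto intro: continuous_on_subset)
    then have "bounded ((\<lambda>y. FD f y b) ` K)" using assms(2) compact_continuous_image compact_imp_bounded by blast
    then show ?thesis by (auto simp: bounded_iff)
  qed
  then obtain C where C: "\<And>b y. y \<in> K \<Longrightarrow> norm (FD f y b) \<le> C b" by metis
  show ?thesis
  proof (intro exI[of _ "\<Sum>b\<in>Basis. \<bar>C b\<bar>"] conjI ballI allI)
    show "0 \<le> (\<Sum>b\<in>Basis. \<bar>C b\<bar>)" by (intro sum_nonneg) auto
    fix y h assume y: "y \<in> K"
    have "norm (FD f y h) = norm (\<Sum>b\<in>Basis. (h \<bullet> b) *\<^sub>R FD f y b)"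
      by (subst linear_sum_Basis[OF lin[OF y]]) simp
    also have "\<dots> \<le> (\<Sum>b\<in>Basis. norm h * \<bar>C b\<bar>)"
    proof (rule sum_norm_le)
      fix b :: 'e assume b: "b \<in> Basis"
      have "norm (FD f y b) \<le> \<bar>C b\<bar>" using C[OF y, of b] by linarith
      then show "norm ((h \<bullet> b) *\<^sub>R FD f y b) \<le> norm h * \<bar>C b\<bar>"
        unfolding norm_scaleR by (intro mult_mono Basis_le_norm b) auto
    qed
    finally show "norm (FD f y h) \<le> (\<Sum>b\<in>Basis. \<bar>C b\<bar>) * norm h" by (simp add: sum_distrib_left mult.commute)
  qed
qed

lemma differentiable_bound_FD:
  assumes "convex K" "\<And>x. x \<in> K \<Longrightarrow> f differentiable (at x)"
    and "\<And>x h. x \<in> K \<Longrightarrow> norm (FD f x h) \<le> C * norm h" "x \<in> K" "y \<in> K" "0 \<le> C"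
  shows "norm (f x - f y) \<le> C * norm (x - y)"
proof (rule differentiable_bound[OF assms(1) _ _ assms(4,5)])
  show "(f has_derivative FD f x) (at x within K)" if "x \<in> K" for x
    using has_derivative_at_withinI[OF FD_has_derivative[OF assms(2)[OF that]]] .
  show "onorm (FD f x) \<le> C" if "x \<in> K" for x
    using assms(3)[OF that] assms(6) by (rule onorm_bound[rotated])
qed

lemma Ck_on_Lipschitz:
  fixes f :: "'e::euclidean_space \<Rightarrow> 'b::real_normed_vector"
  assumes "Ck_on 1 S f" "compact K" "K \<subseteq> S" "convex K"
  shows "\<exists>C\<ge>0. \<forall>x\<in>K. \<forall>y\<in>K. norm (f x - f y) \<le> C * norm (x - y)"
proof -
  obtain C where C: "C \<ge> 0" "\<forall>y\<in>K. \<forall>h. norm (FD f y h) \<le> C * norm h"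
    using FD_bound[OF assms(1-3)] by blast
  show ?thesis
    using C assms(1,3) by (intro exI[of _ C] conjI ballI differentiable_bound_FD[OF assms(4)]) auto
qed

text \<open>One application of the mean value inequality on the ball of radius
  \<open>norm z\<close>, raising the order of vanishing by one.\<close>

lemma bound_from_FD:
  fixes f :: "'e::euclidean_space \<Rightarrow> 'b::real_normed_vector"
  assumes "\<And>y. norm y \<le> s \<Longrightarrow> f differentiable (at y)" "C \<ge> 0"
    and "\<And>y h. norm y \<le> s \<Longrightarrow> norm (FD f y h) \<le> C * norm y ^ n * norm h" "norm z \<le> s"
  shows "norm (f z - f 0) \<le> C * norm z ^ Suc n"
proof -
  have "norm (f z - f 0) \<le> (C * norm z ^ n) * norm (z - 0)"
  proof (rule differentiable_bound_FD[of "cball 0 (norm z)"])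
    fix y h assume y: "y \<in> cball (0::'e) (norm z)"
    then have "norm (FD f y h) \<le> C * norm y ^ n * norm h" using assms(3,4) by simp
    also have "\<dots> \<le> C * norm z ^ n * norm h"
      using y assms(2) by (intro mult_right_mono mult_left_mono power_mono) auto
    finally show "norm (FD f y h) \<le> C * norm z ^ n * norm h" .
  qed (use assms in auto)
  then show ?thesis by (simp add: mult_ac)
qed

text \<open>The second derivative is Lipschitz on the closed ball; applying
  \<open>bound_from_FD\<close> twice raises the order from one to three. Symmetry of the second
  derivative is needed to recognize the derivative of the quadratic term.\<close>

lemma Taylor_third_order:
  fixes f :: "'e::euclidean_space \<Rightarrow> 'b::real_normed_vector"
  assumes f: "smooth_on (ball 0 r) f" and s: "0 < s" "s < r"
  shows "\<exists>C. \<forall>z. norm z \<le> s \<longrightarrow>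
    norm (f z - f 0 - FD f 0 z - (1/2) *\<^sub>R FD (\<lambda>y. FD f y z) 0 z) \<le> C * norm z ^ 3"
proof -
  let ?A = "\<lambda>x h k. FD (\<lambda>y. FD f y k) x h"
  have d0: "f differentiable (at y)" and d1: "(\<lambda>y. FD f y k) differentiable (at y)"
    and d2: "(\<lambda>y. ?A y h k) differentiable (at y)" if "norm y < r" for y h k
    using f that by (auto intro!: smooth_on_differentiable[of "ball 0 r"] smooth_on_FD)
  have lf: "linear (FD f y)" if "norm y < r" for y by (rule linear_FD[OF d0[OF that]])
  have bil: "bilinear (?A y)" if "norm y < r" for y
    unfolding bilinear_def
    using linear_FD[OF d1[OF that]] linear_FD_arg[of "ball 0 r" y "FD f"] that lf d1[OF that] by auto
  have "\<exists>C\<ge>0. \<forall>y\<in>cball 0 s. \<forall>h k. norm (?A y h k - ?A 0 h k) \<le> C * norm y * norm h * norm k"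
  proof (rule bilinear_family_bound)
    fix y :: 'e assume "y \<in> cball 0 s"
    then show "bilinear (\<lambda>h k. ?A y h k - ?A 0 h k)"
      using bil[of y] bil[of 0] s unfolding bilinear_def by (auto intro!: linear_compose_sub)
  next
    fix h k :: 'e
    have "Ck_on 1 (ball 0 r) (\<lambda>y. ?A y h k)" using f by (intro smooth_on_Ck smooth_on_FD)
    moreover have "cball 0 s \<subseteq> ball (0::'e) r" using s by (auto simp: subset_iff)
    ultimately obtain C where
      C: "\<forall>x\<in>cball 0 s. \<forall>y\<in>cball 0 s. norm (?A x h k - ?A y h k) \<le> C * norm (x - y)"
      using Ck_on_Lipschitz[of "ball 0 r" "\<lambda>y. ?A y h k" "cball 0 s"] by auto
    show "\<exists>C. \<forall>y\<in>cball 0 s. norm (?A y h k - ?A 0 h k) \<le> C * norm y"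
      using C[rule_format, of _ 0] s by (intro exI[of _ C]) auto
  qed auto
  then obtain C where C: "C \<ge> 0"
    and A: "\<And>y h k. norm y \<le> s \<Longrightarrow> norm (?A y h k - ?A 0 h k) \<le> C * norm y * norm h * norm k"
    by auto
  have "0 < r" using s by simp
  note b0 = bil[of 0, simplified, OF this, unfolded bilinear_def]
  have lA: "linear (\<lambda>h. ?A 0 h k)" "linear (?A 0 h)" for h k using b0 by auto
  have bl1: "bounded_linear (\<lambda>h. ?A 0 h k)" for k using lA(1) by (simp add: linear_conv_bounded_linear)
  have B: "norm (FD f z k - FD f 0 k - ?A 0 z k) \<le> (C * norm k) * norm z ^ 2" if "norm z \<le> s" for z k
  proof -
    have D: "((\<lambda>y. FD f y k - ?A 0 y k) has_derivative (\<lambda>h. ?A y h k - ?A 0 h k)) (at y)" if "norm y \<le> s" for y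
      using that s by (intro has_derivative_diff FD_has_derivative d1 bounded_linear_imp_has_derivative bl1) auto
    have "norm ((FD f z k - ?A 0 z k) - (FD f 0 k - ?A 0 0 k)) \<le> (C * norm k) * norm z ^ Suc 1"
    proof (rule bound_from_FD[where s = s and f = "\<lambda>y. FD f y k - ?A 0 y k"])
      fix y h :: 'e assume y: "norm y \<le> s"
      show "(\<lambda>y. FD f y k - ?A 0 y k) differentiable (at y)" using D[OF y] by (rule differentiableI)
      show "norm (FD (\<lambda>y. FD f y k - ?A 0 y k) y h) \<le> C * norm k * norm y ^ 1 * norm h"
        using A[OF y, where h = h and k = k] unfolding FD_I[OF D[OF y]] by (simp add: mult_ac)
    qed (use C that in auto)
    then show ?thesis using linear_0[OF lA(1)] by (simp add: numeral_2_eq_2 algebra_simps)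
  qed
  have sym: "?A 0 h k = ?A 0 k h" for h k
    using symmetric_second_derivative[OF smooth_on_Ck[OF f], of 0 k h] \<open>0 < r\<close> by simp
  have "norm (f z - f 0 - FD f 0 z - (1/2) *\<^sub>R ?A 0 z z) \<le> C * norm z ^ 3" if z: "norm z \<le> s" for z
  proof -
    let ?\<psi> = "\<lambda>y. f y - FD f 0 y - (1/2) *\<^sub>R ?A 0 y y"
    have bb: "bounded_bilinear (?A 0)" using bil[of 0] \<open>0 < r\<close> by (simp add: bilinear_conv_bounded_bilinear)
    have D: "(?\<psi> has_derivative (\<lambda>h. FD f y h - FD f 0 h - ?A 0 y h)) (at y)" if "norm y \<le> s" for y
    proof -
      have "(?\<psi> has_derivative (\<lambda>h. FD f y h - FD f 0 h - (1/2) *\<^sub>R (?A 0 y h + ?A 0 h y))) (at y)"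
        using that s lf[of 0]
        by (intro has_derivative_diff has_derivative_scaleR_right bounded_bilinear.FDERIV[OF bb] has_derivative_ident
            FD_has_derivative d0 bounded_linear_imp_has_derivative) (auto simp: linear_conv_bounded_linear)
      moreover have "(1/2) *\<^sub>R (?A 0 y h + ?A 0 h y) = ?A 0 y h" for h
        using sym[of h y] by (simp flip: scaleR_2)
      ultimately show ?thesis by simp
    qed
    have "norm (?\<psi> z - ?\<psi> 0) \<le> C * norm z ^ Suc 2"
    proof (rule bound_from_FD[where s = s and f = ?\<psi>])
      fix y h :: 'e assume y: "norm y \<le> s"
      show "?\<psi> differentiable (at y)" using D[OF y] by (rule differentiableI)
      show "norm (FD ?\<psi> y h) \<le> C * norm y ^ 2 * norm h"
        using B[OF y, of h] unfolding FD_I[OF D[OF y]] by (simp add: mult_ac)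
    qed (use C z in auto)
    then show ?thesis
      using linear_0[OF lf[of 0]] linear_0[OF lA(1)] \<open>0 < r\<close> by (simp add: numeral_3_eq_3 numeral_2_eq_2 algebra_simps)
  qed
  then show ?thesis by blast
qed

section \<open>Differential equations\<close>

text \<open>To the right of \<open>c\<close> the squared norm weighted by
  \<open>exp (- 2 * K * t)\<close> does not increase; to its left the one weighted by
  \<open>exp (2 * K * t)\<close> does not decrease. An interior \<open>c\<close> is needed for the
  local uniqueness of geodesics.\<close>

lemma Gronwall_zero:
  fixes f :: "real \<Rightarrow> 'e::real_inner"
  assumes D: "\<And>t. t \<in> {a..b} \<Longrightarrow> (f has_vector_derivative f' t) (at t within {a..b})"
    and K: "\<And>t. t \<in> {a..b} \<Longrightarrow> norm (f' t) \<le> K * norm (f t)"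
    and "c \<in> {a..b}" "f c = 0" "t \<in> {a..b}"
  shows "f t = 0"
proof -
  have D\<phi>: "((\<lambda>t. exp (\<kappa> * t) * (f t \<bullet> f t)) has_derivative
      (\<lambda>h. h * (exp (\<kappa> * t) * (\<kappa> * (f t \<bullet> f t) + 2 * (f t \<bullet> f' t))))) (at t within S)"
    if "t \<in> {a..b}" "S \<subseteq> {a..b}" for \<kappa> t S
    using has_derivative_subset[OF D[OF that(1), unfolded has_vector_derivative_def] that(2)]
    by (auto intro!: derivative_eq_intros simp: algebra_simps inner_commute)
  have bd: "\<bar>2 * (f t \<bullet> f' t)\<bar> \<le> (2 * K) * (f t \<bullet> f t)" if "t \<in> {a..b}" for t
  proof -
    have "\<bar>f t \<bullet> f' t\<bar> \<le> norm (f t) * norm (f' t)" by (rule Cauchy_Schwarz_ineq2)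
    also have "\<dots> \<le> norm (f t) * (K * norm (f t))" by (intro mult_left_mono K that) auto
    finally show ?thesis by (simp add: power2_norm_eq_inner[symmetric] power2_eq_square abs_mult algebra_simps)
  qed
  have "f t \<bullet> f t \<le> 0"
  proof (cases "c \<le> t")
    case True
    have sub: "{c..t} \<subseteq> {a..b}" using assms by auto
    obtain s where s: "s \<in> {c..t}" and e: "exp (- 2 * K * t) * (f t \<bullet> f t) - exp (- 2 * K * c) * (f c \<bullet> f c) =
       (t - c) * (exp (- 2 * K * s) * (- 2 * K * (f s \<bullet> f s) + 2 * (f s \<bullet> f' s)))"
      using mvt_very_simple[OF True D\<phi>[where \<kappa> = "- 2 * K", OF subsetD[OF sub] sub]] by auto
    have "- 2 * K * (f s \<bullet> f s) + 2 * (f s \<bullet> f' s) \<le> 0" using bd[of s] s sub by auto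
    then have "(t - c) * (exp (- 2 * K * s) * (- 2 * K * (f s \<bullet> f s) + 2 * (f s \<bullet> f' s))) \<le> 0"
      using True by (intro mult_nonneg_nonpos) auto
    then have "exp (- 2 * K * t) * (f t \<bullet> f t) \<le> 0" using e assms(4) by simp
    then show ?thesis by (simp add: mult_le_0_iff)
  next
    case False
    then have ct: "t \<le> c" by simp
    have sub: "{t..c} \<subseteq> {a..b}" using assms by auto
    obtain s where s: "s \<in> {t..c}" and e: "exp (2 * K * c) * (f c \<bullet> f c) - exp (2 * K * t) * (f t \<bullet> f t) =
       (c - t) * (exp (2 * K * s) * (2 * K * (f s \<bullet> f s) + 2 * (f s \<bullet> f' s)))"
      using mvt_very_simple[OF ct D\<phi>[where \<kappa> = "2 * K", OF subsetD[OF sub] sub]] by auto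
    have "2 * K * (f s \<bullet> f s) + 2 * (f s \<bullet> f' s) \<ge> 0" using bd[of s] s sub by auto
    then have "(c - t) * (exp (2 * K * s) * (2 * K * (f s \<bullet> f s) + 2 * (f s \<bullet> f' s))) \<ge> 0"
      using ct by (intro mult_nonneg_nonneg) auto
    then have "exp (2 * K * t) * (f t \<bullet> f t) \<le> 0" using e assms(4) by simp
    then show ?thesis by (simp add: mult_le_0_iff)
  qed
  then show ?thesis by (metis inner_gt_zero_iff not_le)
qed

text \<open>The iterates form a telescoping series dominated by a geometric one, hence converge
  uniformly. The contraction is stated through an arbitrary common bound \<open>d\<close>, which
  avoids suprema over the interval.\<close>

lemma Picard_fixed_point:
  fixes \<Phi> :: "(real \<Rightarrow> 'e::banach) \<Rightarrow> real \<Rightarrow> 'e" and B :: real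
  assumes adm_def: "\<And>w. adm w \<longleftrightarrow> continuous_on {0..1} w \<and> (\<forall>t\<in>{0..1}. norm (w t) \<le> B)"
  assumes B: "0 \<le> B" and adm: "\<And>w. adm w \<Longrightarrow> adm (\<Phi> w)"
    and contr: "\<And>w w' d. adm w \<Longrightarrow> adm w' \<Longrightarrow> (\<And>t. t \<in> {0..1} \<Longrightarrow> norm (w t - w' t) \<le> d) \<Longrightarrow>
       (\<And>t. t \<in> {0..1} \<Longrightarrow> norm (\<Phi> w t - \<Phi> w' t) \<le> d / 2)"
  shows "\<exists>w. adm w \<and> (\<forall>t\<in>{0..1}. w t = \<Phi> w t)"
proof -
  define w where "w = (\<lambda>n. (\<Phi> ^^ n) (\<lambda>_. 0))"
  have w0: "w 0 = (\<lambda>_. 0)" and wS: "w (Suc n) = \<Phi> (w n)" for n by (auto simp: w_def)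
  have aw: "adm (w n)" for n
  proof (induction n)
    case 0
    show ?case unfolding w0 using B by (simp add: adm_def)
  next
    case (Suc n)
    then show ?case unfolding wS by (rule adm)
  qed
  have step: "norm (w (Suc n) t - w n t) \<le> B * (1/2) ^ n" if "t \<in> {0..1}" for n t
    using that
  proof (induction n arbitrary: t)
    case 0
    then show ?case using aw[of "Suc 0"] by (simp add: w0 adm_def)
  next
    case (Suc n)
    then show ?case
      using contr[OF aw aw Suc.IH Suc.prems] unfolding wS[of "Suc n"] by (simp add: wS[symmetric])
  qed
  have tele: "(\<Sum>i<n. w (Suc i) t - w i t) = w n t" for n t
    using sum_lessThan_telescope[of "\<lambda>i. w i t" n] by (simp add: w0)
  have "uniform_limit {0..1} (\<lambda>n t. \<Sum>i<n. w (Suc i) t - w i t) (\<lambda>t. \<Sum>i. w (Suc i) t - w i t) sequentially"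
    by (rule Weierstrass_m_test[OF step]) (auto intro!: summable_mult summable_geometric)
  then have "uniform_limit {0..1} w (\<lambda>t. \<Sum>i. w (Suc i) t - w i t) sequentially"
    unfolding tele .
  then obtain v where v: "uniform_limit {0..1} w v sequentially" by blast
  have "continuous_on {0..1} v"
    by (rule uniform_limit_theorem[OF _ v]) (use aw in \<open>auto simp: adm_def\<close>)
  moreover have "norm (v t) \<le> B" if "t \<in> {0..1}" for t
    by (rule Lim_norm_ubound[OF _ tendsto_uniform_limitI[OF v that]])
      (use aw that in \<open>auto simp: adm_def\<close>)
  ultimately have av: "adm v" by (simp add: adm_def)
  have "norm (v t - \<Phi> v t) \<le> e" if t: "t \<in> {0..1}" and e: "e > 0" for t e
  proof -
    have "\<forall>\<^sub>F n in sequentially. \<forall>t\<in>{0..1}. dist (w n t) (v t) < e / 2"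
      using uniform_limitD[OF v, of "e / 2"] e by simp
    then obtain n where n: "\<And>m t. m \<ge> n \<Longrightarrow> t \<in> {0..1} \<Longrightarrow> norm (w m t - v t) < e / 2"
      unfolding eventually_sequentially dist_norm by blast
    have "norm (\<Phi> (w n) t - \<Phi> v t) \<le> (e / 2) / 2"
      by (rule contr[OF aw av _ t]) (use n[of n] in \<open>auto intro: less_imp_le\<close>)
    moreover have "norm (\<Phi> (w n) t - v t) \<le> e / 2" using n[of "Suc n" t] t unfolding wS by simp
    ultimately have "norm ((\<Phi> (w n) t - \<Phi> v t) - (\<Phi> (w n) t - v t)) \<le> e / 2 / 2 + e / 2"
      by (rule norm_diff_le)
    then show ?thesis using e by simp
  qed
  then have "\<not> 0 < norm (v t - \<Phi> v t)" if "t \<in> {0..1}" for t using that dense by (metis not_le)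
  then have "v t = \<Phi> v t" if "t \<in> {0..1}" for t using that by fastforce
  then show ?thesis using av by blast
qed

section \<open>Charts and tangent vectors\<close>

lemma sum_fun_apply: "(\<Sum>i\<in>I. F i) x = (\<Sum>i\<in>I. F i x)"
  for F :: "'i \<Rightarrow> 'a \<Rightarrow> 'b::comm_monoid_add"
  by (induction I rule: infinite_finite_induct) (auto simp: zero_fun_def plus_fun_def)

locale atlas =
  fixes A :: "('a::{t2_space, second_countable_topology}, 'e::euclidean_space) chart set"
  assumes atlas: "smooth_atlas A"
begin

abbreviation tr :: "('a, 'e) chart \<Rightarrow> ('a, 'e) chart \<Rightarrow> 'e \<Rightarrow> 'e" where
  "tr c d \<equiv> cmap d \<circ> cinv c"

text \<open>The domain of the chart change \<open>tr c d\<close>. The preimage form gives openness;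
  \<open>ov_eq\<close> gives the image form used in \<open>smooth_atlas\<close>.\<close>

definition ov :: "('a, 'e) chart \<Rightarrow> ('a, 'e) chart \<Rightarrow> 'e set" where
  "ov c d = {y \<in> cimage c. cinv c y \<in> cdom d}"

text \<open>The tangent vector at \<open>x\<close> whose component in the chart \<open>c\<close> is
  \<open>a\<close>; the remaining components are forced.\<close>

definition tv :: "('a, 'e) chart \<Rightarrow> 'a \<Rightarrow> 'e \<Rightarrow> ('a, 'e) tvec" where
  "tv c x a = (\<lambda>d. if d \<in> A \<and> x \<in> cdom d then FD (tr c d) (cmap c x) a else 0)"

lemma chart:
  assumes "c \<in> A"
  shows open_cdom: "open (cdom c)" and open_cimage: "open (cimage c)"
    and cinv_cmap: "\<And>x. x \<in> cdom c \<Longrightarrow> cinv c (cmap c x) = x"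
    and cmap_cinv: "\<And>y. y \<in> cimage c \<Longrightarrow> cmap c (cinv c y) = y"
    and cinv_in: "\<And>y. y \<in> cimage c \<Longrightarrow> cinv c y \<in> cdom c"
    and cont_cmap: "continuous_on (cdom c) (cmap c)"
    and cont_cinv: "continuous_on (cimage c) (cinv c)"
proof -
  have "open (cdom c) \<and> open (cimage c) \<and> homeomorphism (cdom c) (cimage c) (cmap c) (cinv c)"
    using atlas assms unfolding smooth_atlas_def by blast
  then show "open (cdom c)" "open (cimage c)"
    "\<And>x. x \<in> cdom c \<Longrightarrow> cinv c (cmap c x) = x" "\<And>y. y \<in> cimage c \<Longrightarrow> cmap c (cinv c y) = y"
    "\<And>y. y \<in> cimage c \<Longrightarrow> cinv c y \<in> cdom c" "continuous_on (cdom c) (cmap c)" "continuous_on (cimage c) (cinv c)"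
    by (auto simp: homeomorphism_def)
qed

lemma ov_subset: "ov c d \<subseteq> cimage c"
  by (auto simp: ov_def)

lemma cmap_in_ov: "c \<in> A \<Longrightarrow> x \<in> cdom c \<Longrightarrow> x \<in> cdom d \<Longrightarrow> cmap c x \<in> ov c d"
  by (auto simp: ov_def cinv_cmap)

lemma ov_eq: "c \<in> A \<Longrightarrow> ov c d = cmap c ` (cdom c \<inter> cdom d)"
  by (auto simp: ov_def cinv_cmap)

lemma open_ov:
  assumes "c \<in> A" "d \<in> A"
  shows "open (ov c d)"
proof -
  have "open (cimage c \<inter> cinv c -` cdom d)"
    by (rule continuous_open_preimage[OF cont_cinv[OF assms(1)] open_cimage[OF assms(1)] open_cdom[OF assms(2)]])
  also have "cimage c \<inter> cinv c -` cdom d = ov c d" by (auto simp: ov_def)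
  finally show ?thesis .
qed

lemma smooth_tr: "c \<in> A \<Longrightarrow> d \<in> A \<Longrightarrow> smooth_on (ov c d) (tr c d)"
  using atlas unfolding smooth_atlas_def ov_eq by blast

lemma tr_differentiable: "c \<in> A \<Longrightarrow> d \<in> A \<Longrightarrow> y \<in> ov c d \<Longrightarrow> tr c d differentiable (at y)"
  using smooth_on_differentiable smooth_tr by blast

lemma tr_in_ov: "c \<in> A \<Longrightarrow> d \<in> A \<Longrightarrow> y \<in> ov c d \<Longrightarrow> tr c d y \<in> ov d c"
  by (auto simp: ov_def cinv_cmap cinv_in)

lemma cinv_tr: "d \<in> A \<Longrightarrow> y \<in> ov c d \<Longrightarrow> cinv d (tr c d y) = cinv c y"
  by (auto simp: ov_def cinv_cmap)

lemma tr_tr: "c \<in> A \<Longrightarrow> d \<in> A \<Longrightarrow> y \<in> ov c d \<Longrightarrow> tr d e (tr c d y) = tr c e y"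
  by (auto simp: ov_def cinv_cmap)

lemma tr_self: "c \<in> A \<Longrightarrow> y \<in> cimage c \<Longrightarrow> tr c c y = y"
  by (simp add: cmap_cinv)

lemma FD_tr_tr:
  assumes "c \<in> A" "d \<in> A" "e \<in> A" "y \<in> ov c d" "y \<in> ov c e"
  shows "FD (tr c e) y h = FD (tr d e) (tr c d y) (FD (tr c d) y h)"
proof -
  have in': "tr c d y \<in> ov d e" using assms by (auto simp: ov_def cinv_cmap)
  have "((\<lambda>y. tr d e (tr c d y)) has_derivative (\<lambda>h. FD (tr d e) (tr c d y) (FD (tr c d) y h))) (at y)"
    using assms in' by (intro FD_comp tr_differentiable)
  then have "(tr c e has_derivative (\<lambda>h. FD (tr d e) (tr c d y) (FD (tr c d) y h))) (at y)"
    by (rule has_derivative_transform_within_open[where s = "ov c d"])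
      (use assms open_ov tr_tr in auto)
  then show ?thesis by (simp add: FD_I)
qed

lemma FD_tr_self: "c \<in> A \<Longrightarrow> y \<in> cimage c \<Longrightarrow> FD (tr c c) y h = h"
  using FD_cong[OF open_cimage, of c y "tr c c" "\<lambda>y. y"] tr_self by simp

lemma linear_FD_tr: "c \<in> A \<Longrightarrow> d \<in> A \<Longrightarrow> y \<in> ov c d \<Longrightarrow> linear (FD (tr c d) y)"
  by (intro linear_FD tr_differentiable)

lemma tangentI:
  assumes "\<And>c d. c \<in> A \<Longrightarrow> d \<in> A \<Longrightarrow> x \<in> cdom c \<Longrightarrow> x \<in> cdom d \<Longrightarrow> v d = FD (tr c d) (cmap c x) (v c)"
    and "\<And>c. \<not> (c \<in> A \<and> x \<in> cdom c) \<Longrightarrow> v c = 0"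
  shows "v \<in> tangent_space A x"
  using assms unfolding tangent_space_def by blast

lemma tangentD:
  assumes "v \<in> tangent_space A x" "c \<in> A" "d \<in> A" "x \<in> cdom c" "x \<in> cdom d"
  shows "v d = FD (tr c d) (cmap c x) (v c)"
  using assms unfolding tangent_space_def by blast

lemma tangent_zero: "v \<in> tangent_space A x \<Longrightarrow> \<not> (c \<in> A \<and> x \<in> cdom c) \<Longrightarrow> v c = 0"
  unfolding tangent_space_def by blast

lemma tv_apply [simp]: "c \<in> A \<Longrightarrow> x \<in> cdom c \<Longrightarrow> tv c x a c = a"
  by (simp add: tv_def FD_tr_self)

lemma tv_tangent:
  assumes "c \<in> A" "x \<in> cdom c"
  shows "tv c x a \<in> tangent_space A x"
proof -
  have F: "FD (tr c e) (cmap c x) a = FD (tr d e) (cmap d x) (FD (tr c d) (cmap c x) a)"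
    if "d \<in> A" "e \<in> A" "x \<in> cdom d" "x \<in> cdom e" for d e
    using FD_tr_tr[of c d e "cmap c x" a] assms that cmap_in_ov by (simp add: cinv_cmap)
  have t: "tv c x a d = FD (tr c d) (cmap c x) a" if "d \<in> A" "x \<in> cdom d" for d
    using that by (simp add: tv_def)
  show ?thesis
  proof (rule tangentI)
    fix d e assume de: "d \<in> A" "e \<in> A" "x \<in> cdom d" "x \<in> cdom e"
    show "tv c x a e = FD (tr d e) (cmap d x) (tv c x a d)"
      unfolding t[OF de(1,3)] t[OF de(2,4)] by (rule F[OF de])
  next
    show "tv c x a d = 0" if "\<not> (d \<in> A \<and> x \<in> cdom d)" for d
      using that unfolding tv_def by (rule if_not_P)
  qed
qed

lemma tangent_tv:
  assumes "v \<in> tangent_space A x" "c \<in> A" "x \<in> cdom c"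
  shows "tv c x (v c) = v"
proof
  show "tv c x (v c) d = v d" for d
    using tangentD[OF assms(1,2) _ assms(3), of d] tangent_zero[OF assms(1), of d] unfolding tv_def by argo
qed

lemma tangent_eqI:
  assumes "v \<in> tangent_space A x" "w \<in> tangent_space A x" "c \<in> A" "x \<in> cdom c" "v c = w c"
  shows "v = w"
  using tangent_tv[OF assms(1,3,4)] tangent_tv[OF assms(2,3,4)] assms(5) by metis

lemma tangent_add: "v \<in> tangent_space A x \<Longrightarrow> w \<in> tangent_space A x \<Longrightarrow> v + w \<in> tangent_space A x"
proof (rule tangentI)
  assume vw: "v \<in> tangent_space A x" "w \<in> tangent_space A x"
  show "(v + w) c = 0" if "\<not> (c \<in> A \<and> x \<in> cdom c)" for c
    using vw[THEN tangent_zero, OF that] by (simp add: plus_fun_def)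
  fix c d assume cd: "c \<in> A" "d \<in> A" "x \<in> cdom c" "x \<in> cdom d"
  show "(v + w) d = FD (tr c d) (cmap c x) ((v + w) c)"
    using vw[THEN tangentD, OF cd] linear_add[OF linear_FD_tr[OF cd(1,2) cmap_in_ov[OF cd(1,3,4)]]]
    by (simp only: plus_fun_def)
qed

lemma tangent_scaleR: "v \<in> tangent_space A x \<Longrightarrow> r *\<^sub>R v \<in> tangent_space A x"
proof (rule tangentI)
  assume v: "v \<in> tangent_space A x"
  show "(r *\<^sub>R v) c = 0" if "\<not> (c \<in> A \<and> x \<in> cdom c)" for c
    using v[THEN tangent_zero, OF that] by (simp add: scaleR_fun_def)
  fix c d assume cd: "c \<in> A" "d \<in> A" "x \<in> cdom c" "x \<in> cdom d"
  show "(r *\<^sub>R v) d = FD (tr c d) (cmap c x) ((r *\<^sub>R v) c)"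
    using v[THEN tangentD, OF cd] linear_scale[OF linear_FD_tr[OF cd(1,2) cmap_in_ov[OF cd(1,3,4)]]]
    by (simp only: scaleR_fun_def)
qed

lemma tangent_minus: "v \<in> tangent_space A x \<Longrightarrow> - v \<in> tangent_space A x"
  using tangent_scaleR[of v x "-1"] by simp

lemma tangent_0: "0 \<in> tangent_space A x"
  by (rule tangentI) (simp_all add: zero_fun_def linear_0[OF linear_FD_tr[OF _ _ cmap_in_ov]])

lemma tangent_diff: "v \<in> tangent_space A x \<Longrightarrow> w \<in> tangent_space A x \<Longrightarrow> v - w \<in> tangent_space A x"
  using tangent_add[OF _ tangent_minus, of v x w] by simp

lemma tangent_sum: "(\<And>i. i \<in> I \<Longrightarrow> v i \<in> tangent_space A x) \<Longrightarrow> (\<Sum>i\<in>I. v i) \<in> tangent_space A x"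
  by (induction I rule: infinite_finite_induct) (auto intro: tangent_0 tangent_add)

lemma tv_add: "c \<in> A \<Longrightarrow> x \<in> cdom c \<Longrightarrow> tv c x (a + b) = tv c x a + tv c x b"
  by (rule tangent_eqI[OF tv_tangent tangent_add]) (auto intro: tv_tangent simp: plus_fun_def)

lemma tv_scaleR: "c \<in> A \<Longrightarrow> x \<in> cdom c \<Longrightarrow> tv c x (r *\<^sub>R a) = r *\<^sub>R tv c x a"
  by (rule tangent_eqI[OF tv_tangent tangent_scaleR]) (auto intro: tv_tangent simp: scaleR_fun_def)

section \<open>Smooth functions and vector fields\<close>

lemma smooth_funD: "smooth_fun A f \<Longrightarrow> c \<in> A \<Longrightarrow> smooth_on (cimage c) (\<lambda>y. f (cinv c y))"
  unfolding smooth_fun_def o_def by blast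

lemma smooth_vfieldsD:
  assumes "X \<in> smooth_vfields A"
  shows "X x \<in> tangent_space A x" "c \<in> A \<Longrightarrow> smooth_on (cimage c) (vrep c X)"
  using assms unfolding smooth_vfields_def by auto

lemma smooth_vfieldsI:
  assumes "\<And>x. X x \<in> tangent_space A x" "\<And>c. c \<in> A \<Longrightarrow> smooth_on (cimage c) (vrep c X)"
  shows "X \<in> smooth_vfields A"
  using assms unfolding smooth_vfields_def by auto

lemma vrep_differentiable:
  "X \<in> smooth_vfields A \<Longrightarrow> c \<in> A \<Longrightarrow> y \<in> cimage c \<Longrightarrow> vrep c X differentiable (at y)"
  using smooth_on_differentiable smooth_vfieldsD(2) by blast

lemma vfields_add: "X \<in> smooth_vfields A \<Longrightarrow> Y \<in> smooth_vfields A \<Longrightarrow> X + Y \<in> smooth_vfields A"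
proof (rule smooth_vfieldsI)
  assume XY: "X \<in> smooth_vfields A" "Y \<in> smooth_vfields A"
  show "(X + Y) x \<in> tangent_space A x" for x
    using XY by (simp add: plus_fun_def[of X Y] tangent_add smooth_vfieldsD)
  show "smooth_on (cimage c) (vrep c (X + Y))" if "c \<in> A" for c
    using smooth_on_add[OF open_cimage smooth_vfieldsD(2) smooth_vfieldsD(2)] XY that
    by (simp add: vrep_def[abs_def] plus_fun_def)
qed

lemma vfields_scale:
  assumes f: "smooth_fun A f" and X: "X \<in> smooth_vfields A"
  shows "(\<lambda>x. f x *\<^sub>R X x) \<in> smooth_vfields A"
proof (rule smooth_vfieldsI)
  show "f x *\<^sub>R X x \<in> tangent_space A x" for x
    by (rule tangent_scaleR[OF smooth_vfieldsD(1)[OF X]])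
  show "smooth_on (cimage c) (vrep c (\<lambda>x. f x *\<^sub>R X x))" if c: "c \<in> A" for c
  proof -
    have "smooth_on (cimage c) (\<lambda>y. f (cinv c y) *\<^sub>R vrep c X y)"
      using f c by (intro smooth_on_scaleR open_cimage smooth_vfieldsD(2)[OF X] smooth_funD)
    then show ?thesis by (simp add: vrep_def[abs_def] scaleR_fun_def)
  qed
qed

lemma smooth_fun_const: "smooth_fun A (\<lambda>x. r)"
  by (simp add: smooth_fun_def o_def)

lemma vfields_scaleR: "X \<in> smooth_vfields A \<Longrightarrow> r *\<^sub>R X \<in> smooth_vfields A"
  using vfields_scale[OF smooth_fun_const, of X r] by (simp add: scaleR_fun_def[abs_def])

lemma vfields_diff: "X \<in> smooth_vfields A \<Longrightarrow> Y \<in> smooth_vfields A \<Longrightarrow> X - Y \<in> smooth_vfields A"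
  using vfields_add[OF _ vfields_scaleR[of Y "-1"], of X] by simp

lemma vfields_0: "0 \<in> smooth_vfields A"
proof (rule smooth_vfieldsI)
  show "0 x \<in> tangent_space A x" for x using tangent_0 by (simp add: zero_fun_def)
  show "smooth_on (cimage c) (vrep c 0)" for c by (simp add: vrep_def[abs_def] zero_fun_def)
qed

lemma vfields_sum: "(\<And>i. i \<in> I \<Longrightarrow> X i \<in> smooth_vfields A) \<Longrightarrow> (\<Sum>i\<in>I. X i) \<in> smooth_vfields A"
  by (induction I rule: infinite_finite_induct) (auto intro: vfields_0 vfields_add)

text \<open>This removes the chosen chart: the chain rule on the overlap changes the differential of
  \<open>f\<close> and the component of \<open>X\<close> in opposite ways.\<close>

lemma vfield_apply_chart:
  assumes "X x \<in> tangent_space A x" "smooth_fun A f" "c \<in> A" "x \<in> cdom c"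
  shows "vfield_apply A X f x = FD (f \<circ> cinv c) (cmap c x) (X x c)"
proof -
  define c' where "c' = (SOME c. c \<in> A \<and> x \<in> cdom c)"
  have c': "c' \<in> A" "x \<in> cdom c'" unfolding c'_def using someI[of "\<lambda>c. c \<in> A \<and> x \<in> cdom c" c] assms by auto
  let ?y = "cmap c' x"
  have y: "?y \<in> ov c' c" using c' assms by (intro cmap_in_ov)
  have t: "tr c' c ?y = cmap c x" using c' by (simp add: cinv_cmap)
  have "((\<lambda>y. (f \<circ> cinv c) (tr c' c y)) has_derivative (\<lambda>h. FD (f \<circ> cinv c) (tr c' c ?y) (FD (tr c' c) ?y h))) (at ?y)"
    using assms c' y t by (intro FD_comp tr_differentiable smooth_on_differentiable[of "cimage c"])
      (simp_all add: smooth_funD o_def)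
  then have "((f \<circ> cinv c') has_derivative (\<lambda>h. FD (f \<circ> cinv c) (tr c' c ?y) (FD (tr c' c) ?y h))) (at ?y)"
    by (rule has_derivative_transform_within_open[where s = "ov c' c"])
      (use c' assms y in \<open>auto simp: open_ov cinv_tr[unfolded o_def]\<close>)
  then have "FD (f \<circ> cinv c') ?y (X x c') = FD (f \<circ> cinv c) (cmap c x) (FD (tr c' c) ?y (X x c'))"
    unfolding t by (simp add: FD_I)
  then show ?thesis
    unfolding vfield_apply_def c'_def[symmetric] Let_def using tangentD[OF assms(1) c'(1) assms(3) c'(2) assms(4)] by simp
qed

text \<open>Extension by zero. A point outside \<open>cdom c\<close> has a neighbourhood avoiding
  \<open>K\<close>, since a compact set is closed in a Hausdorff space.\<close>

lemma smooth_chart_extend: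
  assumes c: "c \<in> A" and K: "compact K" "K \<subseteq> cdom c" "\<And>x. x \<notin> K \<Longrightarrow> F x = 0" and d: "d \<in> A"
    and s: "smooth_on (ov d c) (F \<circ> cinv d)"
  shows "smooth_on (cimage d) (F \<circ> cinv d)"
proof (rule smooth_on_local)
  fix y assume y: "y \<in> cimage d"
  show "\<exists>T. open T \<and> y \<in> T \<and> smooth_on T (F \<circ> cinv d)"
  proof (cases "cinv d y \<in> cdom c")
    case True
    then show ?thesis using s y open_ov[OF d c] by (intro exI[of _ "ov d c"]) (auto simp: ov_def)
  next
    case False
    let ?T = "cimage d \<inter> cinv d -` (- K)"
    have o: "open ?T"
      by (rule continuous_open_preimage[OF cont_cinv[OF d] open_cimage[OF d]])
        (use K compact_imp_closed in auto)
    moreover have "y \<in> ?T" using False y K by auto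
    moreover have "smooth_on ?T (F \<circ> cinv d)"
      using smooth_on_cong[OF o, of "F \<circ> cinv d" "\<lambda>_. 0"] K(3) by auto
    ultimately show ?thesis by blast
  qed
qed

end

section \<open>Cut-off functions and coordinate frame fields\<close>

locale chart_bump = atlas A
  for A :: "('a::{t2_space, second_countable_topology}, 'e::euclidean_space) chart set" +
  fixes c :: "('a, 'e) chart" and b :: "'e \<Rightarrow> real" and K W :: "'a set"
  assumes c: "c \<in> A" and b: "smooth_on UNIV b" and K: "compact K" "K \<subseteq> cdom c"
    and b0: "\<And>x. x \<in> cdom c \<Longrightarrow> x \<notin> K \<Longrightarrow> b (cmap c x) = 0"
    and W: "open W" "W \<subseteq> cdom c" and b1: "\<And>x. x \<in> W \<Longrightarrow> b (cmap c x) = 1"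
begin

definition cut :: "('e \<Rightarrow> real) \<Rightarrow> 'a \<Rightarrow> real" where
  "cut g x = (if x \<in> cdom c then b (cmap c x) * g (cmap c x) else 0)"

text \<open>The coordinate field of direction \<open>a\<close>, cut off so that it is a global
  smooth field; on \<open>W\<close> it is the honest coordinate field.\<close>

definition cfield :: "'e \<Rightarrow> ('a, 'e) vfield" where
  "cfield a x = cut (\<lambda>_. 1) x *\<^sub>R tv c x a"

lemma smooth_cut:
  assumes "smooth_on (cimage c) g"
  shows "smooth_fun A (cut g)"
  unfolding smooth_fun_def
proof
  fix d assume d: "d \<in> A"
  have "smooth_on (ov d c) (\<lambda>y. b (tr d c y) * g (tr d c y))"
    using d c open_ov[OF d c] subsetD[OF ov_subset tr_in_ov[OF d c]]
    by (intro smooth_on_mult smooth_on_comp[OF _ _ b] smooth_on_comp[OF _ _ assms] smooth_tr) auto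
  also have "?this \<longleftrightarrow> smooth_on (ov d c) (cut g \<circ> cinv d)"
    by (rule smooth_on_cong[OF open_ov[OF d c]]) (auto simp: cut_def ov_def)
  finally show "smooth_on (cimage d) (cut g \<circ> cinv d)"
    by (rule smooth_chart_extend[OF c K _ d, rotated]) (use b0 in \<open>auto simp: cut_def\<close>)
qed

lemma cfield_tangent: "cfield a x \<in> tangent_space A x"
  unfolding cfield_def using tv_tangent[OF c] tangent_0[of x]
  by (cases "x \<in> cdom c") (auto intro: tangent_scaleR simp: cut_def)

lemma smooth_cfield: "cfield a \<in> smooth_vfields A"
proof (rule smooth_vfieldsI[OF cfield_tangent])
  fix d assume d: "d \<in> A"
  let ?F = "\<lambda>x. cfield a x d"
  have "smooth_on (ov d c) (\<lambda>y. b (tr d c y) *\<^sub>R FD (tr c d) (tr d c y) a)"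
    using d c open_ov[OF d c] tr_in_ov[OF d c]
    by (intro smooth_on_scaleR smooth_on_comp[OF _ _ b]
      smooth_on_comp[OF _ _ smooth_on_FD[OF smooth_tr[OF c d]]] smooth_tr) auto
  also have "?this \<longleftrightarrow> smooth_on (ov d c) (?F \<circ> cinv d)"
    by (rule smooth_on_cong[OF open_ov[OF d c]])
      (use d in \<open>auto simp: cut_def cfield_def ov_def scaleR_fun_def tv_def cinv_in\<close>)
  finally have "smooth_on (cimage d) (?F \<circ> cinv d)"
    by (rule smooth_chart_extend[OF c K _ d, rotated])
      (use b0 in \<open>auto simp: cfield_def cut_def scaleR_fun_def\<close>)
  then show "smooth_on (cimage d) (vrep d (cfield a))" by (simp add: vrep_def[abs_def] o_def)
qed

lemma cut_W: "x \<in> W \<Longrightarrow> cut g x = g (cmap c x)"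
  using W b1 by (auto simp: cut_def)

lemma cfield_W: "x \<in> W \<Longrightarrow> cfield a x = tv c x a"
  by (simp add: cfield_def cut_W)

end

context atlas
begin

lemma exists_chart_bump:
  assumes c: "c \<in> A" and x: "x \<in> cdom c"
  obtains b K W where "chart_bump A c b K W" "x \<in> W"
proof -
  obtain r0 where r0: "r0 > 0" "cball (cmap c x) r0 \<subseteq> cimage c"
    using open_cimage[OF c] x open_contains_cball by blast
  define r where "r = r0 / 2"
  have r: "r > 0" "cball (cmap c x) (2 * r) \<subseteq> cimage c" using r0 by (auto simp: r_def)
  obtain b where b: "smooth_on UNIV b" "\<forall>y\<in>ball (cmap c x) r. b y = 1"
    "\<forall>y. y \<notin> ball (cmap c x) (2 * r) \<longrightarrow> b y = (0::real)"
    using smooth_bump[OF r(1), of "cmap c x"] by blast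
  let ?K = "cinv c ` cball (cmap c x) (2 * r)"
  let ?W = "cdom c \<inter> cmap c -` ball (cmap c x) r"
  have "chart_bump A c b ?K ?W"
  proof (unfold_locales)
    show "compact ?K"
      by (rule compact_continuous_image[OF continuous_on_subset[OF cont_cinv[OF c] r(2)]]) simp
    show "?K \<subseteq> cdom c" using r cinv_in[OF c] by auto
    show "open ?W" by (rule continuous_open_preimage[OF cont_cmap[OF c] open_cdom[OF c]]) simp
    show "b (cmap c z) = 0" if "z \<in> cdom c" "z \<notin> ?K" for z
    proof -
      have "cmap c z \<notin> cball (cmap c x) (2 * r)" using that cinv_cmap[OF c that(1)] by (metis imageI)
      then show ?thesis using b(3) by auto
    qed
  qed (use b c in auto)
  moreover have "x \<in> ?W" using x r by simp
  ultimately show ?thesis using that by blast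
qed

end

section \<open>Connections in charts\<close>

locale affine_manifold = atlas A
  for A :: "('a::{t2_space, second_countable_topology}, 'e::euclidean_space) chart set" +
  fixes nabla :: "('a, 'e) connection"
  assumes affine: "affine_connection A nabla"
begin

lemma nabla_closed: "X \<in> smooth_vfields A \<Longrightarrow> Y \<in> smooth_vfields A \<Longrightarrow> nabla X Y \<in> smooth_vfields A"
  using affine unfolding affine_connection_def by blast

lemma nabla_add_left: "X \<in> smooth_vfields A \<Longrightarrow> X' \<in> smooth_vfields A \<Longrightarrow> Y \<in> smooth_vfields A \<Longrightarrow>
    nabla (X + X') Y = nabla X Y + nabla X' Y"
  using affine unfolding affine_connection_def by blast

lemma nabla_add_right: "X \<in> smooth_vfields A \<Longrightarrow> Y \<in> smooth_vfields A \<Longrightarrow> Y' \<in> smooth_vfields A \<Longrightarrow>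
    nabla X (Y + Y') = nabla X Y + nabla X Y'"
  using affine unfolding affine_connection_def by blast

lemma nabla_scale:
  assumes "smooth_fun A f" "X \<in> smooth_vfields A" "Y \<in> smooth_vfields A"
  shows nabla_scale_left: "nabla (\<lambda>x. f x *\<^sub>R X x) Y = (\<lambda>x. f x *\<^sub>R nabla X Y x)"
    and nabla_scale_right: "nabla X (\<lambda>x. f x *\<^sub>R Y x) = (\<lambda>x. vfield_apply A X f x *\<^sub>R Y x + f x *\<^sub>R nabla X Y x)"
  using affine assms unfolding affine_connection_def by blast+

lemma nabla_0_left: "Y \<in> smooth_vfields A \<Longrightarrow> nabla 0 Y = 0"
  using nabla_add_left[OF vfields_0 vfields_0, of Y] by simp

lemma nabla_0_right: "X \<in> smooth_vfields A \<Longrightarrow> nabla X 0 = 0"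
  using nabla_add_right[OF _ vfields_0 vfields_0, of X] by simp

lemma nabla_sum_left: "finite I \<Longrightarrow> (\<And>i. i \<in> I \<Longrightarrow> X i \<in> smooth_vfields A) \<Longrightarrow> Y \<in> smooth_vfields A \<Longrightarrow>
    nabla (\<Sum>i\<in>I. X i) Y = (\<Sum>i\<in>I. nabla (X i) Y)"
  by (induction I rule: finite_induct) (auto simp: nabla_0_left nabla_add_left vfields_sum)

lemma nabla_sum_right: "finite I \<Longrightarrow> (\<And>i. i \<in> I \<Longrightarrow> Y i \<in> smooth_vfields A) \<Longrightarrow> X \<in> smooth_vfields A \<Longrightarrow>
    nabla X (\<Sum>i\<in>I. Y i) = (\<Sum>i\<in>I. nabla X (Y i))"
  by (induction I rule: finite_induct) (auto simp: nabla_0_right nabla_add_right vfields_sum)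

end

locale affine_manifold_bump = affine_manifold A nabla + chart_bump A c b K W
  for A :: "('a::{t2_space, second_countable_topology}, 'e::euclidean_space) chart set"
    and nabla c b K W
begin

abbreviation "cmpt X j \<equiv> cut (\<lambda>y. vrep c X y \<bullet> j)"

lemma smooth_cmpt: "X \<in> smooth_vfields A \<Longrightarrow> smooth_fun A (cmpt X j)"
  using c by (intro smooth_cut smooth_on_inner open_cimage smooth_vfieldsD(2)) auto

text \<open>
  Tensoriality: one factor of the squared cut-off makes the components of \<open>X\<close> global functions, the
  other one makes the frame global fields.
\<close>

lemma cut_decompose:
  assumes X: "X \<in> smooth_vfields A"
  shows "(\<lambda>x. (cut (\<lambda>_. 1) x * cut (\<lambda>_. 1) x) *\<^sub>R X x) = (\<Sum>j\<in>Basis. (\<lambda>x. cmpt X j x *\<^sub>R cfield j x))"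
proof
  fix x
  show "(cut (\<lambda>_. 1) x * cut (\<lambda>_. 1) x) *\<^sub>R X x = (\<Sum>j\<in>Basis. (\<lambda>x. cmpt X j x *\<^sub>R cfield j x)) x"
  proof (cases "x \<in> cdom c")
    case True
    show ?thesis
    proof (rule tangent_eqI[OF _ _ c True])
      show "(cut (\<lambda>_. 1) x * cut (\<lambda>_. 1) x) *\<^sub>R X x \<in> tangent_space A x"
        by (intro tangent_scaleR smooth_vfieldsD X)
      show "(\<Sum>j\<in>Basis. (\<lambda>x. cmpt X j x *\<^sub>R cfield j x)) x \<in> tangent_space A x"
        unfolding sum_fun_apply[where x = x] by (intro tangent_sum tangent_scaleR cfield_tangent)
      have "(\<Sum>j\<in>Basis. (\<lambda>x. cmpt X j x *\<^sub>R cfield j x)) x c = (\<Sum>j\<in>Basis. cmpt X j x *\<^sub>R (b (cmap c x) *\<^sub>R j))"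
        unfolding sum_fun_apply using True c by (simp add: cfield_def scaleR_fun_def) (simp add: cut_def)
      also have "\<dots> = (\<Sum>j\<in>Basis. (b (cmap c x) * b (cmap c x)) *\<^sub>R ((X x c \<bullet> j) *\<^sub>R j))"
        using True c by (intro sum.cong refl) (simp add: cut_def vrep_def cinv_cmap)
      also have "\<dots> = (b (cmap c x) * b (cmap c x)) *\<^sub>R X x c"
        by (simp only: scaleR_sum_right[symmetric] euclidean_representation)
      finally show "((cut (\<lambda>_. 1) x * cut (\<lambda>_. 1) x) *\<^sub>R X x) c = (\<Sum>j\<in>Basis. (\<lambda>x. cmpt X j x *\<^sub>R cfield j x)) x c"
        using True by (simp add: cut_def scaleR_fun_def)
    qed
  qed (simp add: sum_fun_apply cut_def)
qed

lemma smooth_cut_sq: "smooth_fun A (\<lambda>x. cut (\<lambda>_. 1) x * cut (\<lambda>_. 1) x)"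
  unfolding smooth_fun_def o_def
  by (intro ballI smooth_on_mult smooth_funD smooth_cut smooth_on_const open_cimage)

lemma open_cmap_W: "open (cmap c ` W)"
proof -
  have "open (cimage c \<inter> cinv c -` W)"
    by (rule continuous_open_preimage[OF cont_cinv[OF c] open_cimage[OF c] W(1)])
  also have "cimage c \<inter> cinv c -` W = cmap c ` W"
    using W(2) c by (auto simp: cinv_cmap image_iff subset_iff)
  finally show ?thesis .
qed

lemma cinv_cmap_W: "y \<in> cmap c ` W \<Longrightarrow> cinv c y \<in> W"
  using W(2) cinv_cmap[OF c] by auto

text \<open>Locality has to be derived from axioms about global fields. The function
  \<open>?q\<close> is 1 near \<open>x\<close>, so its derivative at \<open>x\<close> vanishes and
  multiplying \<open>X\<close> or \<open>Y\<close> by it does not change \<open>nabla X Y x\<close>.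
  The products expand in the frame by \<open>cut_decompose\<close>, and the Leibniz rule does the
  rest.\<close>

lemma nabla_bump:
  assumes X: "X \<in> smooth_vfields A" and Y: "Y \<in> smooth_vfields A" and x: "x \<in> W"
  shows "nabla X Y x c = FD (vrep c Y) (cmap c x) (X x c)
    + (\<Sum>i\<in>Basis. \<Sum>j\<in>Basis. (X x c \<bullet> i) *\<^sub>R (Y x c \<bullet> j) *\<^sub>R nabla (cfield i) (cfield j) x c)"
proof -
  have xc: "x \<in> cdom c" using x W by auto
  have yW: "cmap c x \<in> cmap c ` W" "cmap c x \<in> cimage c" using x xc by auto
  let ?q = "\<lambda>x. cut (\<lambda>_. 1) x * cut (\<lambda>_. 1) x"
  have q1: "?q x = 1" by (simp add: cut_W x)
  have cmpt_x: "cmpt Z j x = Z x c \<bullet> j" for Z j using x xc c by (simp add: cut_W vrep_def cinv_cmap)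
  have 1: "nabla X Y x c = (\<Sum>i\<in>Basis. (X x c \<bullet> i) *\<^sub>R nabla (cfield i) Y x c)"
  proof -
    have "nabla (\<lambda>x. ?q x *\<^sub>R X x) Y x = (\<Sum>i\<in>Basis. nabla (\<lambda>x. cmpt X i x *\<^sub>R cfield i x) Y) x"
      unfolding cut_decompose[OF X]
      by (subst nabla_sum_left) (auto intro: vfields_scale smooth_cmpt X smooth_cfield Y)
    then have "nabla X Y x = (\<Sum>i\<in>Basis. (X x c \<bullet> i) *\<^sub>R nabla (cfield i) Y x)"
      using nabla_scale_left[OF smooth_cut_sq X Y] q1
      by (simp add: sum_fun_apply nabla_scale_left[OF smooth_cmpt[OF X] smooth_cfield Y] cmpt_x)
    then show ?thesis by (simp add: sum_fun_apply scaleR_fun_def)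
  qed
  have 2: "nabla E Y x c = FD (vrep c Y) (cmap c x) (E x c) + (\<Sum>j\<in>Basis. (Y x c \<bullet> j) *\<^sub>R nabla E (cfield j) x c)"
    if E: "E \<in> smooth_vfields A" for E
  proof -
    have "FD (?q \<circ> cinv c) (cmap c x) = FD (\<lambda>_. 1) (cmap c x)"
      by (rule FD_cong[OF open_cmap_W yW(1)]) (simp add: cut_W cinv_cmap_W)
    then have "vfield_apply A E ?q x = 0"
      using vfield_apply_chart[of E x ?q c, OF smooth_vfieldsD(1)[OF E] smooth_cut_sq c xc] by simp
    then have "nabla E (\<lambda>x. ?q x *\<^sub>R Y x) x = nabla E Y x"
      using nabla_scale_right[OF smooth_cut_sq E Y] q1 by simp
    then have "nabla E Y x = (\<Sum>j\<in>Basis. nabla E (\<lambda>x. cmpt Y j x *\<^sub>R cfield j x)) x"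
      unfolding cut_decompose[OF Y]
      by (subst (asm) nabla_sum_right) (auto intro: vfields_scale smooth_cmpt Y smooth_cfield E)
    also have "\<dots> = (\<Sum>j\<in>Basis. vfield_apply A E (cmpt Y j) x *\<^sub>R cfield j x + (Y x c \<bullet> j) *\<^sub>R nabla E (cfield j) x)"
      by (simp add: sum_fun_apply nabla_scale_right[OF smooth_cmpt[OF Y] E smooth_cfield] cmpt_x)
    finally have "nabla E Y x c = (\<Sum>j\<in>Basis. vfield_apply A E (cmpt Y j) x *\<^sub>R j + (Y x c \<bullet> j) *\<^sub>R nabla E (cfield j) x c)"
      using xc c by (simp add: sum_fun_apply scaleR_fun_def plus_fun_def cfield_W x)
    moreover have "vfield_apply A E (cmpt Y j) x = FD (vrep c Y) (cmap c x) (E x c) \<bullet> j" for j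
    proof -
      have "FD (cmpt Y j \<circ> cinv c) (cmap c x) = FD (\<lambda>y. vrep c Y y \<bullet> j) (cmap c x)"
        using c W(2) by (intro FD_cong[OF open_cmap_W yW(1)]) (auto simp: cut_W cinv_cmap_W cmap_cinv)
      also have "\<dots> = (\<lambda>h. FD (vrep c Y) (cmap c x) h \<bullet> j)"
        by (rule FD_I) (intro has_derivative_inner_left FD_has_derivative vrep_differentiable[OF Y c yW(2)])
      finally show ?thesis
        using vfield_apply_chart[of E x "cmpt Y j" c, OF smooth_vfieldsD(1)[OF E] smooth_cmpt[OF Y] c xc] by simp
    qed
    ultimately show ?thesis by (simp add: sum.distrib euclidean_representation)
  qed
  have lin: "linear (FD (vrep c Y) (cmap c x))" by (rule linear_FD[OF vrep_differentiable[OF Y c yW(2)]])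
  have "nabla X Y x c = (\<Sum>i\<in>Basis. (X x c \<bullet> i) *\<^sub>R (FD (vrep c Y) (cmap c x) i +
      (\<Sum>j\<in>Basis. (Y x c \<bullet> j) *\<^sub>R nabla (cfield i) (cfield j) x c)))"
    unfolding 1 2[OF smooth_cfield] using xc c by (simp add: cfield_W x)
  also have "\<dots> = (\<Sum>i\<in>Basis. (X x c \<bullet> i) *\<^sub>R FD (vrep c Y) (cmap c x) i) +
      (\<Sum>i\<in>Basis. \<Sum>j\<in>Basis. (X x c \<bullet> i) *\<^sub>R (Y x c \<bullet> j) *\<^sub>R nabla (cfield i) (cfield j) x c)"
    by (simp only: scaleR_add_right sum.distrib scaleR_sum_right)
  finally show ?thesis using linear_sum_Basis[OF lin, of "X x c"] by simp
qed

text \<open>\<open>nabla_bump\<close> shows that the defining value does not depend on the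
  extensions, and \<open>cfield a\<close>, \<open>cfield a'\<close> show that extensions exist; this
  resolves the \<open>THE\<close>.\<close>

lemma christoffel_bump:
  assumes x: "x \<in> W"
  shows "christoffel A nabla c x a a' =
    (\<Sum>i\<in>Basis. \<Sum>j\<in>Basis. (a \<bullet> i) *\<^sub>R (a' \<bullet> j) *\<^sub>R nabla (cfield i) (cfield j) x c)"
  unfolding christoffel_def
proof (rule the_equality)
  have xc: "x \<in> cdom c" using x W by auto
  show "\<exists>X\<in>smooth_vfields A. \<exists>Y\<in>smooth_vfields A. X x c = a \<and> Y x c = a' \<and>
    (\<Sum>i\<in>Basis. \<Sum>j\<in>Basis. (a \<bullet> i) *\<^sub>R (a' \<bullet> j) *\<^sub>R nabla (cfield i) (cfield j) x c) = nabla X Y x c - FD (vrep c Y) (cmap c x) a"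
    using nabla_bump[OF smooth_cfield smooth_cfield x, of a a'] xc c
    by (intro bexI[of _ "cfield a"] bexI[of _ "cfield a'"] smooth_cfield) (simp add: cfield_W x)
  show "w = (\<Sum>i\<in>Basis. \<Sum>j\<in>Basis. (a \<bullet> i) *\<^sub>R (a' \<bullet> j) *\<^sub>R nabla (cfield i) (cfield j) x c)"
    if "\<exists>X\<in>smooth_vfields A. \<exists>Y\<in>smooth_vfields A. X x c = a \<and> Y x c = a' \<and> w = nabla X Y x c - FD (vrep c Y) (cmap c x) a" for w
    using that nabla_bump[OF _ _ x] by auto
qed

end

section \<open>Christoffel symbols of a chart\<close>

context affine_manifold
begin

abbreviation chr :: "('a, 'e) chart \<Rightarrow> 'e \<Rightarrow> 'e \<Rightarrow> 'e \<Rightarrow> 'e" where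
  "chr c y \<equiv> christoffel A nabla c (cinv c y)"

lemma exists_bump:
  assumes "c \<in> A" "x \<in> cdom c"
  obtains b K W where "affine_manifold_bump A nabla c b K W" "x \<in> W"
  using exists_chart_bump[OF assms] affine_manifold_axioms affine_manifold_bump.intro by metis

lemma nabla_chart:
  assumes "c \<in> A" "x \<in> cdom c" "X \<in> smooth_vfields A" "Y \<in> smooth_vfields A"
  shows "nabla X Y x c = FD (vrep c Y) (cmap c x) (X x c) + christoffel A nabla c x (X x c) (Y x c)"
proof -
  obtain b K W where "affine_manifold_bump A nabla c b K W" and x: "x \<in> W" using exists_bump[OF assms(1,2)] .
  then interpret affine_manifold_bump A nabla c b K W by blast
  show ?thesis using nabla_bump[OF assms(3,4) x] christoffel_bump[OF x] by simp
qed

lemma extend_vector: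
  assumes "c \<in> A" "x \<in> cdom c"
  obtains X where "X \<in> smooth_vfields A" "X x = tv c x a"
proof -
  obtain b K W where "affine_manifold_bump A nabla c b K W" and x: "x \<in> W" using exists_bump[OF assms(1,2)] .
  then interpret affine_manifold_bump A nabla c b K W by blast
  show ?thesis using that[OF smooth_cfield cfield_W[OF x]] .
qed

lemma bilinear_christoffel:
  assumes "c \<in> A" "x \<in> cdom c"
  shows "bilinear (christoffel A nabla c x)"
proof -
  obtain b K W where "affine_manifold_bump A nabla c b K W" and x: "x \<in> W" using exists_bump[OF assms(1,2)] .
  then interpret affine_manifold_bump A nabla c b K W by blast
  have "christoffel A nabla c x = (\<lambda>a a'. \<Sum>i\<in>Basis. \<Sum>j\<in>Basis. (a \<bullet> i) *\<^sub>R (a' \<bullet> j) *\<^sub>R nabla (cfield i) (cfield j) x c)"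
    using christoffel_bump[OF x] by blast
  moreover have "bilinear (\<lambda>a a'. \<Sum>i\<in>Basis. \<Sum>j\<in>Basis. (a \<bullet> i) *\<^sub>R (a' \<bullet> j) *\<^sub>R nabla (cfield i) (cfield j) x c)"
    unfolding bilinear_def
    by (auto intro!: linearI simp: inner_add_left scaleR_add_left distrib_left sum.distrib scaleR_sum_right mult_ac)
  ultimately show ?thesis by simp
qed

lemma smooth_chr:
  assumes c: "c \<in> A"
  shows "smooth_on (cimage c) (\<lambda>y. chr c y a a')"
proof (rule smooth_on_local)
  fix y assume y: "y \<in> cimage c"
  obtain b K W where "affine_manifold_bump A nabla c b K W" and x: "cinv c y \<in> W"
    using exists_bump[OF c cinv_in[OF c y]] .
  then interpret affine_manifold_bump A nabla c b K W by blast
  have "smooth_on (cmap c ` W) (\<lambda>y. \<Sum>i\<in>Basis. \<Sum>j\<in>Basis. (a \<bullet> i) *\<^sub>R (a' \<bullet> j) *\<^sub>R vrep c (nabla (cfield i) (cfield j)) y)"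
    using W(2)
    by (intro smooth_on_sum smooth_on_scaleR smooth_on_const open_cmap_W
      smooth_on_subset[OF smooth_vfieldsD(2)[OF nabla_closed[OF smooth_cfield smooth_cfield] c]]) auto
  also have "?this \<longleftrightarrow> smooth_on (cmap c ` W) (\<lambda>y. chr c y a a')"
    by (rule smooth_on_cong[OF open_cmap_W]) (simp add: christoffel_bump[OF cinv_cmap_W] vrep_def)
  finally show "\<exists>T. open T \<and> y \<in> T \<and> smooth_on T (\<lambda>y. chr c y a a')"
    using open_cmap_W x cmap_cinv[OF c y] by (metis imageI)
qed

text \<open>The derivative terms in \<open>nabla X Y - nabla Y X\<close> are exactly the components
  of the bracket, so only the difference of the two Christoffel values remains.\<close>

lemma christoffel_symmetric:
  assumes "torsion_free A nabla" "c \<in> A" "x \<in> cdom c"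
  shows "christoffel A nabla c x a b = christoffel A nabla c x b a"
proof -
  obtain X Y where X: "X \<in> smooth_vfields A" "X x = tv c x a" and Y: "Y \<in> smooth_vfields A" "Y x = tv c x b"
    using extend_vector[OF assms(2,3)] by metis
  have "nabla X Y - nabla Y X = lie_bracket A X Y"
    using assms(1) X Y unfolding torsion_free_def by blast
  then have "(nabla X Y - nabla Y X) x c = lie_bracket A X Y x c" by simp
  then have "nabla X Y x c - nabla Y X x c = lie_bracket A X Y x c" by (simp add: fun_diff_def)
  then show ?thesis
    unfolding nabla_chart[OF assms(2,3) X(1) Y(1)] nabla_chart[OF assms(2,3) Y(1) X(1)]
    using assms by (simp add: X(2) Y(2) lie_bracket_def)
qed

text \<open>Near \<open>cmap c x\<close>, the components of \<open>Y\<close> in \<open>d\<close> are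
  the differential of the chart change applied to those in \<open>c\<close>. Differentiating this
  once by the chain rule and once by the product rule, and using that \<open>nabla X Y x\<close> is
  itself a tangent vector, gives the inhomogeneous law.\<close>

lemma christoffel_transform:
  assumes c: "c \<in> A" "x \<in> cdom c" and d: "d \<in> A" "x \<in> cdom d"
  shows "christoffel A nabla d x (FD (tr c d) (cmap c x) a) (FD (tr c d) (cmap c x) a') =
    FD (tr c d) (cmap c x) (christoffel A nabla c x a a') - FD (\<lambda>y. FD (tr c d) y a') (cmap c x) a"
proof -
  obtain X Y where X: "X \<in> smooth_vfields A" "X x = tv c x a" and Y: "Y \<in> smooth_vfields A" "Y x = tv c x a'"
    using extend_vector[OF c] by metis
  let ?y = "cmap c x" and ?T = "FD (tr c d) (cmap c x)"
  have y: "?y \<in> ov c d" "?y \<in> cimage c" using c d cmap_in_ov by auto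
  have t: "tr c d ?y = cmap d x" using c by (simp add: cinv_cmap)
  have Xd: "X x d = ?T a" "Y x d = ?T a'" using tangentD[OF smooth_vfieldsD(1)[OF X(1)] c(1) d(1) c(2) d(2)]
      tangentD[OF smooth_vfieldsD(1)[OF Y(1)] c(1) d(1) c(2) d(2)] c by (auto simp: X Y)
  have XYc: "X x c = a" "vrep c Y ?y = a'" "Y x c = a'" using X Y c by (auto simp: vrep_def cinv_cmap)
  have lin: "linear (FD (tr c d) z)" if "z \<in> ov c d" for z using linear_FD_tr that c d by blast
  have dt: "(\<lambda>y. FD (tr c d) y h) differentiable (at ?y)" for h
    using smooth_on_differentiable[OF smooth_on_FD[OF smooth_tr[OF c(1) d(1)]] y(1)] .
  have D1: "((\<lambda>y. FD (tr c d) y (vrep c Y y)) has_derivative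
     (\<lambda>h. FD (\<lambda>y. FD (tr c d) y (vrep c Y ?y)) ?y h + FD (tr c d) ?y (FD (vrep c Y) ?y h))) (at ?y)"
    by (rule has_derivative_family[OF open_ov[OF c(1) d(1)] y(1) lin dt])
      (auto intro!: FD_has_derivative vrep_differentiable[OF Y(1) c(1) y(2)])
  have dY: "vrep d Y differentiable (at (tr c d ?y))" using t d by (auto intro: vrep_differentiable[OF Y(1) d(1)])
  have "((\<lambda>y. vrep d Y (tr c d y)) has_derivative (\<lambda>h. FD (vrep d Y) (tr c d ?y) (?T h))) (at ?y)"
    by (intro FD_comp dY tr_differentiable c d y)
  then have D2: "((\<lambda>y. FD (tr c d) y (vrep c Y y)) has_derivative (\<lambda>h. FD (vrep d Y) (tr c d ?y) (?T h))) (at ?y)"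
  proof (rule has_derivative_transform_within_open[OF _ open_ov[OF c(1) d(1)] y(1)])
    fix z assume z: "z \<in> ov c d"
    then have zz: "cinv c z \<in> cdom c" "cinv c z \<in> cdom d" "cmap c (cinv c z) = z"
      using c by (auto simp: ov_def cinv_cmap)
    have "Y (cinv c z) d = FD (tr c d) z (Y (cinv c z) c)"
      using tangentD[OF smooth_vfieldsD(1)[OF Y(1)] c(1) d(1) zz(1,2)] zz(3) by simp
    then show "vrep d Y (tr c d z) = FD (tr c d) z (vrep c Y z)"
      unfolding vrep_def cinv_tr[OF d(1) z] .
  qed
  have e: "FD (vrep d Y) (cmap d x) (?T a) = FD (\<lambda>y. FD (tr c d) y a') ?y a + ?T (FD (vrep c Y) ?y a)"
    using fun_cong[OF has_derivative_unique[OF D2 D1], of a] unfolding t XYc .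
  have "nabla X Y x d = ?T (nabla X Y x c)"
    by (rule tangentD[OF smooth_vfieldsD(1)[OF nabla_closed[OF X(1) Y(1)]] c(1) d(1) c(2) d(2)])
  then show ?thesis
    unfolding nabla_chart[OF d X(1) Y(1)] nabla_chart[OF c X(1) Y(1)] Xd e XYc
    by (simp add: linear_add[OF lin[OF y(1)]] algebra_simps)
qed

end

section \<open>Curves in charts\<close>

lemma has_vector_derivative_compose_at:
  assumes "(x has_vector_derivative x') (at t within S)" "f differentiable (at (x t))"
  shows "((\<lambda>s. f (x s)) has_vector_derivative FD f (x t) x') (at t within S)"
proof -
  have "((\<lambda>s. f (x s)) has_derivative (\<lambda>h. FD f (x t) (h *\<^sub>R x'))) (at t within S)"
    using has_derivative_compose[OF assms(1)[unfolded has_vector_derivative_def] FD_has_derivative[OF assms(2)]] .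
  then show ?thesis
    unfolding has_vector_derivative_def linear_scale[OF linear_FD[OF assms(2)]] .
qed

lemma has_vector_derivative_family:
  fixes W :: "real \<Rightarrow> 'b::euclidean_space"
  assumes T: "open T" "x t \<in> T" and lin: "\<And>z. z \<in> T \<Longrightarrow> linear (L z)"
    and L: "\<And>b. (\<lambda>z. L z b) differentiable (at (x t))"
    and x: "(x has_vector_derivative x') (at t within S)"
    and W: "(W has_vector_derivative W') (at t within S)" and t: "t \<in> S"
  shows "((\<lambda>s. L (x s) (W s)) has_vector_derivative FD (\<lambda>z. L z (W t)) (x t) x' + L (x t) W') (at t within S)"
proof -
  have s: "linear (\<lambda>b. FD (\<lambda>z. L z b) (x t) x')"
    by (rule linear_FD_arg[OF T lin L])
  have "((\<lambda>s. \<Sum>b\<in>Basis. (W s \<bullet> b) *\<^sub>R L (x s) b) has_vector_derivative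
     (\<Sum>b\<in>Basis. (W t \<bullet> b) *\<^sub>R FD (\<lambda>z. L z b) (x t) x' + (W' \<bullet> b) *\<^sub>R L (x t) b)) (at t within S)"
  proof (rule has_vector_derivative_sum)
    fix b :: 'b
    have "((\<lambda>s. W s \<bullet> b) has_vector_derivative W' \<bullet> b) (at t within S)"
      using bounded_linear.has_vector_derivative[OF bounded_linear_inner_left W] .
    then show "((\<lambda>s. (W s \<bullet> b) *\<^sub>R L (x s) b) has_vector_derivative
       (W t \<bullet> b) *\<^sub>R FD (\<lambda>z. L z b) (x t) x' + (W' \<bullet> b) *\<^sub>R L (x t) b) (at t within S)"
      by (intro has_vector_derivative_scaleR has_vector_derivative_compose_at[OF x L])
        (simp add: has_real_derivative_iff_has_vector_derivative)
  qed
  also have "(\<Sum>b\<in>Basis. (W t \<bullet> b) *\<^sub>R FD (\<lambda>z. L z b) (x t) x' + (W' \<bullet> b) *\<^sub>R L (x t) b) =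
      FD (\<lambda>z. L z (W t)) (x t) x' + L (x t) W'"
    unfolding sum.distrib linear_sum_Basis[OF s, symmetric] linear_sum_Basis[OF lin[OF T(2)], symmetric] ..
  finally have D: "((\<lambda>s. \<Sum>b\<in>Basis. (W s \<bullet> b) *\<^sub>R L (x s) b) has_vector_derivative
     FD (\<lambda>z. L z (W t)) (x t) x' + L (x t) W') (at t within S)" .
  have "(x \<longlongrightarrow> x t) (at t within S)"
    using x has_vector_derivative_continuous continuous_within by blast
  then have "\<forall>\<^sub>F s in at t within S. x s \<in> T" using T by (rule topological_tendstoD)
  then have ev: "\<forall>\<^sub>F s in at t within S. (\<Sum>b\<in>Basis. (W s \<bullet> b) *\<^sub>R L (x s) b) = L (x s) (W s)"
    by (rule eventually_mono) (rule linear_sum_Basis[OF lin, symmetric])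
  show ?thesis
    unfolding has_vector_derivative_def
    by (rule has_derivative_transform_eventually[OF D[unfolded has_vector_derivative_def] ev _ t])
      (rule linear_sum_Basis[OF lin[OF T(2)], symmetric])
qed

text \<open>Curves are functions on all reals, but uniqueness only determines them on the parameter
  interval. The following congruences make velocity and parallelism insensitive to values outside
  it.\<close>

lemma has_vector_derivative_cong_on:
  assumes "t \<in> S" "\<And>s. s \<in> S \<Longrightarrow> f s = g s"
  shows "(f has_vector_derivative D) (at t within S) \<longleftrightarrow> (g has_vector_derivative D) (at t within S)"
  using assms has_vector_derivative_transform[of t S f g D] has_vector_derivative_transform[of t S g f D] by auto

lemma vector_derivative_cong_on:
  assumes "t \<in> S" "\<And>s. s \<in> S \<Longrightarrow> f s = g s"
  shows "vector_derivative f (at t within S) = vector_derivative g (at t within S)"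
  unfolding vector_derivative_def using has_vector_derivative_cong_on[OF assms] by simp

lemma differentiable_cong_on:
  assumes "t \<in> S" "\<And>s. s \<in> S \<Longrightarrow> f s = g s"
  shows "f differentiable (at t within S) \<longleftrightarrow> g differentiable (at t within S)"
  unfolding differentiable_def
  using assms has_derivative_transform[of t S f g] has_derivative_transform[of t S g f] by auto

lemma vector_derivative_I:
  fixes f :: "real \<Rightarrow> 'b::euclidean_space"
  assumes "(f has_vector_derivative D) (at t within {0..1})" "t \<in> {0..1::real}"
  shows "vector_derivative f (at t within {0..1}) = D"
  by (rule vector_derivative_within_closed_interval[OF zero_less_one assms(2,1)])

lemma has_vector_derivative_imp_differentiable:
  "(f has_vector_derivative D) (at t within S) \<Longrightarrow> f differentiable (at t within S)"
  unfolding has_vector_derivative_def by (rule differentiableI)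

lemma velocity_cong:
  assumes "\<And>s. s \<in> S \<Longrightarrow> \<gamma> s = \<gamma>' s" "t \<in> S"
  shows "velocity A S \<gamma> t = velocity A S \<gamma>' t"
proof
  show "velocity A S \<gamma> t c = velocity A S \<gamma>' t c" for c
    using vector_derivative_cong_on[OF assms(2), of "cmap c \<circ> \<gamma>" "cmap c \<circ> \<gamma>'"] assms
    by (simp add: velocity_def)
qed

lemma parallel_along_cong:
  assumes g: "\<And>s. s \<in> S \<Longrightarrow> \<gamma> s = \<gamma>' s" and V: "\<And>s. s \<in> S \<Longrightarrow> V s = V' s"
    and P: "parallel_along A nabla S \<gamma> V"
  shows "parallel_along A nabla S \<gamma>' V'"
proof -
  have v: "vector_derivative (\<lambda>s. V s c) (at t within S) = vector_derivative (\<lambda>s. V' s c) (at t within S)" if "t \<in> S" for t c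
    by (rule vector_derivative_cong_on[OF that]) (simp add: V)
  have "cov_deriv_along A nabla S \<gamma>' V' t = cov_deriv_along A nabla S \<gamma> V t" if "t \<in> S" for t
    using that by (auto simp: cov_deriv_along_def g V v velocity_cong[OF g] fun_eq_iff)
  moreover have "differentiable_along A S \<gamma>' V'"
    unfolding differentiable_along_def
  proof (intro ballI conjI impI)
    fix t assume t: "t \<in> S"
    have d: "V t \<in> tangent_space A (\<gamma> t) \<and> (\<forall>c\<in>A. \<gamma> t \<in> cdom c \<longrightarrow> (\<lambda>s. V s c) differentiable (at t within S))"
      using P t unfolding parallel_along_def differentiable_along_def by blast
    show "V' t \<in> tangent_space A (\<gamma>' t)" using d t by (simp add: g V)
    fix c assume "c \<in> A" "\<gamma>' t \<in> cdom c"
    then have "(\<lambda>s. V s c) differentiable (at t within S)" using d t by (simp add: g)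
    then show "(\<lambda>s. V' s c) differentiable (at t within S)"
      by (subst (asm) differentiable_cong_on[OF t]) (simp add: V)
  qed
  ultimately show ?thesis using P unfolding parallel_along_def by simp
qed

section \<open>Geodesics and parallel fields in one chart: lifting and uniqueness\<close>

context affine_manifold
begin

lemma parallel_deriv:
  assumes P: "parallel_along A nabla S \<gamma> V" and t: "t \<in> S" and c: "c \<in> A" "\<gamma> t \<in> cdom c"
  shows "((\<lambda>s. V s c) has_vector_derivative - christoffel A nabla c (\<gamma> t) (velocity A S \<gamma> t c) (V t c)) (at t within S)"
proof -
  have "(\<lambda>s. V s c) differentiable (at t within S)"
    using P t c unfolding parallel_along_def differentiable_along_def by blast
  then have D: "((\<lambda>s. V s c) has_vector_derivative vector_derivative (\<lambda>s. V s c) (at t within S)) (at t within S)"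
    using vector_derivative_works by blast
  have "cov_deriv_along A nabla S \<gamma> V t c = 0"
    using P t unfolding parallel_along_def by (simp add: zero_fun_def)
  then have "vector_derivative (\<lambda>s. V s c) (at t within S) = - christoffel A nabla c (\<gamma> t) (velocity A S \<gamma> t c) (V t c)"
    using c by (simp add: cov_deriv_along_def eq_neg_iff_add_eq_0)
  then show ?thesis using D by simp
qed

lemma parallel_tangent: "parallel_along A nabla S \<gamma> V \<Longrightarrow> t \<in> S \<Longrightarrow> V t \<in> tangent_space A (\<gamma> t)"
  unfolding parallel_along_def differentiable_along_def by blast

lemma curve_deriv:
  assumes "differentiable_curve A S \<gamma>" "t \<in> S" "c \<in> A" "\<gamma> t \<in> cdom c"
  shows "((\<lambda>s. cmap c (\<gamma> s)) has_vector_derivative velocity A S \<gamma> t c) (at t within S)"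
  using assms vector_derivative_works[of "cmap c \<circ> \<gamma>" "at t within S"]
  unfolding differentiable_curve_def velocity_def by (auto simp: o_def)

lemma chr_bound:
  assumes c: "c \<in> A" and K: "compact K" "K \<subseteq> cimage c"
  shows "\<exists>C\<ge>0. \<forall>y\<in>K. \<forall>a b. norm (chr c y a b) \<le> C * norm a * norm b"
proof -
  have "\<exists>C\<ge>0. \<forall>y\<in>K. \<forall>a b. norm (chr c y a b) \<le> C * 1 * norm a * norm b"
  proof (rule bilinear_family_bound)
    show "bilinear (chr c y)" if "y \<in> K" for y
      using bilinear_christoffel[OF c cinv_in[OF c]] that K by auto
    fix a b
    have "continuous_on K (\<lambda>y. chr c y a b)"
      using smooth_on_continuous[OF smooth_chr[OF c]] K continuous_on_subset by blast
    then have "bounded ((\<lambda>y. chr c y a b) ` K)"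
      using K(1) compact_continuous_image compact_imp_bounded by blast
    then show "\<exists>C. \<forall>y\<in>K. norm (chr c y a b) \<le> C * 1" by (auto simp: bounded_iff)
  qed auto
  then show ?thesis by simp
qed

lemma chr_Lipschitz:
  assumes c: "c \<in> A" and K: "compact K" "K \<subseteq> cimage c" "convex K"
  shows "\<exists>C\<ge>0. \<forall>y\<in>K. \<forall>z\<in>K. \<forall>a b. norm (chr c y a b - chr c z a b) \<le> C * norm (y - z) * norm a * norm b"
proof -
  have "\<exists>C\<ge>0. \<forall>p\<in>K \<times> K. \<forall>a b. norm (chr c (fst p) a b - chr c (snd p) a b) \<le> C * norm (fst p - snd p) * norm a * norm b"
  proof (rule bilinear_family_bound)
    show "bilinear (\<lambda>a b. chr c (fst p) a b - chr c (snd p) a b)" if "p \<in> K \<times> K" for p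
      using bilinear_christoffel[OF c cinv_in[OF c], of "fst p"] bilinear_christoffel[OF c cinv_in[OF c], of "snd p"] that K
      unfolding bilinear_def by (auto intro!: linear_compose_sub)
    fix a b
    show "\<exists>C. \<forall>p\<in>K \<times> K. norm (chr c (fst p) a b - chr c (snd p) a b) \<le> C * norm (fst p - snd p)"
      using Ck_on_Lipschitz[OF smooth_on_Ck[OF smooth_chr[OF c]] K(1,2,3), of a b] by auto
  qed auto
  then show ?thesis by force
qed

text \<open>The manifold notions quantify over every chart at a point of the curve, whereas
  equations are solved in a single chart \<open>c\<close>; the lifts bridge this gap.\<close>

lemma lift_curve:
  assumes c: "c \<in> A" and x: "\<And>t. t \<in> {0..1} \<Longrightarrow> x t \<in> cimage c"
    and D: "\<And>t. t \<in> {0..1} \<Longrightarrow> (x has_vector_derivative x' t) (at t within {0..1})"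
  shows lift_differentiable: "differentiable_curve A {0..1} (\<lambda>t. cinv c (x t))"
    and lift_velocity: "\<And>t. t \<in> {0..1} \<Longrightarrow> velocity A {0..1} (\<lambda>t. cinv c (x t)) t = tv c (cinv c (x t)) (x' t)"
proof -
  have contx: "continuous_on {0..1} x"
    by (rule continuous_on_vector_derivative[OF D])
  have Dd: "((cmap d \<circ> (\<lambda>t. cinv c (x t))) has_vector_derivative FD (tr c d) (x t) (x' t)) (at t within {0..1})"
    if "t \<in> {0..1}" "d \<in> A" "cinv c (x t) \<in> cdom d" for t d
  proof -
    have "x t \<in> ov c d" using that x by (auto simp: ov_def)
    from has_vector_derivative_compose_at[OF D[OF that(1)] tr_differentiable[OF c that(2) this]]
    show ?thesis by (simp add: o_def)
  qed
  show "differentiable_curve A {0..1} (\<lambda>t. cinv c (x t))"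
    unfolding differentiable_curve_def
  proof (intro conjI ballI impI)
    show "continuous_on {0..1} (\<lambda>t. cinv c (x t))"
      by (rule continuous_on_compose2[OF cont_cinv[OF c] contx]) (use x in auto)
    show "(cmap d \<circ> (\<lambda>t. cinv c (x t))) differentiable (at t within {0..1})"
      if "t \<in> {0..1}" "d \<in> A" "cinv c (x t) \<in> cdom d" for t d
      by (rule has_vector_derivative_imp_differentiable[OF Dd[OF that]])
  qed
  show "velocity A {0..1} (\<lambda>t. cinv c (x t)) t = tv c (cinv c (x t)) (x' t)" if t: "t \<in> {0..1}" for t
  proof
    fix d
    show "velocity A {0..1} (\<lambda>t. cinv c (x t)) t d = tv c (cinv c (x t)) (x' t) d"
      unfolding velocity_def tv_def using vector_derivative_I[OF Dd[OF t] t] cmap_cinv[OF c x[OF t]] by auto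
  qed
qed

text \<open>In another chart \<open>d\<close> the product rule creates a second derivative of the
  chart change, which cancels against the inhomogeneous term of
  \<open>christoffel_transform\<close>.\<close>

lemma lift_parallel:
  assumes c: "c \<in> A" and x: "\<And>t. t \<in> {0..1} \<Longrightarrow> x t \<in> cimage c"
    and D: "\<And>t. t \<in> {0..1} \<Longrightarrow> (x has_vector_derivative x' t) (at t within {0..1})"
    and W: "\<And>t. t \<in> {0..1} \<Longrightarrow> (W has_vector_derivative - chr c (x t) (x' t) (W t)) (at t within {0..1})"
  shows "parallel_along A nabla {0..1} (\<lambda>t. cinv c (x t)) (\<lambda>t. tv c (cinv c (x t)) (W t))"
proof -
  let ?\<gamma> = "\<lambda>t. cinv c (x t)"
  let ?V = "\<lambda>t. tv c (?\<gamma> t) (W t)"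
  have Vd: "((\<lambda>s. ?V s d) has_vector_derivative
      FD (\<lambda>z. FD (tr c d) z (W t)) (x t) (x' t) + FD (tr c d) (x t) (- chr c (x t) (x' t) (W t))) (at t within {0..1})"
    if t: "t \<in> {0..1}" and d: "d \<in> A" "?\<gamma> t \<in> cdom d" for t d
  proof -
    have xo: "x t \<in> ov c d" using d x[OF t] by (auto simp: ov_def)
    have "((\<lambda>s. FD (tr c d) (x s) (W s)) has_vector_derivative
      FD (\<lambda>z. FD (tr c d) z (W t)) (x t) (x' t) + FD (tr c d) (x t) (- chr c (x t) (x' t) (W t))) (at t within {0..1})"
    proof (rule has_vector_derivative_family[OF open_ov[OF c d(1)] xo _ _ D[OF t] W[OF t] t])
      show "linear (FD (tr c d) z)" if "z \<in> ov c d" for z by (rule linear_FD_tr[OF c d(1) that])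
      show "(\<lambda>z. FD (tr c d) z b) differentiable (at (x t))" for b
        by (rule smooth_on_differentiable[OF smooth_on_FD[OF smooth_tr[OF c d(1)]] xo])
    qed
    note V' = this
    have ev: "\<forall>\<^sub>F s in at t within {0..1}. FD (tr c d) (x s) (W s) = ?V s d"
    proof -
      have "(x \<longlongrightarrow> x t) (at t within {0..1})"
        using D[OF t] has_vector_derivative_continuous continuous_within by blast
      then have "\<forall>\<^sub>F s in at t within {0..1}. x s \<in> ov c d" using open_ov[OF c d(1)] xo by (rule topological_tendstoD)
      then show ?thesis
        by (rule eventually_mono) (use d c in \<open>auto simp: tv_def ov_def cinv_cmap\<close>)
    qed
    have "FD (tr c d) (x t) (W t) = ?V t d"
      using d c x[OF t] by (auto simp: tv_def cmap_cinv)
    then show ?thesis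
      unfolding has_vector_derivative_def
      by (rule has_derivative_transform_eventually[OF V'[unfolded has_vector_derivative_def] ev _ t])
  qed
  have "cov_deriv_along A nabla {0..1} ?\<gamma> ?V t = 0" if t: "t \<in> {0..1}" for t
  proof
    fix d
    show "cov_deriv_along A nabla {0..1} ?\<gamma> ?V t d = 0 d"
    proof (cases "d \<in> A \<and> ?\<gamma> t \<in> cdom d")
      case True
      then have d: "d \<in> A" "?\<gamma> t \<in> cdom d" by auto
      have gc: "?\<gamma> t \<in> cdom c" "cmap c (?\<gamma> t) = x t" using x[OF t] c by (auto simp: cinv_in cmap_cinv)
      have xo: "x t \<in> ov c d" using d x[OF t] by (auto simp: ov_def)
      have v: "velocity A {0..1} ?\<gamma> t d = FD (tr c d) (x t) (x' t)"
        using fun_cong[OF lift_velocity[OF c x D t], of d] d gc by (simp add: tv_def)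
      have w: "?V t d = FD (tr c d) (x t) (W t)" using d gc by (simp add: tv_def)
      have "cov_deriv_along A nabla {0..1} ?\<gamma> ?V t d =
        FD (\<lambda>z. FD (tr c d) z (W t)) (x t) (x' t) + FD (tr c d) (x t) (- chr c (x t) (x' t) (W t)) +
        christoffel A nabla d (?\<gamma> t) (FD (tr c d) (x t) (x' t)) (FD (tr c d) (x t) (W t))"
        unfolding cov_deriv_along_def v w using True vector_derivative_I[OF Vd[OF t d] t] by simp
      also have "\<dots> = 0"
        using christoffel_transform[OF c gc(1) d, of "x' t" "W t"] linear_neg[OF linear_FD_tr[OF c d(1) xo]]
        unfolding gc(2) by simp
      finally show ?thesis by (simp add: zero_fun_def)
    qed (auto simp: cov_deriv_along_def zero_fun_def)
  qed
  moreover have "differentiable_along A {0..1} ?\<gamma> ?V"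
    unfolding differentiable_along_def
    using tv_tangent[OF c cinv_in[OF c x]] has_vector_derivative_imp_differentiable[OF Vd] by blast
  ultimately show ?thesis unfolding parallel_along_def by blast
qed

lemma lift_geodesic:
  assumes c: "c \<in> A" and x: "\<And>t. t \<in> {0..1} \<Longrightarrow> x t \<in> cimage c"
    and D: "\<And>t. t \<in> {0..1} \<Longrightarrow> (x has_vector_derivative x' t) (at t within {0..1})"
    and D2: "\<And>t. t \<in> {0..1} \<Longrightarrow> (x' has_vector_derivative - chr c (x t) (x' t) (x' t)) (at t within {0..1})"
  shows "geodesic A nabla {0..1} (\<lambda>t. cinv c (x t))"
  unfolding geodesic_def
proof
  show "differentiable_curve A {0..1} (\<lambda>t. cinv c (x t))" by (rule lift_differentiable[OF c x D])
  show "parallel_along A nabla {0..1} (\<lambda>t. cinv c (x t)) (velocity A {0..1} (\<lambda>t. cinv c (x t)))"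
    by (rule parallel_along_cong[OF refl lift_velocity[OF c x D, symmetric] lift_parallel[OF c x D D2]])
qed

text \<open>The difference of two solutions satisfies a linear equation; compactness of the curve
  and the bound \<open>M\<close> give the constant for \<open>Gronwall_zero\<close>.\<close>

lemma parallel_unique:
  assumes c: "c \<in> A" and x: "\<And>t. t \<in> {0..1} \<Longrightarrow> x t \<in> cimage c"
    and D: "\<And>t. t \<in> {0..1} \<Longrightarrow> (x has_vector_derivative x' t) (at t within {0..1})"
    and M: "\<And>t. t \<in> {0..1} \<Longrightarrow> norm (x' t) \<le> M"
    and P: "parallel_along A nabla {0..1} (\<lambda>t. cinv c (x t)) V" "parallel_along A nabla {0..1} (\<lambda>t. cinv c (x t)) V'"
    and eq: "V 0 = V' 0" and t: "t \<in> {0..1}"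
  shows "V t = V' t"
proof -
  have "continuous_on {0..1} x"
    by (rule continuous_on_vector_derivative[OF D])
  then have "compact (x ` {0..1})" by (rule compact_continuous_image) simp
  moreover have "x ` {0..1} \<subseteq> cimage c" using x by (rule image_subsetI)
  ultimately obtain C where C: "C \<ge> 0" "\<forall>y\<in>x ` {0..1}. \<forall>a b. norm (chr c y a b) \<le> C * norm a * norm b"
    using chr_bound[OF c, of "x ` {0..1}"] by auto
  have gc: "cinv c (x t) \<in> cdom c" if "t \<in> {0..1}" for t using x[OF that] cinv_in[OF c] by blast
  let ?f = "\<lambda>t. V t c - V' t c"
  have Df: "(?f has_vector_derivative - chr c (x t) (x' t) (?f t)) (at t within {0..1})" if "t \<in> {0..1}" for t
  proof -
    have l: "linear (chr c (x t) (x' t))" using bilinear_christoffel[OF c gc[OF that]] unfolding bilinear_def by blast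
    have "velocity A {0..1} (\<lambda>t. cinv c (x t)) t c = x' t"
      using fun_cong[OF lift_velocity[OF c x D that], of c] tv_apply[OF c gc[OF that]] by (rule trans)
    then show ?thesis
      using has_vector_derivative_diff[OF parallel_deriv[OF P(1) that c gc[OF that]] parallel_deriv[OF P(2) that c gc[OF that]]]
      by (simp add: linear_diff[OF l])
  qed
  have "?f t = 0"
  proof (rule Gronwall_zero[OF Df _ _ _ t, where c = 0])
    fix s :: real assume s: "s \<in> {0..1}"
    have "norm (chr c (x s) (x' s) (?f s)) \<le> C * norm (x' s) * norm (?f s)" using C(2) s by blast
    also have "\<dots> \<le> C * M * norm (?f s)" using M[OF s] C(1) by (intro mult_right_mono mult_left_mono) auto
    finally show "norm (- chr c (x s) (x' s) (?f s)) \<le> (C * M) * norm (?f s)" by simp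
  qed (use eq in auto)
  then show ?thesis
    using tangent_eqI[OF parallel_tangent[OF P(1) t] parallel_tangent[OF P(2) t] c gc[OF t]] by simp
qed

text \<open>The competitor \<open>\<gamma>\<close> is any geodesic of the manifold and might leave
  the chart, so one Gronwall estimate in coordinates is not enough. Agreement of position and
  velocity is shown to be locally constant in time, and the interval is connected.\<close>

lemma geodesic_unique:
  assumes c: "c \<in> A" and x: "\<And>t. t \<in> {0..1} \<Longrightarrow> x t \<in> cimage c"
    and D: "\<And>t. t \<in> {0..1} \<Longrightarrow> (x has_vector_derivative x' t) (at t within {0..1})"
    and D2: "\<And>t. t \<in> {0..1} \<Longrightarrow> (x' has_vector_derivative - chr c (x t) (x' t) (x' t)) (at t within {0..1})"
    and g: "geodesic A nabla {0..1} \<gamma>" and init: "\<gamma> 0 = cinv c (x 0)" "velocity A {0..1} \<gamma> 0 c = x' 0"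
    and t: "t \<in> {0..1}"
  shows "\<gamma> t = cinv c (x t)"
proof -
  define P where "P t \<longleftrightarrow> \<gamma> t = cinv c (x t) \<and> velocity A {0..1} \<gamma> t c = x' t" for t
  have dc: "differentiable_curve A {0..1} \<gamma>" and pc: "parallel_along A nabla {0..1} \<gamma> (velocity A {0..1} \<gamma>)"
    using g unfolding geodesic_def by auto
  have cg: "continuous_on {0..1} \<gamma>" using dc unfolding differentiable_curve_def by blast
  have cx: "continuous_on {0..1} x" "continuous_on {0..1} x'"
    by (rule continuous_on_vector_derivative[OF D], assumption, rule continuous_on_vector_derivative[OF D2])
  have cgx: "continuous_on {0..1} (\<lambda>t. cinv c (x t))"
    by (rule continuous_on_compose2[OF cont_cinv[OF c] cx(1)]) (use x in auto)
  have tend: "(f \<longlongrightarrow> f t0) (at t0 within {0..1})" if "continuous_on {0..1} f" "t0 \<in> {0..1}" for f :: "real \<Rightarrow> 'z::topological_space" and t0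
    using that by (simp add: continuous_on_def)
  \<comment> \<open>Three cases: different points separate by the Hausdorff property, different
    velocities at a common point separate by continuity in the chart \<open>c\<close>, and full
    agreement spreads by \<open>Gronwall_zero\<close>.\<close>
  have loc: "\<forall>\<^sub>F s in at t0 within {0..1}. P s \<longleftrightarrow> P t0" if t0: "t0 \<in> {0..1}" for t0
  proof (cases "\<gamma> t0 = cinv c (x t0)")
    case False
    then obtain U U' where U: "open U" "open U'" "\<gamma> t0 \<in> U" "cinv c (x t0) \<in> U'" "U \<inter> U' = {}"
      using hausdorff by metis
    have "\<forall>\<^sub>F s in at t0 within {0..1}. \<gamma> s \<in> U" "\<forall>\<^sub>F s in at t0 within {0..1}. cinv c (x s) \<in> U'"
      using topological_tendstoD[OF tend[OF cg t0] U(1,3)] topological_tendstoD[OF tend[OF cgx t0] U(2,4)] .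
    then show ?thesis
      by eventually_elim (use False U(5) in \<open>auto simp: P_def\<close>)
  next
    case eq: True
    have gc: "\<gamma> t0 \<in> cdom c" using eq cinv_in[OF c x[OF t0]] by simp
    have vc: "((\<lambda>s. velocity A {0..1} \<gamma> s c) \<longlongrightarrow> velocity A {0..1} \<gamma> t0 c) (at t0 within {0..1})"
      using has_vector_derivative_continuous[OF parallel_deriv[OF pc t0 c gc]] by (simp add: continuous_within)
    show ?thesis
    proof (cases "velocity A {0..1} \<gamma> t0 c = x' t0")
      case False
      then obtain U U' where U: "open U" "open U'" "velocity A {0..1} \<gamma> t0 c \<in> U" "x' t0 \<in> U'" "U \<inter> U' = {}"
        using hausdorff by metis
      have "\<forall>\<^sub>F s in at t0 within {0..1}. velocity A {0..1} \<gamma> s c \<in> U" "\<forall>\<^sub>F s in at t0 within {0..1}. x' s \<in> U'"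
        using topological_tendstoD[OF vc U(1,3)] topological_tendstoD[OF tend[OF cx(2) t0] U(2,4)] .
      then show ?thesis
        by eventually_elim (use False U(5) in \<open>auto simp: P_def\<close>)
    next
      case True
      let ?y = "x t0"
      obtain r where r: "r > 0" "cball ?y r \<subseteq> cimage c"
        using open_cimage[OF c] x[OF t0] open_contains_cball by blast
      have yg: "cmap c (\<gamma> t0) = ?y" using eq x[OF t0] c by (simp add: cmap_cinv)
      let ?M = "norm (x' t0) + 1"
      have "\<forall>\<^sub>F s in at t0 within {0..1}. \<gamma> s \<in> cdom c"
        by (rule topological_tendstoD[OF tend[OF cg t0] open_cdom[OF c] gc])
      moreover have "\<forall>\<^sub>F s in at t0 within {0..1}. x s \<in> ball ?y r"
        by (rule topological_tendstoD[OF tend[OF cx(1) t0]]) (use r in auto)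
      moreover have "\<forall>\<^sub>F s in at t0 within {0..1}. cmap c (\<gamma> s) \<in> ball ?y r"
      proof (rule topological_tendstoD)
        show "((\<lambda>s. cmap c (\<gamma> s)) \<longlongrightarrow> ?y) (at t0 within {0..1})"
          using has_vector_derivative_continuous[OF curve_deriv[OF dc t0 c gc]] yg by (simp add: continuous_within)
      qed (use r in auto)
      moreover have "\<forall>\<^sub>F s in at t0 within {0..1}. norm (x' s) < ?M"
        using order_tendstoD(2)[OF tendsto_norm[OF tend[OF cx(2) t0]], of ?M] by simp
      moreover have "\<forall>\<^sub>F s in at t0 within {0..1}. norm (velocity A {0..1} \<gamma> s c) < ?M"
        using order_tendstoD(2)[OF tendsto_norm[OF vc], of ?M] True by simp
      ultimately have "\<forall>\<^sub>F s in at t0 within {0..1}. \<gamma> s \<in> cdom c \<and> x s \<in> ball ?y r \<and> cmap c (\<gamma> s) \<in> ball ?y r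
          \<and> norm (x' s) < ?M \<and> norm (velocity A {0..1} \<gamma> s c) < ?M" by eventually_elim simp
      then obtain \<eta> where \<eta>: "\<eta> > 0" and near: "\<And>s. s \<in> {0..1} \<Longrightarrow> s \<noteq> t0 \<Longrightarrow> dist s t0 < \<eta> \<Longrightarrow>
          \<gamma> s \<in> cdom c \<and> x s \<in> ball ?y r \<and> cmap c (\<gamma> s) \<in> ball ?y r \<and> norm (x' s) < ?M \<and> norm (velocity A {0..1} \<gamma> s c) < ?M"
        unfolding eventually_at by blast
      \<comment> \<open>\<open>Gronwall_zero\<close> lives on compact intervals, while
        \<open>near\<close> is available only at distance below \<open>\<eta>\<close>; half of it
        leaves the necessary margin.\<close>
      define a where "a = max 0 (t0 - \<eta> / 2)"
      define b where "b = min 1 (t0 + \<eta> / 2)"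
      have J: "{a..b} \<subseteq> {0..1}" "t0 \<in> {a..b}" using t0 \<eta> by (auto simp: a_def b_def)
      have nearJ: "\<gamma> s \<in> cdom c \<and> x s \<in> cball ?y r \<and> cmap c (\<gamma> s) \<in> cball ?y r \<and> norm (x' s) \<le> ?M \<and> norm (velocity A {0..1} \<gamma> s c) \<le> ?M"
        if "s \<in> {a..b}" for s
      proof (cases "s = t0")
        case True
        then show ?thesis using gc yg r \<open>velocity A {0..1} \<gamma> t0 c = x' t0\<close> by simp
      next
        case False
        have "dist s t0 < \<eta>" using that \<eta> by (auto simp: a_def b_def dist_real_def)
        then show ?thesis using near[of s] that J False by (auto intro: less_imp_le)
      qed
      obtain L where L: "L \<ge> 0" "\<forall>y\<in>cball ?y r. \<forall>z\<in>cball ?y r. \<forall>a b. norm (chr c y a b - chr c z a b) \<le> L * norm (y - z) * norm a * norm b"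
        using chr_Lipschitz[OF c compact_cball r(2) convex_cball] by blast
      obtain C where C: "C \<ge> 0" "\<forall>y\<in>cball ?y r. \<forall>a b. norm (chr c y a b) \<le> C * norm a * norm b"
        using chr_bound[OF c compact_cball r(2)] by blast
      let ?v = "\<lambda>s. velocity A {0..1} \<gamma> s c"
      let ?f = "\<lambda>s. (x s - cmap c (\<gamma> s), x' s - ?v s)"
      let ?f' = "\<lambda>s. (x' s - ?v s, - chr c (x s) (x' s) (x' s) - - christoffel A nabla c (\<gamma> s) (?v s) (?v s))"
      \<comment> \<open>The first summand is the Lipschitz dependence of the Christoffel tensor on
        the position, the second its bilinearity in two velocities bounded by
        \<open>?M\<close>.\<close>
      let ?K = "L * ?M * ?M + 2 * C * ?M"
      have M: "?M \<ge> 0" by simp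
      have Df: "(?f has_vector_derivative ?f' s) (at s within {a..b})" if s: "s \<in> {a..b}" for s
      proof -
        have s': "s \<in> {0..1}" "\<gamma> s \<in> cdom c" using s J nearJ by auto
        have "(?f has_vector_derivative ?f' s) (at s within {0..1})"
          by (intro has_vector_derivative_Pair has_vector_derivative_diff D D2 curve_deriv[OF dc] parallel_deriv[OF pc] s' c)
        then show ?thesis using J(1) by (rule has_vector_derivative_within_subset)
      qed
      have bd: "norm (?f' s) \<le> (1 + ?K) * norm (?f s)" if s: "s \<in> {a..b}" for s
      proof -
        note n = nearJ[OF s]
        let ?z = "cmap c (\<gamma> s)"
        have gz: "christoffel A nabla c (\<gamma> s) = chr c ?z" using n c by (simp add: cinv_cmap)
        have bl: "bilinear (chr c ?z)" using n bilinear_christoffel[OF c] c by (simp add: cinv_cmap)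
        have "chr c (x s) (x' s) (x' s) - chr c ?z (?v s) (?v s) = (chr c (x s) (x' s) (x' s) - chr c ?z (x' s) (x' s)) +
           (chr c ?z (x' s - ?v s) (x' s) + chr c ?z (?v s) (x' s - ?v s))"
          by (simp add: bilinear_lsub[OF bl] bilinear_rsub[OF bl])
        then have "norm (chr c (x s) (x' s) (x' s) - chr c ?z (?v s) (?v s)) \<le>
           norm (chr c (x s) (x' s) (x' s) - chr c ?z (x' s) (x' s)) +
           (norm (chr c ?z (x' s - ?v s) (x' s)) + norm (chr c ?z (?v s) (x' s - ?v s)))"
          by (metis norm_triangle_mono norm_triangle_ineq order_refl)
        also have "\<dots> \<le> L * norm (x s - ?z) * ?M * ?M + (C * norm (x' s - ?v s) * ?M + C * ?M * norm (x' s - ?v s))"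
        proof (intro add_mono)
          have "norm (chr c (x s) (x' s) (x' s) - chr c ?z (x' s) (x' s)) \<le> L * norm (x s - ?z) * norm (x' s) * norm (x' s)"
            using L n by blast
          also have "\<dots> \<le> L * norm (x s - ?z) * ?M * ?M" using n L(1) by (intro mult_mono) auto
          finally show "norm (chr c (x s) (x' s) (x' s) - chr c ?z (x' s) (x' s)) \<le> L * norm (x s - ?z) * ?M * ?M" .
          have "norm (chr c ?z (x' s - ?v s) (x' s)) \<le> C * norm (x' s - ?v s) * norm (x' s)" using C n by blast
          also have "\<dots> \<le> C * norm (x' s - ?v s) * ?M" using n C(1) by (intro mult_mono) auto
          finally show "norm (chr c ?z (x' s - ?v s) (x' s)) \<le> C * norm (x' s - ?v s) * ?M" .
          have "norm (chr c ?z (?v s) (x' s - ?v s)) \<le> C * norm (?v s) * norm (x' s - ?v s)" using C n by blast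
          also have "\<dots> \<le> C * ?M * norm (x' s - ?v s)" using n C(1) by (intro mult_mono) auto
          finally show "norm (chr c ?z (?v s) (x' s - ?v s)) \<le> C * ?M * norm (x' s - ?v s)" .
        qed
        also have "\<dots> = (L * ?M * ?M) * norm (x s - ?z) + (2 * C * ?M) * norm (x' s - ?v s)" by algebra
        also have "\<dots> \<le> (L * ?M * ?M) * norm (?f s) + (2 * C * ?M) * norm (?f s)"
        proof (intro add_mono mult_left_mono)
          show "norm (x s - ?z) \<le> norm (?f s)" by (rule norm_fst_le)
          show "norm (x' s - ?v s) \<le> norm (?f s)" by (rule norm_snd_le)
        qed (use L(1) C(1) M in auto)
        finally have 1: "norm (chr c (x s) (x' s) (x' s) - chr c ?z (?v s) (?v s)) \<le> ?K * norm (?f s)"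
          by (simp add: distrib_right)
        have "norm (?f' s) \<le> norm (x' s - ?v s) + norm (- chr c (x s) (x' s) (x' s) - - chr c ?z (?v s) (?v s))"
          unfolding gz by (rule norm_Pair_le)
        also have "norm (- chr c (x s) (x' s) (x' s) - - chr c ?z (?v s) (?v s)) = norm (chr c (x s) (x' s) (x' s) - chr c ?z (?v s) (?v s))"
          by (simp add: norm_minus_commute)
        also have "norm (x' s - ?v s) + norm (chr c (x s) (x' s) (x' s) - chr c ?z (?v s) (?v s)) \<le> norm (?f s) + ?K * norm (?f s)"
          by (intro add_mono 1 norm_snd_le)
        finally show ?thesis by (simp add: distrib_right)
      qed
      have f0: "?f t0 = 0" using yg True by (simp add: zero_prod_def)
      have "P s" if "s \<in> {a..b}" for s
      proof -
        have "?f s = 0" using Gronwall_zero[OF Df bd J(2) f0 that] .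
        then have "cmap c (\<gamma> s) = x s" "?v s = x' s" by (auto simp: zero_prod_def)
        moreover have "cinv c (cmap c (\<gamma> s)) = \<gamma> s" using nearJ[OF that] c by (simp add: cinv_cmap)
        ultimately show ?thesis by (auto simp: P_def)
      qed
      moreover have "s \<in> {a..b}" if "s \<in> {0..1}" "dist s t0 < \<eta> / 2" for s
      proof -
        have "s < t0 + \<eta> / 2" "t0 - \<eta> / 2 < s" using that(2) unfolding dist_real_def by linarith+
        then show ?thesis using that(1) by (simp add: a_def b_def)
      qed
      ultimately show ?thesis
        unfolding eventually_at using \<eta> eq True by (intro exI[of _ "\<eta> / 2"]) (auto simp: P_def)
    qed
  qed
  have "P constant_on {0..1}"
  proof (rule locally_constant_imp_constant)
    fix t0 :: real assume t0: "t0 \<in> {0..1}"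
    then obtain d where d: "d > 0" "\<forall>s\<in>{0..1}. s \<noteq> t0 \<and> dist s t0 < d \<longrightarrow> P s = P t0"
      using loc[OF t0] unfolding eventually_at by blast
    show "\<exists>T. openin (top_of_set {0..1}) T \<and> t0 \<in> T \<and> (\<forall>s\<in>T. P s = P t0)"
      using d t0 by (intro exI[of _ "{0..1} \<inter> ball t0 d"]) (auto simp: dist_commute openin_open_Int)
  qed simp
  moreover have "P 0" using init by (simp add: P_def)
  ultimately have "P t" using t unfolding constant_on_def by (metis atLeastAtMost_iff order_refl zero_le_one)
  then show ?thesis by (simp add: P_def)
qed

end

section \<open>Geodesics and parallel fields near the origin\<close>

lemma mean_value_norm:
  fixes f :: "real \<Rightarrow> 'e::real_normed_vector"
  assumes D: "\<And>t. t \<in> {0..1} \<Longrightarrow> (f has_vector_derivative f' t) (at t within {0..1})"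
    and B: "\<And>t. t \<in> {0..1} \<Longrightarrow> norm (f' t) \<le> B" and t: "t \<in> {0..1}"
  shows "norm (f t - f 0) \<le> B"
proof -
  have B0: "0 \<le> B" using B[of 0] norm_ge_zero[of "f' 0"] by (simp del: norm_ge_zero)
  have "norm (f t - f 0) \<le> B * norm (t - 0)"
  proof (rule differentiable_bound[OF convex_real_interval(5)])
    show "(f has_derivative (\<lambda>h. h *\<^sub>R f' s)) (at s within {0..1})" if "s \<in> {0..1}" for s
      using D[OF that] unfolding has_vector_derivative_def .
    show "onorm (\<lambda>h. h *\<^sub>R f' s) \<le> B" if "s \<in> {0..1}" for s
    proof (rule onorm_bound[OF B0])
      show "norm (h *\<^sub>R f' s) \<le> B * norm h" for h :: real
        using mult_right_mono[OF B[OF that] abs_ge_zero[of h]] by (simp add: mult.commute)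
    qed
  qed (use t in auto)
  also have "\<dots> \<le> B" using t B0 by (simp add: mult_left_le)
  finally show ?thesis .
qed

lemma
  fixes f :: "real \<Rightarrow> 'e::euclidean_space"
  assumes "continuous_on {0..1} f"
  shows integral_deriv_unit: "\<And>t. t \<in> {0..1} \<Longrightarrow> ((\<lambda>t. integral {0..t} f) has_vector_derivative f t) (at t within {0..1})"
    and integral_cont_unit: "continuous_on {0..1} (\<lambda>t. integral {0..t} f)"
    and integral_bound_unit: "\<And>t B. (\<And>s. s \<in> {0..1} \<Longrightarrow> norm (f s) \<le> B) \<Longrightarrow> t \<in> {0..1} \<Longrightarrow> norm (integral {0..t} f) \<le> B"
proof -
  show D: "((\<lambda>t. integral {0..t} f) has_vector_derivative f t) (at t within {0..1})" if "t \<in> {0..1}" for t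
    by (rule integral_has_vector_derivative[OF assms that])
  show "continuous_on {0..1} (\<lambda>t. integral {0..t} f)"
    by (rule continuous_on_vector_derivative[OF D])
  show "norm (integral {0..t} f) \<le> B" if "\<And>s. s \<in> {0..1} \<Longrightarrow> norm (f s) \<le> B" "t \<in> {0..1}" for t B
    using mean_value_norm[OF D that(1) that(2)] by simp
qed

lemma integral_diff_bound_unit:
  fixes f g :: "real \<Rightarrow> 'e::euclidean_space"
  assumes f: "continuous_on {0..1} f" and g: "continuous_on {0..1} g"
    and B: "\<And>s. s \<in> {0..1} \<Longrightarrow> norm (f s - g s) \<le> B" and t: "t \<in> {0..1}"
  shows "norm (integral {0..t} f - integral {0..t} g) \<le> B"
proof -
  have "norm ((integral {0..t} f - integral {0..t} g) - (integral {0..0} f - integral {0..0} g)) \<le> B"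
    by (rule mean_value_norm[OF has_vector_derivative_diff[OF integral_deriv_unit[OF f] integral_deriv_unit[OF g]] B t])
  then show ?thesis by simp
qed

text \<open>The analytic core, free of manifolds: \<open>G\<close> is a Christoffel tensor vanishing
  at the origin, \<open>D\<close> and \<open>S\<close> are its first and second derivatives there,
  with directions listed before the two vector arguments. One constant \<open>K\<close> serves all
  estimates, so later bounds are polynomials in \<open>K\<close>.\<close>

locale small_connection =
  fixes G :: "'e::euclidean_space \<Rightarrow> 'e \<Rightarrow> 'e \<Rightarrow> 'e" and D :: "'e \<Rightarrow> 'e \<Rightarrow> 'e \<Rightarrow> 'e"
    and S :: "'e \<Rightarrow> 'e \<Rightarrow> 'e \<Rightarrow> 'e \<Rightarrow> 'e" and r K :: real
  assumes r: "0 < r" and K: "1 \<le> K"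
    and G_bil: "\<And>z. norm z \<le> r \<Longrightarrow> bilinear (G z)"
    and G_cont: "\<And>a b. continuous_on (cball 0 r) (\<lambda>z. G z a b)"
    and G_bound: "\<And>z a b. norm z \<le> r \<Longrightarrow> norm (G z a b) \<le> K * norm z * norm a * norm b"
    and G_lip: "\<And>y z a b. norm y \<le> r \<Longrightarrow> norm z \<le> r \<Longrightarrow>
      norm (G y a b - G z a b) \<le> K * norm (y - z) * norm a * norm b"
    and G_taylor: "\<And>z a b. norm z \<le> r \<Longrightarrow>
      norm (G z a b - D z a b - (1/2) *\<^sub>R S z z a b) \<le> K * norm z ^ 3 * norm a * norm b"
    and D_lin: "\<And>a b. linear (\<lambda>z. D z a b)" "\<And>z b. linear (\<lambda>a. D z a b)" "\<And>z a. linear (D z a)"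
    and S_lin: "\<And>z a b. linear (\<lambda>w. S w z a b)" "\<And>w a b. linear (\<lambda>z. S w z a b)"
      "\<And>w z b. linear (\<lambda>a. S w z a b)" "\<And>w z a. linear (S w z a)"
    and D_bound: "\<And>z a b. norm (D z a b) \<le> K * norm z * norm a * norm b"
    and S_bound: "\<And>w z a b. norm (S w z a b) \<le> K * norm w * norm z * norm a * norm b"
    and S_sym1: "\<And>w z a b. S w z a b = S z w a b"
    and S_sym2: "\<And>w z a b. S w z a b = S w z b a"
begin

lemma G_cont_comp:
  assumes "continuous_on T z" "continuous_on T a" "continuous_on T b" "\<And>t. t \<in> T \<Longrightarrow> norm (z t) \<le> r"
  shows "continuous_on T (\<lambda>t. G (z t) (a t) (b t))"
proof -
  have "continuous_on T (\<lambda>t. \<Sum>i\<in>Basis. \<Sum>j\<in>Basis. (a t \<bullet> i) *\<^sub>R (b t \<bullet> j) *\<^sub>R G (z t) i j)"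
    by (intro continuous_intros assms continuous_on_compose2[OF G_cont assms(1)]) (use assms(4) in auto)
  moreover have "(\<Sum>i\<in>Basis. \<Sum>j\<in>Basis. (a t \<bullet> i) *\<^sub>R (b t \<bullet> j) *\<^sub>R G (z t) i j) = G (z t) (a t) (b t)" if "t \<in> T" for t
  proof -
    have l: "linear (\<lambda>x. G (z t) x y)" "linear (G (z t) x)" for x y
      using G_bil[OF assms(4)[OF that]] unfolding bilinear_def by auto
    have "G (z t) (a t) (b t) = (\<Sum>i\<in>Basis. (a t \<bullet> i) *\<^sub>R G (z t) i (b t))" by (rule linear_sum_Basis[OF l(1)])
    also have "\<dots> = (\<Sum>i\<in>Basis. (a t \<bullet> i) *\<^sub>R (\<Sum>j\<in>Basis. (b t \<bullet> j) *\<^sub>R G (z t) i j))"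
      by (subst linear_sum_Basis[OF l(2), of _ "b t"]) simp
    finally show ?thesis by (simp add: scaleR_sum_right)
  qed
  ultimately show ?thesis by (simp cong: continuous_on_cong)
qed

text \<open>For \<open>\<kappa> = 0\<close> this is the initial value problem, for \<open>\<kappa> = 1\<close> the boundary value problem.\<close>

lemma geodesic_exists:
  assumes \<kappa>: "\<kappa> = 0 \<or> \<kappa> = (1::real)" and e: "norm e \<le> e0" and s: "norm x + 2 * e0 \<le> s" "s \<le> r" "32 * K * s\<^sup>2 \<le> 1"
  obtains z z' where "z 0 = x" "\<kappa> = 0 \<longrightarrow> z' 0 = e" "\<kappa> = 1 \<longrightarrow> z 1 = x + e"
    "\<And>t. t \<in> {0..1} \<Longrightarrow> norm (z t) \<le> norm x + 2 * e0" "\<And>t. t \<in> {0..1} \<Longrightarrow> norm (z' t) \<le> 2 * e0"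
    "\<And>t. t \<in> {0..1} \<Longrightarrow> (z has_vector_derivative z' t) (at t within {0..1})"
    "\<And>t. t \<in> {0..1} \<Longrightarrow> (z' has_vector_derivative - G (z t) (z' t) (z' t)) (at t within {0..1})"
proof -
  have e0: "0 \<le> e0" using e norm_ge_zero[of e] by linarith
  have s0: "0 \<le> s" "2 * e0 \<le> s" using s(1) e0 norm_ge_zero[of x] by linarith+
  let ?J = "\<lambda>f t. integral {0..t} f"
  let ?Z = "\<lambda>w t. x + ?J w t"
  let ?g = "\<lambda>w t. - G (?Z w t) (w t) (w t)"
  \<comment> \<open>The unknown is the velocity \<open>w\<close>; the position \<open>?Z w\<close>
    is its integral from \<open>x\<close>. Subtracting the double integral for
    \<open>\<kappa> = 1\<close> makes the mean velocity equal to \<open>e\<close>, hence the end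
    point equal to \<open>x + e\<close>.\<close>
  define \<Phi> :: "(real \<Rightarrow> 'e) \<Rightarrow> real \<Rightarrow> 'e" where "\<Phi> w t = e + ?J (?g w) t - \<kappa> *\<^sub>R ?J (?J (?g w)) 1" for w t
  define adm where "adm w \<longleftrightarrow> continuous_on {0..1} w \<and> (\<forall>t\<in>{0..1}. norm (w t) \<le> 2 * e0)" for w :: "real \<Rightarrow> 'e"
  have Zb: "norm (?Z w t) \<le> norm x + 2 * e0" if "adm w" "t \<in> {0..1}" for w t
    using norm_triangle_ineq[of x "?J w t"] integral_bound_unit[of w "2 * e0" t] that
    unfolding adm_def by fastforce
  have Zc: "continuous_on {0..1} (?Z w)" if "adm w" for w
    using that unfolding adm_def by (intro continuous_intros integral_cont_unit) auto
  have gc: "continuous_on {0..1} (?g w)" if "adm w" for w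
  proof (intro continuous_on_minus G_cont_comp Zc that)
    show "continuous_on {0..1} w" "continuous_on {0..1} w" using that unfolding adm_def by auto
    show "norm (?Z w t) \<le> r" if "t \<in> {0..1}" for t using Zb[OF \<open>adm w\<close> that] s by linarith
  qed
  \<comment> \<open>The factor 32 leaves room for both integrals: each is at most
    \<open>e0 / 8\<close>, so the bound \<open>2 * e0\<close> is preserved, and each has Lipschitz
    constant \<open>3 / 32\<close>, below \<open>1 / 8\<close>.\<close>
  have ks: "K * s * s \<le> 1 / 32" using s(3) by (simp add: power2_eq_square)
  have gb: "norm (?g w t) \<le> e0 / 8" if w: "adm w" and t: "t \<in> {0..1}" for w t
  proof -
    have wt: "norm (w t) \<le> 2 * e0" using w t unfolding adm_def by blast
    have zs: "norm (?Z w t) \<le> s" using Zb[OF w t] s by linarith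
    have "norm (?g w t) \<le> K * norm (?Z w t) * norm (w t) * norm (w t)"
      using G_bound[of "?Z w t" "w t" "w t"] zs s by simp
    also have "\<dots> \<le> K * s * s * (2 * e0)"
      using K s0 wt zs by (intro mult_mono) auto
    also have "\<dots> \<le> 1 / 32 * (2 * e0)" using ks e0 by (intro mult_right_mono) auto
    finally show ?thesis using e0 by simp
  qed
  have kn: "norm (\<kappa> *\<^sub>R v) \<le> norm v" for v :: 'e using \<kappa> by auto
  have "\<exists>w. adm w \<and> (\<forall>t\<in>{0..1}. w t = \<Phi> w t)"
  proof (rule Picard_fixed_point[OF adm_def])
    show "0 \<le> 2 * e0" using e0 by simp
    show "adm (\<Phi> w)" if w: "adm w" for w
      unfolding adm_def
    proof (intro conjI ballI)
      show "continuous_on {0..1} (\<Phi> w)"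
        unfolding \<Phi>_def by (intro continuous_intros integral_cont_unit gc w)
      fix t :: real assume t: "t \<in> {0..1}"
      have 1: "norm (?J (?g w) t) \<le> e0 / 8" if "t \<in> {0..1}" for t
        by (rule integral_bound_unit[OF gc[OF w] gb[OF w] that])
      have 2: "norm (?J (?J (?g w)) 1) \<le> e0 / 8"
        by (rule integral_bound_unit[OF integral_cont_unit[OF gc[OF w]] 1]) auto
      have "norm (\<Phi> w t) \<le> norm e + norm (?J (?g w) t) + norm (\<kappa> *\<^sub>R ?J (?J (?g w)) 1)"
        unfolding \<Phi>_def by (rule order_trans[OF norm_triangle_ineq4 add_right_mono[OF norm_triangle_ineq]])
      also have "\<dots> \<le> e0 + e0 / 8 + e0 / 8"
        using e 1[OF t] order_trans[OF kn 2] by (intro add_mono)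
      finally show "norm (\<Phi> w t) \<le> 2 * e0" using e0 by simp
    qed
    fix w w' d and t :: real
    assume w: "adm w" and w': "adm w'" and d: "\<And>t. t \<in> {0..1} \<Longrightarrow> norm (w t - w' t) \<le> d" and t: "t \<in> {0..1}"
    have d0: "0 \<le> d" using d[OF t] norm_ge_zero order_trans by blast
    have cw: "continuous_on {0..1} w" "continuous_on {0..1} w'" using w w' unfolding adm_def by auto
    have gd: "norm (?g w t - ?g w' t) \<le> d / 8" if t: "t \<in> {0..1}" for t
    proof -
      have wt: "norm (w t) \<le> s" "norm (w' t) \<le> s" using w w' t s0 unfolding adm_def by fastforce+
      have zs: "norm (?Z w t) \<le> s" "norm (?Z w' t) \<le> s" using Zb[OF w t] Zb[OF w' t] s by linarith+
      have zd: "norm (?Z w t - ?Z w' t) \<le> d" using integral_diff_bound_unit[OF cw d t] by simp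
      have b: "bilinear (G (?Z w' t))" using zs s by (intro G_bil) simp
      have eq: "?g w t - ?g w' t = - (G (?Z w t) (w t) (w t) - G (?Z w' t) (w t) (w t)) - (G (?Z w' t) (w t - w' t) (w t) + G (?Z w' t) (w' t) (w t - w' t))"
        by (simp add: bilinear_lsub[OF b] bilinear_rsub[OF b])
      have "norm (?g w t - ?g w' t) \<le> norm (G (?Z w t) (w t) (w t) - G (?Z w' t) (w t) (w t)) + (norm (G (?Z w' t) (w t - w' t) (w t)) + norm (G (?Z w' t) (w' t) (w t - w' t)))"
        unfolding eq by (rule norm_diff_le[OF eq_refl[OF norm_minus_cancel] norm_triangle_ineq])
      also have "\<dots> \<le> K * d * s * s + (K * s * d * s + K * s * s * d)"
      proof (intro add_mono)
        have "norm (G (?Z w t) (w t) (w t) - G (?Z w' t) (w t) (w t)) \<le> K * norm (?Z w t - ?Z w' t) * norm (w t) * norm (w t)"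
          using zs s by (intro G_lip) auto
        also have "\<dots> \<le> K * d * s * s" using K zd wt d0 s0 by (intro mult_mono) auto
        finally show "norm (G (?Z w t) (w t) (w t) - G (?Z w' t) (w t) (w t)) \<le> K * d * s * s" .
        have "norm (G (?Z w' t) (w t - w' t) (w t)) \<le> K * norm (?Z w' t) * norm (w t - w' t) * norm (w t)"
          using zs s by (intro G_bound) auto
        also have "\<dots> \<le> K * s * d * s" using K zs wt d0 s0 d[OF t] by (intro mult_mono) auto
        finally show "norm (G (?Z w' t) (w t - w' t) (w t)) \<le> K * s * d * s" .
        have "norm (G (?Z w' t) (w' t) (w t - w' t)) \<le> K * norm (?Z w' t) * norm (w' t) * norm (w t - w' t)"
          using zs s by (intro G_bound) auto
        also have "\<dots> \<le> K * s * s * d" using K zs wt d0 s0 d[OF t] by (intro mult_mono) auto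
        finally show "norm (G (?Z w' t) (w' t) (w t - w' t)) \<le> K * s * s * d" .
      qed
      also have "\<dots> = 3 * (K * s * s) * d" by algebra
      also have "\<dots> \<le> 3 * (1 / 32) * d" using ks d0 by (intro mult_right_mono mult_left_mono) auto
      finally show ?thesis using d0 by simp
    qed
    have 1: "norm (?J (?g w) t - ?J (?g w') t) \<le> d / 8" if "t \<in> {0..1}" for t
      by (rule integral_diff_bound_unit[OF gc[OF w] gc[OF w'] gd that])
    have 2: "norm (?J (?J (?g w)) 1 - ?J (?J (?g w')) 1) \<le> d / 8"
      by (rule integral_diff_bound_unit[OF integral_cont_unit[OF gc[OF w]] integral_cont_unit[OF gc[OF w']] 1]) auto
    have "\<Phi> w t - \<Phi> w' t = (?J (?g w) t - ?J (?g w') t) - \<kappa> *\<^sub>R (?J (?J (?g w)) 1 - ?J (?J (?g w')) 1)"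
      by (simp add: \<Phi>_def algebra_simps)
    also have "norm \<dots> \<le> d / 8 + d / 8"
      by (rule norm_diff_le[OF 1[OF t] order_trans[OF kn 2]])
    finally show "norm (\<Phi> w t - \<Phi> w' t) \<le> d / 2" using d0 by simp
  qed
  then obtain w where w: "adm w" and fp: "\<And>t. t \<in> {0..1} \<Longrightarrow> w t = \<Phi> w t" by blast
  have cw: "continuous_on {0..1} w" using w unfolding adm_def by blast
  show ?thesis
  proof (rule that[of "?Z w" w])
    show "?Z w 0 = x" by simp
    show "\<kappa> = 0 \<longrightarrow> w 0 = e" using fp[of 0] by (simp add: \<Phi>_def)
    show "\<kappa> = 1 \<longrightarrow> ?Z w 1 = x + e"
    proof
      assume k: "\<kappa> = 1"
      have "?J w 1 = integral {0..1} (\<lambda>t. e + ?J (?g w) t - ?J (?J (?g w)) 1)"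
        by (rule integral_cong) (use fp k in \<open>simp add: \<Phi>_def\<close>)
      also have "\<dots> = e + ?J (?J (?g w)) 1 - ?J (?J (?g w)) 1"
      proof -
        have "(?J (?g w)) integrable_on {0..1}"
          by (rule integrable_continuous_real[OF integral_cont_unit[OF gc[OF w]]])
        then show ?thesis
          by (subst integral_diff, (intro integrable_add integrable_const_ivl | assumption)+)
            (subst integral_add, auto)
      qed
      finally show "?Z w 1 = x + e" by simp
    qed
    fix t :: real assume t: "t \<in> {0..1}"
    show "norm (?Z w t) \<le> norm x + 2 * e0" by (rule Zb[OF w t])
    show "norm (w t) \<le> 2 * e0" using w t unfolding adm_def by blast
    show "(?Z w has_vector_derivative w t) (at t within {0..1})"
      using has_vector_derivative_add[OF has_vector_derivative_const integral_deriv_unit[OF cw t], of x] by simp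
    have "((\<lambda>t. (e - \<kappa> *\<^sub>R ?J (?J (?g w)) 1) + ?J (?g w) t) has_vector_derivative ?g w t) (at t within {0..1})"
      using has_vector_derivative_add[OF has_vector_derivative_const integral_deriv_unit[OF gc[OF w] t], of "e - \<kappa> *\<^sub>R ?J (?J (?g w)) 1"] by simp
    then show "(w has_vector_derivative ?g w t) (at t within {0..1})"
      by (rule has_vector_derivative_transform[OF t, rotated]) (use fp in \<open>simp add: \<Phi>_def\<close>)
  qed
qed

text \<open>\<open>\<kappa>\<close> selects the end at which the value is prescribed. Prescribing it
  at time 1 is needed for the vector that the ladder produces at \<open>q\<close>, while the
  expansion of transport starts at \<open>m\<close>.\<close>

lemma parallel_exists:
  assumes \<kappa>: "\<kappa> = 0 \<or> \<kappa> = (1::real)" and s: "s \<le> r" "32 * K * s\<^sup>2 \<le> 1"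
    and z: "continuous_on {0..1} z" "continuous_on {0..1} z'"
    and zb: "\<And>t. t \<in> {0..1} \<Longrightarrow> norm (z t) \<le> s" "\<And>t. t \<in> {0..1} \<Longrightarrow> norm (z' t) \<le> s"
  obtains U where "\<kappa> = 0 \<longrightarrow> U 0 = u" "\<kappa> = 1 \<longrightarrow> U 1 = u" "\<And>t. t \<in> {0..1} \<Longrightarrow> norm (U t) \<le> 2 * norm u"
    "\<And>t. t \<in> {0..1} \<Longrightarrow> (U has_vector_derivative - G (z t) (z' t) (U t)) (at t within {0..1})"
proof -
  have s0: "0 \<le> s" using zb(1)[of 0] norm_ge_zero[of "z 0"] by (simp del: norm_ge_zero)
  let ?J = "\<lambda>f t. integral {0..t} f"
  let ?g = "\<lambda>w t. - G (z t) (z' t) (w t)"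
  define \<Phi> :: "(real \<Rightarrow> 'e) \<Rightarrow> real \<Rightarrow> 'e" where "\<Phi> w t = u + ?J (?g w) t - \<kappa> *\<^sub>R ?J (?g w) 1" for w t
  define adm where "adm w \<longleftrightarrow> continuous_on {0..1} w \<and> (\<forall>t\<in>{0..1}. norm (w t) \<le> 2 * norm u)" for w :: "real \<Rightarrow> 'e"
  have gc: "continuous_on {0..1} (?g w)" if "adm w" for w
    using that zb s unfolding adm_def
    by (intro continuous_on_minus G_cont_comp z) (auto intro: order_trans)
  have ks: "K * s * s \<le> 1 / 32" using s(2) by (simp add: power2_eq_square)
  have Gb: "norm (G (z t) (z' t) a) \<le> norm a / 32" if t: "t \<in> {0..1}" for t a
  proof -
    have "norm (G (z t) (z' t) a) \<le> K * norm (z t) * norm (z' t) * norm a"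
      using zb(1)[OF t] s by (intro G_bound) auto
    also have "\<dots> \<le> K * s * s * norm a" using K zb(1)[OF t] zb(2)[OF t] s0 by (intro mult_right_mono mult_mono) auto
    also have "\<dots> \<le> 1 / 32 * norm a" using ks by (intro mult_right_mono) auto
    finally show ?thesis by simp
  qed
  have kn: "norm (\<kappa> *\<^sub>R v) \<le> norm v" for v :: 'e using \<kappa> by auto
  have "\<exists>w. adm w \<and> (\<forall>t\<in>{0..1}. w t = \<Phi> w t)"
  proof (rule Picard_fixed_point[OF adm_def])
    show "0 \<le> 2 * norm u" by simp
    show "adm (\<Phi> w)" if w: "adm w" for w
      unfolding adm_def
    proof (intro conjI ballI)
      show "continuous_on {0..1} (\<Phi> w)"
        unfolding \<Phi>_def by (intro continuous_intros integral_cont_unit gc w)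
      fix t :: real assume t: "t \<in> {0..1}"
      have 1: "norm (?J (?g w) t) \<le> norm u / 16" if t: "t \<in> {0..1}" for t
      proof (rule integral_bound_unit[OF gc[OF w] _ t])
        fix t :: real assume t: "t \<in> {0..1}"
        then have "norm (w t) \<le> 2 * norm u" using w unfolding adm_def by blast
        then show "norm (?g w t) \<le> norm u / 16" using Gb[OF t, of "w t"] by simp
      qed
      have "norm (\<Phi> w t) \<le> norm u + norm (?J (?g w) t) + norm (\<kappa> *\<^sub>R ?J (?g w) 1)"
        unfolding \<Phi>_def by (rule order_trans[OF norm_triangle_ineq4 add_right_mono[OF norm_triangle_ineq]])
      also have "\<dots> \<le> norm u + norm u / 16 + norm u / 16"
        using 1[OF t] order_trans[OF kn 1[of 1]] by (intro add_mono) auto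
      finally show "norm (\<Phi> w t) \<le> 2 * norm u" using norm_ge_zero[of u] by linarith
    qed
    fix w w' d and t :: real
    assume w: "adm w" and w': "adm w'" and d: "\<And>t. t \<in> {0..1} \<Longrightarrow> norm (w t - w' t) \<le> d" and t: "t \<in> {0..1}"
    have d0: "0 \<le> d" using d[OF t] norm_ge_zero order_trans by blast
    have gd: "norm (?g w t - ?g w' t) \<le> d / 32" if t: "t \<in> {0..1}" for t
    proof -
      have b: "bilinear (G (z t))" using zb(1)[OF t] s by (intro G_bil) simp
      have "?g w t - ?g w' t = - G (z t) (z' t) (w t - w' t)" by (simp add: bilinear_rsub[OF b])
      then show ?thesis using Gb[OF t, of "w t - w' t"] d[OF t] by simp
    qed
    have 1: "norm (?J (?g w) t - ?J (?g w') t) \<le> d / 32" if "t \<in> {0..1}" for t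
      by (rule integral_diff_bound_unit[OF gc[OF w] gc[OF w'] gd that])
    have "\<Phi> w t - \<Phi> w' t = (?J (?g w) t - ?J (?g w') t) - \<kappa> *\<^sub>R (?J (?g w) 1 - ?J (?g w') 1)"
      by (simp add: \<Phi>_def algebra_simps)
    also have "norm \<dots> \<le> d / 32 + d / 32"
      by (rule norm_diff_le[OF 1[OF t] order_trans[OF kn 1]]) auto
    finally show "norm (\<Phi> w t - \<Phi> w' t) \<le> d / 2" using d0 by simp
  qed
  then obtain w where w: "adm w" and fp: "\<And>t. t \<in> {0..1} \<Longrightarrow> w t = \<Phi> w t" by blast
  show ?thesis
  proof (rule that[of w])
    show "\<kappa> = 0 \<longrightarrow> w 0 = u" using fp[of 0] by (simp add: \<Phi>_def)
    show "\<kappa> = 1 \<longrightarrow> w 1 = u" using fp[of 1] by (simp add: \<Phi>_def)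
    fix t :: real assume t: "t \<in> {0..1}"
    show "norm (w t) \<le> 2 * norm u" using w t unfolding adm_def by blast
    have "((\<lambda>t. (u - \<kappa> *\<^sub>R ?J (?g w) 1) + ?J (?g w) t) has_vector_derivative ?g w t) (at t within {0..1})"
      using has_vector_derivative_add[OF has_vector_derivative_const integral_deriv_unit[OF gc[OF w] t], of "u - \<kappa> *\<^sub>R ?J (?g w) 1"] by simp
    then show "(w has_vector_derivative ?g w t) (at t within {0..1})"
      by (rule has_vector_derivative_transform[OF t, rotated]) (use fp in \<open>simp add: \<Phi>_def\<close>)
  qed
qed

section \<open>Expansions\<close>

lemmas D_simps = linear_add[OF D_lin(1)] linear_add[OF D_lin(2)] linear_add[OF D_lin(3)]
  linear_scale[OF D_lin(1)] linear_scale[OF D_lin(2)] linear_scale[OF D_lin(3)]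
  linear_0[OF D_lin(1)] linear_0[OF D_lin(2)] linear_0[OF D_lin(3)]
  linear_neg[OF D_lin(1)] linear_neg[OF D_lin(2)] linear_neg[OF D_lin(3)]
  linear_diff[OF D_lin(1)] linear_diff[OF D_lin(2)] linear_diff[OF D_lin(3)]

lemmas S_simps = linear_add[OF S_lin(1)] linear_add[OF S_lin(2)] linear_add[OF S_lin(3)] linear_add[OF S_lin(4)]
  linear_scale[OF S_lin(1)] linear_scale[OF S_lin(2)] linear_scale[OF S_lin(3)] linear_scale[OF S_lin(4)]
  linear_0[OF S_lin(1)] linear_0[OF S_lin(2)] linear_0[OF S_lin(3)] linear_0[OF S_lin(4)]
  linear_neg[OF S_lin(1)] linear_neg[OF S_lin(2)] linear_neg[OF S_lin(3)] linear_neg[OF S_lin(4)]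
  linear_diff[OF S_lin(1)] linear_diff[OF S_lin(2)] linear_diff[OF S_lin(3)] linear_diff[OF S_lin(4)]

lemma D_lip:
  assumes "norm a \<le> L" "norm b' \<le> L" "norm b \<le> L" "norm c \<le> L" "norm a' \<le> L" "norm c' \<le> L"
    and "norm (a - a') \<le> \<delta>" "norm (b - b') \<le> \<delta>" "norm (c - c') \<le> \<delta>"
  shows "norm (D a b c - D a' b' c') \<le> 3 * K * L\<^sup>2 * \<delta>"
proof -
  have L: "0 \<le> L" using assms(1) norm_ge_zero order_trans by blast
  have \<delta>: "0 \<le> \<delta>" using assms(7) norm_ge_zero order_trans by blast
  have b: "norm (D x y z) \<le> K * p * q * o'" if "norm x \<le> p" "norm y \<le> q" "norm z \<le> o'" for x y z p q o'
  proof -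
    have n: "0 \<le> p" "0 \<le> q" "0 \<le> o'" using that norm_ge_zero order_trans by blast+
    have "norm (D x y z) \<le> K * norm x * norm y * norm z" by (rule D_bound)
    also have "\<dots> \<le> K * p * q * o'" using K n that by (intro mult_mono) auto
    finally show ?thesis .
  qed
  have "D a b c - D a' b' c' = D (a - a') b c + D a' (b - b') c + D a' b' (c - c')"
    by (simp add: D_simps)
  also have "norm \<dots> \<le> K * \<delta> * L * L + K * L * \<delta> * L + K * L * L * \<delta>"
    by (intro norm_triangle_mono b assms)
  also have "\<dots> = 3 * K * L\<^sup>2 * \<delta>" by (simp add: power2_eq_square)
  finally show ?thesis .
qed

lemma S_lip:
  assumes "norm a \<le> L" "norm b' \<le> L" "norm b \<le> L" "norm c \<le> L" "norm a' \<le> L" "norm c' \<le> L" "norm d \<le> L" "norm d' \<le> L"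
    and "norm (a - a') \<le> \<delta>" "norm (b - b') \<le> \<delta>" "norm (c - c') \<le> \<delta>" "norm (d - d') \<le> \<delta>"
  shows "norm (S a b c d - S a' b' c' d') \<le> 4 * K * L ^ 3 * \<delta>"
proof -
  have L: "0 \<le> L" using assms(1) norm_ge_zero order_trans by blast
  have \<delta>: "0 \<le> \<delta>" using assms(9) norm_ge_zero order_trans by blast
  have b: "norm (S x y z w) \<le> K * p * q * o' * l" if "norm x \<le> p" "norm y \<le> q" "norm z \<le> o'" "norm w \<le> l" for x y z w p q o' l
  proof -
    have n: "0 \<le> p" "0 \<le> q" "0 \<le> o'" "0 \<le> l" using that norm_ge_zero order_trans by blast+
    have "norm (S x y z w) \<le> K * norm x * norm y * norm z * norm w" by (rule S_bound)
    also have "\<dots> \<le> K * p * q * o' * l" using K n that by (intro mult_mono) auto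
    finally show ?thesis .
  qed
  have "S a b c d - S a' b' c' d' = S (a - a') b c d + S a' (b - b') c d + S a' b' (c - c') d + S a' b' c' (d - d')"
    by (simp add: S_simps)
  also have "norm \<dots> \<le> K * \<delta> * L * L * L + K * L * \<delta> * L * L + K * L * L * \<delta> * L + K * L * L * L * \<delta>"
    by (intro norm_triangle_mono b assms)
  also have "\<dots> = 4 * K * L ^ 3 * \<delta>" by (simp add: power3_eq_cube)
  finally show ?thesis .
qed

text \<open>Replacing the arguments by approximations with cubic error costs order five in
  \<open>D\<close>, since two small arguments remain, and order six in \<open>S\<close>; the Taylor
  remainder is also of order five. With one surplus factor bounded by 1, the constants are 1 + 12 +
  16 = 29. The bound \<open>2 * \<sigma>\<close> on \<open>y\<close> allows for a straight line
  \<open>x + t *\<^sub>R w\<close>.\<close>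

lemma G_approx:
  assumes \<sigma>: "\<sigma> \<le> 1" "\<sigma> \<le> r" and n: "norm z \<le> \<sigma>" "norm a \<le> \<sigma>" "norm b \<le> \<sigma>"
    and n': "norm y \<le> 2 * \<sigma>" "norm c \<le> \<sigma>" "norm d \<le> \<sigma>"
    and d: "norm (z - y) \<le> K * \<sigma> ^ 3" "norm (a - c) \<le> K * \<sigma> ^ 3" "norm (b - d) \<le> K * \<sigma> ^ 3"
  shows "norm (G z a b - (D y c d + (1/2) *\<^sub>R S y y c d)) \<le> 29 * K\<^sup>2 * \<sigma> ^ 5"
proof -
  have s0: "0 \<le> \<sigma>" using n(1) norm_ge_zero order_trans by blast
  have n2: "norm z \<le> 2 * \<sigma>" "norm a \<le> 2 * \<sigma>" "norm b \<le> 2 * \<sigma>" "norm c \<le> 2 * \<sigma>" "norm d \<le> 2 * \<sigma>"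
    using n n' s0 by linarith+
  have "norm (G z a b - D z a b - (1/2) *\<^sub>R S z z a b) \<le> K * norm z ^ 3 * norm a * norm b"
    using n \<sigma> by (intro G_taylor) auto
  also have "\<dots> \<le> K * \<sigma> ^ 3 * \<sigma> * \<sigma>" using n K s0 by (intro mult_mono power_mono) auto
  also have "\<dots> = K * \<sigma> ^ 5" by (simp add: eval_nat_numeral)
  finally have 1: "norm (G z a b - D z a b - (1/2) *\<^sub>R S z z a b) \<le> K * \<sigma> ^ 5" .
  have "norm (D z a b - D y c d) \<le> 3 * K * (2 * \<sigma>)\<^sup>2 * (K * \<sigma> ^ 3)"
    by (intro D_lip n2 n' d)
  also have "\<dots> = 12 * K\<^sup>2 * \<sigma> ^ 5" by (simp add: eval_nat_numeral)
  finally have 2: "norm (D z a b - D y c d) \<le> 12 * K\<^sup>2 * \<sigma> ^ 5" .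
  have "norm (S z z a b - S y y c d) \<le> 4 * K * (2 * \<sigma>) ^ 3 * (K * \<sigma> ^ 3)"
    by (intro S_lip n2 n' d)
  also have "\<dots> = 32 * K\<^sup>2 * (\<sigma> ^ 5 * \<sigma>)" by (simp add: eval_nat_numeral)
  also have "\<dots> \<le> 32 * K\<^sup>2 * (\<sigma> ^ 5 * 1)" using s0 \<sigma> by (intro mult_left_mono) auto
  finally have 3: "norm ((1/2) *\<^sub>R (S z z a b - S y y c d)) \<le> 16 * K\<^sup>2 * \<sigma> ^ 5" by simp
  have "G z a b - (D y c d + (1/2) *\<^sub>R S y y c d) = (G z a b - D z a b - (1/2) *\<^sub>R S z z a b) + (D z a b - D y c d) + (1/2) *\<^sub>R (S z z a b - S y y c d)"
    by (simp add: algebra_simps)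
  also have "norm \<dots> \<le> K * \<sigma> ^ 5 + 12 * K\<^sup>2 * \<sigma> ^ 5 + 16 * K\<^sup>2 * \<sigma> ^ 5"
    by (intro norm_triangle_mono 1 2 3)
  also have "\<dots> \<le> 29 * K\<^sup>2 * \<sigma> ^ 5"
  proof -
    have "K \<le> K\<^sup>2" using K by (simp add: power2_eq_square)
    then have "K * \<sigma> ^ 5 \<le> K\<^sup>2 * \<sigma> ^ 5" using s0 by (intro mult_right_mono) auto
    then show ?thesis by simp
  qed
  finally show ?thesis .
qed

text \<open>\<open>E3\<close> and \<open>E4\<close> are the cubic and quartic corrections to the end
  point \<open>x + w\<close> of the geodesic with initial point \<open>x\<close> and velocity
  \<open>w\<close>.\<close>

definition E3 :: "'e \<Rightarrow> 'e \<Rightarrow> 'e" where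
  "E3 x w = (1/2) *\<^sub>R D x w w + (1/6) *\<^sub>R D w w w"
definition E4 :: "'e \<Rightarrow> 'e \<Rightarrow> 'e" where
  "E4 x w = (1/4) *\<^sub>R S x x w w + (1/6) *\<^sub>R S x w w w + (1/24) *\<^sub>R S w w w w"
text \<open>\<open>T3\<close> and \<open>T4\<close> are the corresponding corrections to the
  parallel translate of \<open>u\<close> along the geodesic from the origin with velocity
  \<open>v\<close>.\<close>

definition T3 :: "'e \<Rightarrow> 'e \<Rightarrow> 'e" where
  "T3 v u = (1/2) *\<^sub>R D v v u"
definition T4 :: "'e \<Rightarrow> 'e \<Rightarrow> 'e" where
  "T4 v u = (1/6) *\<^sub>R S v v v u"

definition geo :: "(real \<Rightarrow> 'e) \<Rightarrow> (real \<Rightarrow> 'e) \<Rightarrow> real \<Rightarrow> bool" where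
  "geo z z' \<sigma> \<longleftrightarrow> (\<forall>t\<in>{0..1}. (z has_vector_derivative z' t) (at t within {0..1}) \<and>
     (z' has_vector_derivative - G (z t) (z' t) (z' t)) (at t within {0..1}) \<and> norm (z t) \<le> \<sigma> \<and> norm (z' t) \<le> \<sigma>)"

definition par :: "(real \<Rightarrow> 'e) \<Rightarrow> (real \<Rightarrow> 'e) \<Rightarrow> (real \<Rightarrow> 'e) \<Rightarrow> real \<Rightarrow> bool" where
  "par z z' U \<sigma> \<longleftrightarrow> (\<forall>t\<in>{0..1}. (U has_vector_derivative - G (z t) (z' t) (U t)) (at t within {0..1}) \<and> norm (U t) \<le> \<sigma>)"

text \<open>The acceleration is cubic in \<open>\<sigma>\<close> because \<open>G\<close> vanishes
  at the origin; integrating once and twice keeps that order.\<close>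

lemma geo_close:
  assumes g: "geo z z' \<sigma>" and \<sigma>: "\<sigma> \<le> r" and t: "t \<in> {0..1}"
  shows "norm (z' t - z' 0) \<le> K * \<sigma> ^ 3" "norm (z t - (z 0 + t *\<^sub>R z' 0)) \<le> K * \<sigma> ^ 3"
proof -
  have D1: "(z has_vector_derivative z' t) (at t within {0..1})"
    and D2: "(z' has_vector_derivative - G (z t) (z' t) (z' t)) (at t within {0..1})"
    and n: "norm (z t) \<le> \<sigma>" "norm (z' t) \<le> \<sigma>" if "t \<in> {0..1}" for t
    using g that unfolding geo_def by auto
  have s0: "0 \<le> \<sigma>" using n(1)[OF t] norm_ge_zero order_trans by blast
  have b: "norm (- G (z t) (z' t) (z' t)) \<le> K * \<sigma> ^ 3" if t: "t \<in> {0..1}" for t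
  proof -
    have "norm (G (z t) (z' t) (z' t)) \<le> K * norm (z t) * norm (z' t) * norm (z' t)"
      using n(1)[OF t] \<sigma> by (intro G_bound) auto
    also have "\<dots> \<le> K * \<sigma> * \<sigma> * \<sigma>" using n[OF t] K s0 by (intro mult_mono) auto
    finally show ?thesis by (simp add: eval_nat_numeral mult.assoc)
  qed
  have 1: "norm (z' t - z' 0) \<le> K * \<sigma> ^ 3" if "t \<in> {0..1}" for t
    by (rule mean_value_norm[OF D2 b that])
  then show "norm (z' t - z' 0) \<le> K * \<sigma> ^ 3" using t .
  have "norm ((z t - t *\<^sub>R z' 0) - (z 0 - 0 *\<^sub>R z' 0)) \<le> K * \<sigma> ^ 3"
  proof (rule mean_value_norm[OF _ 1 t])
    show "((\<lambda>t. z t - t *\<^sub>R z' 0) has_vector_derivative z' t - z' 0) (at t within {0..1})" if "t \<in> {0..1}" for t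
      using D1[OF that] by (auto intro!: derivative_eq_intros)
  qed
  then show "norm (z t - (z 0 + t *\<^sub>R z' 0)) \<le> K * \<sigma> ^ 3" by (simp add: algebra_simps)
qed

text \<open>The right-hand side may be evaluated along the tangent line up to order five by
  \<open>geo_close\<close> and \<open>G_approx\<close>; two integrations of the resulting polynomial
  give the terms \<open>E3\<close> and \<open>E4\<close>.\<close>

lemma geo_expand:
  assumes g: "geo z z' \<sigma>" and \<sigma>: "\<sigma> \<le> 1" "\<sigma> \<le> r"
  shows "norm (z 1 - (z 0 + z' 0 - E3 (z 0) (z' 0) - E4 (z 0) (z' 0))) \<le> 29 * K\<^sup>2 * \<sigma> ^ 5"
proof -
  define x w where "x = z 0" and "w = z' 0"
  have D1: "(z has_vector_derivative z' t) (at t within {0..1})"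
    and D2: "(z' has_vector_derivative - G (z t) (z' t) (z' t)) (at t within {0..1})"
    and n: "norm (z t) \<le> \<sigma>" "norm (z' t) \<le> \<sigma>" if "t \<in> {0..1}" for t
    using g that unfolding geo_def by auto
  \<comment> \<open>\<open>m\<close> is \<open>G\<close> expanded to second order along the line
    \<open>x + t *\<^sub>R w\<close>; \<open>q'\<close> and \<open>q\<close> are its exact iterated
    antiderivatives with the initial data of the geodesic, up to the sign of
    \<open>m\<close>.\<close>
  define q' where "q' t = w - t *\<^sub>R D x w w - (t\<^sup>2 / 2) *\<^sub>R D w w w - (t / 2) *\<^sub>R S x x w w - (t\<^sup>2 / 2) *\<^sub>R S x w w w - (t ^ 3 / 6) *\<^sub>R S w w w w" for t
  define q where "q t = x + t *\<^sub>R w - (t\<^sup>2 / 2) *\<^sub>R D x w w - (t ^ 3 / 6) *\<^sub>R D w w w - (t\<^sup>2 / 4) *\<^sub>R S x x w w - (t ^ 3 / 6) *\<^sub>R S x w w w - (t ^ 4 / 24) *\<^sub>R S w w w w" for t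
  define m where "m t = D (x + t *\<^sub>R w) w w + (1/2) *\<^sub>R S (x + t *\<^sub>R w) (x + t *\<^sub>R w) w w" for t
  have m: "m t = D x w w + t *\<^sub>R D w w w + (1/2) *\<^sub>R S x x w w + t *\<^sub>R S x w w w + (t\<^sup>2 / 2) *\<^sub>R S w w w w" for t
    unfolding m_def using S_sym1[of w x w w]
    by (simp add: D_simps S_simps power2_eq_square scaleR_add_right flip: scaleR_2)
  have Dq: "(q has_vector_derivative q' t) (at t within {0..1})" for t
    unfolding q_def[abs_def] q'_def has_vector_derivative_def
    by (auto intro!: derivative_eq_intros simp: algebra_simps eval_nat_numeral)
  have Dq': "(q' has_vector_derivative - m t) (at t within {0..1})" for t
    unfolding q'_def[abs_def] m has_vector_derivative_def
    by (auto intro!: derivative_eq_intros simp: algebra_simps eval_nat_numeral)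
  have b: "norm (- G (z t) (z' t) (z' t) - - m t) \<le> 29 * K\<^sup>2 * \<sigma> ^ 5" if t: "t \<in> {0..1}" for t
  proof -
    have s0: "0 \<le> \<sigma>" using n(1)[OF t] norm_ge_zero order_trans by blast
    have "norm (x + t *\<^sub>R w) \<le> norm x + norm (t *\<^sub>R w)" by (rule norm_triangle_ineq)
    also have "norm (t *\<^sub>R w) \<le> 1 * \<sigma>" using t n(2)[of 0] s0 unfolding norm_scaleR by (intro mult_mono) (auto simp: w_def)
    finally have y: "norm (x + t *\<^sub>R w) \<le> 2 * \<sigma>" using n(1)[of 0] by (simp add: x_def)
    have "norm (G (z t) (z' t) (z' t) - m t) \<le> 29 * K\<^sup>2 * \<sigma> ^ 5"
      unfolding m_def
      by (rule G_approx[OF \<sigma> n(1)[OF t] n(2)[OF t] n(2)[OF t] y])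
        (use geo_close[OF g \<sigma>(2) t] n[of 0] in \<open>auto simp: x_def w_def\<close>)
    then show ?thesis by (simp add: norm_minus_commute)
  qed
  have q0: "q' 0 = z' 0" "q 0 = z 0" by (simp_all add: q'_def q_def x_def w_def)
  have 1: "norm (z' t - q' t) \<le> 29 * K\<^sup>2 * \<sigma> ^ 5" if "t \<in> {0..1}" for t
    using mean_value_norm[OF has_vector_derivative_diff[OF D2 Dq'] b that] q0 by simp
  have "norm ((z 1 - q 1) - (z 0 - q 0)) \<le> 29 * K\<^sup>2 * \<sigma> ^ 5"
    by (rule mean_value_norm[OF has_vector_derivative_diff[OF D1 Dq] 1]) auto
  moreover have "q 1 = z 0 + z' 0 - E3 (z 0) (z' 0) - E4 (z 0) (z' 0)"
    by (simp add: q_def E3_def E4_def x_def w_def)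
  ultimately show ?thesis using q0 by simp
qed

lemma par_close:
  assumes g: "geo z z' \<sigma>" and p: "par z z' U \<sigma>" and \<sigma>: "\<sigma> \<le> r" and t: "t \<in> {0..1}"
  shows "norm (U t - U 0) \<le> K * \<sigma> ^ 3"
proof (rule mean_value_norm[OF _ _ t])
  fix t :: real assume t: "t \<in> {0..1}"
  show "(U has_vector_derivative - G (z t) (z' t) (U t)) (at t within {0..1})" using p t unfolding par_def by blast
  have n: "norm (z t) \<le> \<sigma>" "norm (z' t) \<le> \<sigma>" "norm (U t) \<le> \<sigma>" using g p t unfolding geo_def par_def by auto
  have "norm (G (z t) (z' t) (U t)) \<le> K * norm (z t) * norm (z' t) * norm (U t)"
    using n \<sigma> by (intro G_bound) auto
  also have "\<dots> \<le> K * \<sigma> * \<sigma> * \<sigma>" using n K order_trans[OF norm_ge_zero n(1)] by (intro mult_mono) auto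
  finally show "norm (- G (z t) (z' t) (U t)) \<le> K * \<sigma> ^ 3" by (simp add: eval_nat_numeral mult.assoc)
qed

text \<open>Same comparison as for geodesics, with a single integration. Only transport starting at
  the origin is expanded, so powers of \<open>t *\<^sub>R v\<close> are the only
  contributions.\<close>

lemma par_expand:
  assumes g: "geo z z' \<sigma>" and p: "par z z' U \<sigma>" and \<sigma>: "\<sigma> \<le> 1" "\<sigma> \<le> r" and z0: "z 0 = 0"
  shows "norm (U 1 - (U 0 - T3 (z' 0) (U 0) - T4 (z' 0) (U 0))) \<le> 29 * K\<^sup>2 * \<sigma> ^ 5"
proof -
  define v u where "v = z' 0" and "u = U 0"
  have D: "(U has_vector_derivative - G (z t) (z' t) (U t)) (at t within {0..1})"
    and n: "norm (z t) \<le> \<sigma>" "norm (z' t) \<le> \<sigma>" "norm (U t) \<le> \<sigma>" if "t \<in> {0..1}" for t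
    using g p that unfolding geo_def par_def by auto
  define q where "q t = u - (t\<^sup>2 / 2) *\<^sub>R D v v u - (t ^ 3 / 6) *\<^sub>R S v v v u" for t
  define m where "m t = D (t *\<^sub>R v) v u + (1/2) *\<^sub>R S (t *\<^sub>R v) (t *\<^sub>R v) v u" for t
  have m: "m t = t *\<^sub>R D v v u + (t\<^sup>2 / 2) *\<^sub>R S v v v u" for t
    unfolding m_def by (simp add: D_simps S_simps power2_eq_square)
  have Dq: "(q has_vector_derivative - m t) (at t within {0..1})" for t
    unfolding q_def[abs_def] m has_vector_derivative_def
    by (auto intro!: derivative_eq_intros simp: algebra_simps eval_nat_numeral)
  have b: "norm (- G (z t) (z' t) (U t) - - m t) \<le> 29 * K\<^sup>2 * \<sigma> ^ 5" if t: "t \<in> {0..1}" for t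
  proof -
    have s0: "0 \<le> \<sigma>" using n(1)[OF t] norm_ge_zero order_trans by blast
    have "norm (t *\<^sub>R v) \<le> 1 * \<sigma>" using t n(2)[of 0] s0 unfolding norm_scaleR by (intro mult_mono) (auto simp: v_def)
    then have y: "norm (t *\<^sub>R v) \<le> 2 * \<sigma>" using s0 by simp
    have "norm (G (z t) (z' t) (U t) - m t) \<le> 29 * K\<^sup>2 * \<sigma> ^ 5"
      unfolding m_def
      by (rule G_approx[OF \<sigma> n(1)[OF t] n(2)[OF t] n(3)[OF t] y])
        (use geo_close[OF g \<sigma>(2) t] par_close[OF g p \<sigma>(2) t] n[of 0] z0 in \<open>auto simp: v_def u_def\<close>)
    then show ?thesis by (simp add: norm_minus_commute)
  qed
  have "norm ((U 1 - q 1) - (U 0 - q 0)) \<le> 29 * K\<^sup>2 * \<sigma> ^ 5"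
    by (rule mean_value_norm[OF has_vector_derivative_diff[OF D Dq] b]) auto
  then show ?thesis by (simp add: q_def u_def v_def T3_def T4_def)
qed

end

lemma norm_scaleR_le: "norm a \<le> B \<Longrightarrow> 0 \<le> c \<Longrightarrow> norm (c *\<^sub>R a) \<le> c * B"
  by (simp add: mult_left_mono)

lemma norm_diff3:
  "norm a \<le> A \<Longrightarrow> norm b \<le> B \<Longrightarrow> norm c \<le> C \<Longrightarrow> norm (a - b - c) \<le> A + B + C"
  by (intro norm_diff_le)

section \<open>The logarithm of an iterated exponential and the error of a ladder step\<close>

context small_connection
begin

lemma E3_lip:
  assumes "norm x \<le> L" "norm w \<le> L" "norm x' \<le> L" "norm w' \<le> L" "norm (x - x') \<le> \<delta>" "norm (w - w') \<le> \<delta>"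
  shows "norm (E3 x w - E3 x' w') \<le> 2 * K * L\<^sup>2 * \<delta>"
proof -
  have "norm (D x w w - D x' w' w') \<le> 3 * K * L\<^sup>2 * \<delta>" "norm (D w w w - D w' w' w') \<le> 3 * K * L\<^sup>2 * \<delta>"
    by (rule D_lip; use assms in simp)+
  then have "norm ((1/2) *\<^sub>R (D x w w - D x' w' w') + (1/6) *\<^sub>R (D w w w - D w' w' w')) \<le>
      (1/2) * (3 * K * L\<^sup>2 * \<delta>) + (1/6) * (3 * K * L\<^sup>2 * \<delta>)"
    by (intro norm_triangle_mono norm_scaleR_le) auto
  then show ?thesis by (simp add: E3_def algebra_simps)
qed

lemma E4_lip:
  assumes "norm x \<le> L" "norm w \<le> L" "norm x' \<le> L" "norm w' \<le> L" "norm (x - x') \<le> \<delta>" "norm (w - w') \<le> \<delta>"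
  shows "norm (E4 x w - E4 x' w') \<le> 2 * K * L ^ 3 * \<delta>"
proof -
  have 1: "norm (S x x w w - S x' x' w' w') \<le> 4 * K * L ^ 3 * \<delta>" "norm (S x w w w - S x' w' w' w') \<le> 4 * K * L ^ 3 * \<delta>"
    "norm (S w w w w - S w' w' w' w') \<le> 4 * K * L ^ 3 * \<delta>"
    by (rule S_lip; use assms in simp)+
  then have "norm ((1/4) *\<^sub>R (S x x w w - S x' x' w' w') + (1/6) *\<^sub>R (S x w w w - S x' w' w' w') + (1/24) *\<^sub>R (S w w w w - S w' w' w' w')) \<le>
      (1/4) * (4 * K * L ^ 3 * \<delta>) + (1/6) * (4 * K * L ^ 3 * \<delta>) + (1/24) * (4 * K * L ^ 3 * \<delta>)"
    by (intro norm_triangle_mono norm_scaleR_le) auto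
  moreover have "0 \<le> 4 * K * L ^ 3 * \<delta>" using 1(1) norm_ge_zero order_trans by blast
  ultimately show ?thesis by (simp add: E4_def algebra_simps)
qed

lemma T3_lip:
  assumes "norm v \<le> L" "norm u \<le> L" "norm u' \<le> L" "norm (u - u') \<le> \<delta>"
  shows "norm (T3 v u - T3 v u') \<le> 2 * K * L\<^sup>2 * \<delta>"
proof -
  have \<delta>: "0 \<le> \<delta>" using assms(4) norm_ge_zero order_trans by blast
  have 1: "norm (D v v u - D v v u') \<le> 3 * K * L\<^sup>2 * \<delta>"
    by (rule D_lip; use assms \<delta> in simp)
  then have "0 \<le> 3 * K * L\<^sup>2 * \<delta>" using norm_ge_zero order_trans by blast
  moreover have "norm (T3 v u - T3 v u') = norm (D v v u - D v v u') / 2"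
    by (simp add: T3_def flip: scaleR_diff_right)
  ultimately show ?thesis using 1 by linarith
qed

lemma T4_lip:
  assumes "norm v \<le> L" "norm u \<le> L" "norm u' \<le> L" "norm (u - u') \<le> \<delta>"
  shows "norm (T4 v u - T4 v u') \<le> 2 * K * L ^ 3 * \<delta>"
proof -
  have \<delta>: "0 \<le> \<delta>" using assms(4) norm_ge_zero order_trans by blast
  have 1: "norm (S v v v u - S v v v u') \<le> 4 * K * L ^ 3 * \<delta>"
    by (rule S_lip; use assms \<delta> in simp)
  then have "0 \<le> 4 * K * L ^ 3 * \<delta>" using norm_ge_zero order_trans by blast
  moreover have "norm (T4 v u - T4 v u') = norm (S v v v u - S v v v u') / 6"
    by (simp add: T4_def flip: scaleR_diff_right)
  ultimately show ?thesis using 1 by linarith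
qed

text \<open>Following the two geodesics gives the end point in terms of \<open>v\<close> and
  \<open>u\<close>; it must equal \<open>h - E3 0 h - E4 0 h\<close> to order four. Solving for
  \<open>h\<close>, with \<open>v + u\<close> inserted in the corrections, gives \<open>h3\<close>
  and \<open>h4\<close>.\<close>

definition h3 :: "'e \<Rightarrow> 'e \<Rightarrow> 'e" where
  "h3 v u = E3 0 (v + u) - E3 0 v - T3 v u - E3 v u"
definition h4 :: "'e \<Rightarrow> 'e \<Rightarrow> 'e" where
  "h4 v u = E4 0 (v + u) - E4 0 v - T4 v u - E4 v u"

lemma h3_lip:
  assumes "norm v \<le> \<sigma>" "norm u \<le> \<sigma>" "norm u' \<le> \<sigma>"
  shows "norm (h3 v u - h3 v u') \<le> 24 * K * \<sigma>\<^sup>2 * norm (u - u')"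
proof -
  have n: "norm (v + a) \<le> 2 * \<sigma>" "norm v \<le> 2 * \<sigma>" "norm a \<le> 2 * \<sigma>" "norm (0::'e) \<le> 2 * \<sigma>" if "norm a \<le> \<sigma>" for a
    using norm_triangle_ineq[of v a] assms(1) that norm_ge_zero[of v] by (auto simp del: norm_ge_zero)
  note n = n[OF assms(2)] n[OF assms(3)]
  have "h3 v u - h3 v u' = (E3 0 (v + u) - E3 0 (v + u')) - (T3 v u - T3 v u') - (E3 v u - E3 v u')"
    by (simp add: h3_def)
  also have "norm \<dots> \<le> 2 * K * (2 * \<sigma>)\<^sup>2 * norm (u - u') + 2 * K * (2 * \<sigma>)\<^sup>2 * norm (u - u') + 2 * K * (2 * \<sigma>)\<^sup>2 * norm (u - u')"
    by (intro norm_diff3 E3_lip T3_lip n) auto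
  also have "\<dots> = 24 * K * \<sigma>\<^sup>2 * norm (u - u')" by (simp add: power2_eq_square)
  finally show ?thesis .
qed

lemma h4_lip:
  assumes "norm v \<le> \<sigma>" "norm u \<le> \<sigma>" "norm u' \<le> \<sigma>"
  shows "norm (h4 v u - h4 v u') \<le> 48 * K * \<sigma> ^ 3 * norm (u - u')"
proof -
  have n: "norm (v + a) \<le> 2 * \<sigma>" "norm v \<le> 2 * \<sigma>" "norm a \<le> 2 * \<sigma>" "norm (0::'e) \<le> 2 * \<sigma>" if "norm a \<le> \<sigma>" for a
    using norm_triangle_ineq[of v a] assms(1) that norm_ge_zero[of v] by (auto simp del: norm_ge_zero)
  note n = n[OF assms(2)] n[OF assms(3)]
  have "h4 v u - h4 v u' = (E4 0 (v + u) - E4 0 (v + u')) - (T4 v u - T4 v u') - (E4 v u - E4 v u')"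
    by (simp add: h4_def)
  also have "norm \<dots> \<le> 2 * K * (2 * \<sigma>) ^ 3 * norm (u - u') + 2 * K * (2 * \<sigma>) ^ 3 * norm (u - u') + 2 * K * (2 * \<sigma>) ^ 3 * norm (u - u')"
    by (intro norm_diff3 E4_lip T4_lip n) auto
  also have "\<dots> = 48 * K * \<sigma> ^ 3 * norm (u - u')" by (simp add: power3_eq_cube)
  finally show ?thesis .
qed

lemma h4_0: "h4 v 0 = 0"
  by (simp add: h4_def E4_def T4_def S_simps)

lemma E_neg: "E3 (- x) (- w) = - E3 x w" "E4 (- x) (- w) = E4 x w" "T3 (- x) (- w) = - T3 x w" "T4 (- x) (- w) = T4 x w"
  by (simp_all add: E3_def E4_def T3_def T4_def D_simps S_simps)

lemma h3_neg: "h3 (- v) (- u) = - h3 v u"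
  using E_neg(1)[of 0 "v + u"] E_neg(1)[of 0 v] E_neg(1,3)[of v u] by (simp add: h3_def)

lemma h4_neg: "h4 (- v) (- u) = h4 v u"
  using E_neg(2)[of 0 "v + u"] E_neg(2)[of 0 v] E_neg(2,4)[of v u] by (simp add: h4_def)

text \<open>\<open>c' 0\<close> is the logarithm \<open>h(v, u)\<close> of the introduction, for \<open>v = a' 0\<close> and \<open>u = U 0\<close>.\<close>

lemma double_exponential:
  assumes a: "geo a a' \<sigma>" "a 0 = 0" and U: "par a a' U \<sigma>" and b: "geo b b' \<sigma>" "b 0 = a 1" "b' 0 = U 1"
    and c: "geo c c' \<sigma>" "c 0 = 0" "c 1 = b 1" and \<sigma>: "\<sigma> \<le> 1" "\<sigma> \<le> r"
  shows "norm (c' 0 - (a' 0 + U 0 + h3 (a' 0) (U 0) + h4 (a' 0) (U 0))) \<le> 1000 * K\<^sup>2 * \<sigma> ^ 5"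
proof -
  define v u h where "v = a' 0" and "u = U 0" and "h = c' 0"
  have na: "norm (a t) \<le> \<sigma>" "norm (a' t) \<le> \<sigma>" "norm (U t) \<le> \<sigma>" "norm (c' t) \<le> \<sigma>" "norm (b t) \<le> \<sigma>" if "t \<in> {0..1}" for t
    using a U c b that unfolding geo_def par_def by auto
  have n: "norm v \<le> \<sigma>" "norm u \<le> \<sigma>" "norm h \<le> \<sigma>" "norm (U 1) \<le> \<sigma>" "norm (a 1) \<le> \<sigma>"
    using na unfolding v_def u_def h_def by auto
  have s0: "0 \<le> \<sigma>" using n(1) norm_ge_zero order_trans by blast
  have n2: "norm v \<le> 2 * \<sigma>" "norm u \<le> 2 * \<sigma>" "norm h \<le> 2 * \<sigma>" "norm (U 1) \<le> 2 * \<sigma>" "norm (a 1) \<le> 2 * \<sigma>"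
    "norm (v + u) \<le> 2 * \<sigma>" "norm (0::'e) \<le> 2 * \<sigma>"
    using n s0 norm_triangle_ineq[of v u] by auto
  let ?e = "K * \<sigma> ^ 3"
  have p1: "norm (a 1 - v) \<le> ?e" using geo_close(2)[OF a(1) \<sigma>(2), of 1] a(2) by (simp add: v_def)
  have U1: "norm (U 1 - u) \<le> ?e" using par_close[OF a(1) U \<sigma>(2), of 1] by (simp add: u_def)
  have b1: "norm (b 1 - (a 1 + U 1)) \<le> ?e" using geo_close(2)[OF b(1) \<sigma>(2), of 1] b(2,3) by simp
  have c1: "norm (b 1 - h) \<le> ?e" using geo_close(2)[OF c(1) \<sigma>(2), of 1] c(2,3) by (simp add: h_def)
  \<comment> \<open>All curves are straight up to cubic errors, so \<open>h\<close> agrees with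
    \<open>v + u\<close> to that order. That is enough inside \<open>E3\<close> and
    \<open>E4\<close>, whose arguments then cause errors of order five only.\<close>
  have "h - (v + u) = (b 1 - (a 1 + U 1)) + (a 1 - v) + (U 1 - u) - (b 1 - h)" by simp
  also have "norm \<dots> \<le> ?e + ?e + ?e + ?e" by (intro norm_diff_le norm_triangle_mono p1 U1 b1 c1)
  finally have hvu: "norm (h - (v + u)) \<le> 4 * ?e" by simp
  have e4: "?e \<le> 4 * ?e" using K s0 by simp
  have lip3: "norm (E3 x w - E3 x' w') \<le> 32 * K\<^sup>2 * \<sigma> ^ 5" if "norm x \<le> 2 * \<sigma>" "norm w \<le> 2 * \<sigma>" "norm x' \<le> 2 * \<sigma>" "norm w' \<le> 2 * \<sigma>"
    "norm (x - x') \<le> 4 * ?e" "norm (w - w') \<le> 4 * ?e" for x w x' w'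
  proof -
    have "norm (E3 x w - E3 x' w') \<le> 2 * K * (2 * \<sigma>)\<^sup>2 * (4 * ?e)" by (rule E3_lip[OF that])
    also have "\<dots> = 32 * K\<^sup>2 * \<sigma> ^ 5" by (simp add: eval_nat_numeral)
    finally show ?thesis .
  qed
  have lip4: "norm (E4 x w - E4 x' w') \<le> 64 * K\<^sup>2 * \<sigma> ^ 5" if "norm x \<le> 2 * \<sigma>" "norm w \<le> 2 * \<sigma>" "norm x' \<le> 2 * \<sigma>" "norm w' \<le> 2 * \<sigma>"
    "norm (x - x') \<le> 4 * ?e" "norm (w - w') \<le> 4 * ?e" for x w x' w'
  proof -
    have "norm (E4 x w - E4 x' w') \<le> 2 * K * (2 * \<sigma>) ^ 3 * (4 * ?e)" by (rule E4_lip[OF that])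
    also have "\<dots> = 64 * K\<^sup>2 * (\<sigma> ^ 5 * \<sigma>)" by (simp add: eval_nat_numeral)
    also have "\<dots> \<le> 64 * K\<^sup>2 * (\<sigma> ^ 5 * 1)" using s0 \<sigma> by (intro mult_left_mono) auto
    finally show ?thesis by simp
  qed
  have z: "norm (0 - 0::'e) \<le> 4 * ?e" using K s0 by simp
  note close = order_trans[OF p1 e4] order_trans[OF U1 e4] hvu z
  have pe: "norm (a 1 - (v - E3 0 v - E4 0 v)) \<le> 29 * K\<^sup>2 * \<sigma> ^ 5"
    using geo_expand[OF a(1) \<sigma>] a(2) by (simp add: v_def)
  have Ue: "norm (U 1 - (u - T3 v u - T4 v u)) \<le> 29 * K\<^sup>2 * \<sigma> ^ 5"
    using par_expand[OF a(1) U \<sigma> a(2)] by (simp add: v_def u_def)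
  have be: "norm (b 1 - (a 1 + U 1 - E3 (a 1) (U 1) - E4 (a 1) (U 1))) \<le> 29 * K\<^sup>2 * \<sigma> ^ 5"
    using geo_expand[OF b(1) \<sigma>] b(2,3) by simp
  have ce: "norm (b 1 - (h - E3 0 h - E4 0 h)) \<le> 29 * K\<^sup>2 * \<sigma> ^ 5"
    using geo_expand[OF c(1) \<sigma>] c(2,3) by (simp add: h_def)
  \<comment> \<open>Four brackets are expansion errors and four move \<open>E3\<close> and
    \<open>E4\<close> to the points \<open>v\<close>, \<open>u\<close> and \<open>v + u\<close>; the
    constants add up to 308.\<close>
  have eq: "h - (v + u + h3 v u + h4 v u) =
     (b 1 - (a 1 + U 1 - E3 (a 1) (U 1) - E4 (a 1) (U 1))) + (a 1 - (v - E3 0 v - E4 0 v)) + (U 1 - (u - T3 v u - T4 v u))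
     - (b 1 - (h - E3 0 h - E4 0 h)) - (E3 (a 1) (U 1) - E3 v u) - (E4 (a 1) (U 1) - E4 v u)
     + (E3 0 h - E3 0 (v + u)) + (E4 0 h - E4 0 (v + u))"
    by (simp add: h3_def h4_def algebra_simps)
  have "norm (h - (v + u + h3 v u + h4 v u)) \<le> 29 * K\<^sup>2 * \<sigma> ^ 5 + 29 * K\<^sup>2 * \<sigma> ^ 5 + 29 * K\<^sup>2 * \<sigma> ^ 5 + 29 * K\<^sup>2 * \<sigma> ^ 5
      + 32 * K\<^sup>2 * \<sigma> ^ 5 + 64 * K\<^sup>2 * \<sigma> ^ 5 + 32 * K\<^sup>2 * \<sigma> ^ 5 + 64 * K\<^sup>2 * \<sigma> ^ 5"
    unfolding eq by (intro norm_diff_le norm_triangle_mono pe Ue be ce lip3 lip4 n2 close)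
  also have "\<dots> \<le> 1000 * K\<^sup>2 * \<sigma> ^ 5" using s0 by simp
  finally show ?thesis unfolding v_def u_def h_def .
qed

text \<open>Adding the two expansions leaves the differences of \<open>h3\<close> and
  \<open>h4\<close> at \<open>- u'\<close> and \<open>- u\<close>, bounded by
  \<open>72 * K * \<sigma>\<^sup>2 * norm (u' - u)\<close>. As
  \<open>144 * K * \<sigma>\<^sup>2 \<le> 1\<close>, half of \<open>norm (u' - u)\<close> absorbs
  this, which shows that \<open>u' - u\<close> is of order four; reinserted, the differences become
  of order six.\<close>

lemma ladder_error:
  assumes h: "norm (h - (- v + u + h3 (- v) u + h4 (- v) u)) \<le> C * \<sigma> ^ 5"
    and h': "norm (- h - (v + - u' + h3 v (- u') + h4 v (- u'))) \<le> C * \<sigma> ^ 5"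
    and n: "norm v \<le> \<sigma>" "norm u \<le> \<sigma>" "norm u' \<le> \<sigma>" and \<sigma>: "\<sigma> \<le> 1" "144 * K * \<sigma>\<^sup>2 \<le> 1" and C: "0 \<le> C"
  shows "norm (u' - u - 2 *\<^sub>R h4 v (- u)) \<le> (72 * K * (192 * K + 4 * C) + 2 * C) * \<sigma> ^ 5"
proof -
  have s0: "0 \<le> \<sigma>" using n(1) norm_ge_zero order_trans by blast
  let ?d = "norm (u' - u)"
  have hn: "h3 (- v) u = - h3 v (- u)" "h4 (- v) u = h4 v (- u)"
    using h3_neg[of v "- u"] h4_neg[of v "- u"] by auto
  have eq: "u' - u - 2 *\<^sub>R h4 v (- u) = (h3 v (- u') - h3 v (- u)) + (h4 v (- u') - h4 v (- u))
     + (h - (- v + u + h3 (- v) u + h4 (- v) u)) + (- h - (v + - u' + h3 v (- u') + h4 v (- u')))"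
    unfolding hn by (simp add: algebra_simps scaleR_2)
  have d: "norm (- u' - - u) = ?d" by (simp add: norm_minus_commute)
  have 3: "norm (h3 v (- u') - h3 v (- u)) \<le> 24 * K * \<sigma>\<^sup>2 * ?d"
    using h3_lip[OF n(1), of "- u'" "- u"] n unfolding d by simp
  have "norm (h4 v (- u') - h4 v (- u)) \<le> 48 * K * \<sigma> ^ 3 * ?d"
    using h4_lip[OF n(1), of "- u'" "- u"] n unfolding d by simp
  also have "\<dots> \<le> 48 * K * \<sigma>\<^sup>2 * ?d"
    using K s0 \<sigma> power_decreasing[of 2 3 \<sigma>] by (intro mult_right_mono mult_left_mono) auto
  finally have 4: "norm (h4 v (- u') - h4 v (- u)) \<le> 48 * K * \<sigma>\<^sup>2 * ?d" .
  have main: "norm (u' - u - 2 *\<^sub>R h4 v (- u)) \<le> 24 * K * \<sigma>\<^sup>2 * ?d + 48 * K * \<sigma>\<^sup>2 * ?d + C * \<sigma> ^ 5 + C * \<sigma> ^ 5"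
    unfolding eq by (intro norm_triangle_mono 3 4 h h')
  then have main': "norm (u' - u - 2 *\<^sub>R h4 v (- u)) \<le> 72 * K * \<sigma>\<^sup>2 * ?d + 2 * C * \<sigma> ^ 5" by linarith
  have "norm (h4 v (- u)) \<le> 48 * K * \<sigma> ^ 3 * norm u"
    using h4_lip[OF n(1), of "- u" 0] n s0 unfolding h4_0 by simp
  also have "\<dots> \<le> 48 * K * \<sigma> ^ 3 * \<sigma>" using n K s0 by (intro mult_left_mono) auto
  also have "\<dots> = 48 * K * \<sigma> ^ 4" by (simp add: eval_nat_numeral)
  finally have h4b: "norm (2 *\<^sub>R h4 v (- u)) \<le> 96 * K * \<sigma> ^ 4" by simp
  have "?d \<le> norm (u' - u - 2 *\<^sub>R h4 v (- u)) + norm (2 *\<^sub>R h4 v (- u))"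
    using norm_triangle_ineq[of "u' - u - 2 *\<^sub>R h4 v (- u)" "2 *\<^sub>R h4 v (- u)"] by simp
  also have "\<dots> \<le> (72 * K * \<sigma>\<^sup>2 * ?d + 2 * C * \<sigma> ^ 5) + 96 * K * \<sigma> ^ 4" by (intro add_mono main' h4b)
  also have "\<dots> \<le> 1 / 2 * ?d + 2 * C * \<sigma> ^ 4 + 96 * K * \<sigma> ^ 4"
  proof (intro add_mono order_refl)
    have "72 * K * \<sigma>\<^sup>2 \<le> 1 / 2" using \<sigma>(2) by simp
    then show "72 * K * \<sigma>\<^sup>2 * ?d \<le> 1 / 2 * ?d" by (rule mult_right_mono) simp
    show "2 * C * \<sigma> ^ 5 \<le> 2 * C * \<sigma> ^ 4" using C s0 \<sigma>(1) power_decreasing[of 4 5 \<sigma>] by (intro mult_left_mono) auto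
  qed
  finally have "?d \<le> (192 * K + 4 * C) * \<sigma> ^ 4" by (simp add: algebra_simps)
  then have "72 * K * \<sigma>\<^sup>2 * ?d \<le> 72 * K * \<sigma>\<^sup>2 * ((192 * K + 4 * C) * \<sigma> ^ 4)"
    using K by (intro mult_left_mono) auto
  also have "\<dots> = 72 * K * (192 * K + 4 * C) * (\<sigma> ^ 5 * \<sigma>)" by (simp add: eval_nat_numeral)
  also have "\<dots> \<le> 72 * K * (192 * K + 4 * C) * (\<sigma> ^ 5 * 1)"
    using K C s0 \<sigma> by (intro mult_left_mono) auto
  finally show ?thesis using main' by (simp add: algebra_simps)
qed

text \<open>Here the terms are grouped as values of the differentiated curvature: by
  \<open>cov_curvature_m\<close> the pairs on the right are the components of (nabla_v R)(u, v) and
  (nabla_u R)(u, v). The identity uses only the symmetry of \<open>S\<close> within its first and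
  within its last pair of arguments.\<close>

lemma twice_h4:
  "2 *\<^sub>R h4 v (- u) = (1/12) *\<^sub>R ((S v u v (5 *\<^sub>R u - 2 *\<^sub>R v) - S v v u (5 *\<^sub>R u - 2 *\<^sub>R v))
     + (S u u v (v - 2 *\<^sub>R u) - S u v u (v - 2 *\<^sub>R u)))"
proof -
  have s: "S u v = S v u" using S_sym1 by blast
  have t: "S a b u v = S a b v u" for a b by (rule S_sym2)
  show ?thesis
    unfolding h4_def E4_def T4_def
    by (rule euclidean_eqI) (simp add: S_simps s t inner_simps algebra_simps)
qed

end

section \<open>Coordinates adapted to the midpoint\<close>

text \<open>
  The substitution \<open>x = x\<^sub>0 + z - \<Gamma>\<^sub>0(z, z) / 2\<close>, where \<open>\<Gamma>\<^sub>0\<close> is the Christoffel tensor at \<open>m\<close>,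
  yields coordinates \<open>z\<close> whose Christoffel tensor \<open>G\<close> vanishes at \<open>m\<close>. The coordinates need not belong
  to the atlas; points and tangent vectors are transferred by \<open>pt\<close> and \<open>tvz\<close>.
\<close>

locale adapted_chart = affine_manifold A nabla
  for A :: "('a::{t2_space, second_countable_topology}, 'e::euclidean_space) chart set" and nabla +
  fixes c :: "('a, 'e) chart" and m :: 'a and \<rho> :: real
  assumes c: "c \<in> A" and m: "m \<in> cdom c" and torsion_free: "torsion_free A nabla" and \<rho>: "0 < \<rho>"
    and P_in': "\<And>z. norm z < \<rho> \<Longrightarrow> cmap c m + z - (1/2) *\<^sub>R christoffel A nabla c m z z \<in> cimage c"
    and small: "\<And>z h. norm z < \<rho> \<Longrightarrow> norm (christoffel A nabla c m z h) \<le> norm h / 2"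
begin

abbreviation \<Gamma>0 :: "'e \<Rightarrow> 'e \<Rightarrow> 'e" where "\<Gamma>0 \<equiv> christoffel A nabla c m"

definition P :: "'e \<Rightarrow> 'e" where "P z = cmap c m + z - (1/2) *\<^sub>R \<Gamma>0 z z"
definition dP :: "'e \<Rightarrow> 'e \<Rightarrow> 'e" where "dP z h = h - \<Gamma>0 z h"
definition iP :: "'e \<Rightarrow> 'e \<Rightarrow> 'e" where "iP z = inv (dP z)"
text \<open>The transformation law of Christoffel symbols under \<open>P\<close>, whose derivative
  is \<open>dP\<close> and whose second derivative is the constant map \<open>- \<Gamma>0\<close>.
  At the origin the two terms cancel.\<close>

definition G :: "'e \<Rightarrow> 'e \<Rightarrow> 'e \<Rightarrow> 'e" where
  "G z a b = iP z (chr c (P z) (dP z a) (dP z b) - \<Gamma>0 a b)"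
definition D :: "'e \<Rightarrow> 'e \<Rightarrow> 'e \<Rightarrow> 'e" where
  "D z a b = FD (\<lambda>y. G y a b) 0 z"
definition S :: "'e \<Rightarrow> 'e \<Rightarrow> 'e \<Rightarrow> 'e \<Rightarrow> 'e" where
  "S w z a b = FD (\<lambda>y. FD (\<lambda>y. G y a b) y z) 0 w"
definition pt :: "'e \<Rightarrow> 'a" where "pt z = cinv c (P z)"
definition tvz :: "'e \<Rightarrow> 'e \<Rightarrow> ('a, 'e) tvec" where "tvz z a = tv c (pt z) (dP z a)"

lemma P_in: "norm z < \<rho> \<Longrightarrow> P z \<in> cimage c"
  unfolding P_def by (rule P_in')

lemma pt_in: "norm z < \<rho> \<Longrightarrow> pt z \<in> cdom c"
  unfolding pt_def by (intro cinv_in c P_in)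

lemma cmap_pt: "norm z < \<rho> \<Longrightarrow> cmap c (pt z) = P z"
  unfolding pt_def by (intro cmap_cinv c P_in)

lemma bilinear_\<Gamma>0: "bilinear \<Gamma>0"
  by (rule bilinear_christoffel[OF c m])

lemma \<Gamma>0_sym: "\<Gamma>0 a b = \<Gamma>0 b a"
  by (rule christoffel_symmetric[OF torsion_free c m])

lemma bounded_\<Gamma>0: "bounded_bilinear \<Gamma>0"
  using bilinear_\<Gamma>0 by (simp add: bilinear_conv_bounded_bilinear)

lemma linear_dP: "linear (dP z)"
  unfolding dP_def[abs_def]
  using bilinear_\<Gamma>0 unfolding bilinear_def by (intro linear_compose_sub linear_ident) blast

text \<open>\<open>dP z\<close> differs from the identity by at most one half on the ball of radius
  \<open>\<rho>\<close>. It is therefore injective, hence bijective in finite dimension, and its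
  inverse is bounded by 2.\<close>

lemma dP_lower: "norm z < \<rho> \<Longrightarrow> norm h \<le> 2 * norm (dP z h)"
  using norm_triangle_ineq2[of h "\<Gamma>0 z h"] small[of z h] by (simp add: dP_def)

lemma bij_dP: "norm z < \<rho> \<Longrightarrow> bij (dP z)"
proof -
  assume z: "norm z < \<rho>"
  have "inj (dP z)"
    using dP_lower[OF z] by (simp add: linear_injective_0[OF linear_dP]) (metis mult_zero_right norm_le_zero_iff norm_zero)
  then show ?thesis using linear_injective_imp_surjective[OF linear_dP] by (simp add: bij_def)
qed

lemma iP_dP: "norm z < \<rho> \<Longrightarrow> iP z (dP z a) = a"
  unfolding iP_def using bij_dP by (simp add: bij_is_inj)

lemma dP_iP: "norm z < \<rho> \<Longrightarrow> dP z (iP z a) = a"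
  unfolding iP_def using bij_dP by (simp add: bij_is_surj surj_f_inv_f)

lemma linear_iP:
  assumes z: "norm z < \<rho>"
  shows "linear (iP z)"
proof (rule linearI)
  show "iP z (a + b) = iP z a + iP z b" for a b
  proof -
    have "iP z (a + b) = iP z (dP z (iP z a + iP z b))" by (simp add: linear_add[OF linear_dP] dP_iP[OF z])
    then show ?thesis by (simp only: iP_dP[OF z])
  qed
  show "iP z (r *\<^sub>R a) = r *\<^sub>R iP z a" for r a
  proof -
    have "iP z (r *\<^sub>R a) = iP z (dP z (r *\<^sub>R iP z a))" by (simp add: linear_scale[OF linear_dP] dP_iP[OF z])
    then show ?thesis by (simp only: iP_dP[OF z])
  qed
qed

lemma iP_bound: "norm z < \<rho> \<Longrightarrow> norm (iP z a) \<le> 2 * norm a"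
  using dP_lower[of z "iP z a"] by (simp add: dP_iP)

lemma smooth_dP: "smooth_on (ball 0 \<rho>) (\<lambda>z. dP z a)"
  unfolding dP_def
  by (intro smooth_on_diff smooth_on_const open_ball smooth_on_id
      smooth_on_bounded_linear[OF bounded_bilinear.bounded_linear_left[OF bounded_\<Gamma>0]])

lemma smooth_iP: "smooth_on (ball 0 \<rho>) (\<lambda>z. iP z a)"
  unfolding smooth_on_def
proof
  show "Ck_on k (ball 0 \<rho>) (\<lambda>z. iP z a)" for k
    by (rule Ck_on_inverse_family[where L = dP and K = 2])
      (use linear_dP linear_iP iP_dP dP_iP iP_bound smooth_on_Ck[OF smooth_dP] in auto)
qed

text \<open>Symmetry of \<open>\<Gamma>0\<close>, that is torsion-freeness, merges the two halves of
  the derivative of the quadratic term.\<close>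

lemma P_derivative: "(P has_derivative dP z) (at z)"
proof -
  have "(P has_derivative (\<lambda>h. h - (1/2) *\<^sub>R (\<Gamma>0 z h + \<Gamma>0 h z))) (at z)"
    unfolding P_def[abs_def]
    by (auto intro!: derivative_eq_intros bounded_bilinear.FDERIV[OF bounded_\<Gamma>0])
  moreover have "h - (1/2) *\<^sub>R (\<Gamma>0 z h + \<Gamma>0 h z) = dP z h" for h
    unfolding dP_def \<Gamma>0_sym[of h z] by (simp flip: scaleR_2)
  ultimately show ?thesis by simp
qed

lemma smooth_P: "smooth_on (ball 0 \<rho>) P"
  unfolding smooth_on_def
proof
  show "Ck_on k (ball 0 \<rho>) P" for k
  proof (cases k)
    case 0
    then show ?thesis using P_derivative
      by (auto intro!: continuous_at_imp_continuous_on has_derivative_continuous)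
  next
    case (Suc j)
    show ?thesis unfolding Suc
      by (rule Ck_on_SucI[OF open_ball P_derivative smooth_on_Ck[OF smooth_dP]])
  qed
qed

lemma bilinear_chr: "norm z < \<rho> \<Longrightarrow> bilinear (chr c (P z))"
  by (intro bilinear_christoffel c cinv_in P_in)

lemma smooth_chr_P:
  assumes a: "smooth_on (ball 0 \<rho>) a" and b: "smooth_on (ball 0 \<rho>) b"
  shows "smooth_on (ball 0 \<rho>) (\<lambda>z. chr c (P z) (a z) (b z))"
proof (rule smooth_on_family[OF open_ball _ _ b, where L = "\<lambda>z. chr c (P z) (a z)"])
  show "linear (chr c (P z) (a z))" if "z \<in> ball 0 \<rho>" for z
    using bilinear_chr[of z] that unfolding bilinear_def by simp
  fix j
  show "smooth_on (ball 0 \<rho>) (\<lambda>z. chr c (P z) (a z) j)"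
  proof (rule smooth_on_family[OF open_ball _ _ a, where L = "\<lambda>z i. chr c (P z) i j"])
    show "linear (\<lambda>i. chr c (P z) i j)" if "z \<in> ball 0 \<rho>" for z
      using bilinear_chr[of z] that unfolding bilinear_def by simp
    show "smooth_on (ball 0 \<rho>) (\<lambda>z. chr c (P z) i j)" for i
      by (rule smooth_on_comp[OF open_ball _ smooth_chr[OF c] smooth_P]) (use P_in in auto)
  qed
qed

lemma smooth_G: "smooth_on (ball 0 \<rho>) (\<lambda>z. G z a b)"
  unfolding G_def
proof (rule smooth_on_family[OF open_ball _ smooth_iP])
  show "linear (iP z)" if "z \<in> ball 0 \<rho>" for z using linear_iP that by simp
  show "smooth_on (ball 0 \<rho>) (\<lambda>z. chr c (P z) (dP z a) (dP z b) - \<Gamma>0 a b)"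
    by (intro smooth_on_diff smooth_on_const open_ball smooth_chr_P smooth_dP)
qed

lemma bilinear_G:
  assumes "norm z < \<rho>"
  shows "bilinear (G z)"
  unfolding bilinear_def
proof (intro conjI allI)
  note l = linear_iP[OF assms] and d = linear_dP[of z]
  note b = bilinear_chr[OF assms] bilinear_\<Gamma>0
  show "linear (G z a)" for a
    by (rule linearI) (simp_all add: G_def linear_add[OF d] linear_scale[OF d] linear_add[OF l] linear_scale[OF l]
      linear_diff[OF l] bilinear_radd[OF b(1)] bilinear_radd[OF b(2)] bilinear_rmul[OF b(1)] bilinear_rmul[OF b(2)] algebra_simps)
  show "linear (\<lambda>a. G z a b)" for b
    by (rule linearI) (simp_all add: G_def linear_add[OF d] linear_scale[OF d] linear_add[OF l] linear_scale[OF l]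
      linear_diff[OF l] bilinear_ladd[OF b(1)] bilinear_ladd[OF b(2)] bilinear_lmul[OF b(1)] bilinear_lmul[OF b(2)] algebra_simps)
qed

lemma linear_G: "norm z < \<rho> \<Longrightarrow> linear (G z a)" "norm z < \<rho> \<Longrightarrow> linear (\<lambda>a. G z a b)"
  using bilinear_G unfolding bilinear_def by auto

lemma G_sym: "norm z < \<rho> \<Longrightarrow> G z a b = G z b a"
  unfolding G_def using christoffel_symmetric[OF torsion_free c cinv_in[OF c P_in[of z]]] \<Gamma>0_sym by metis

lemma P_0 [simp]: "P 0 = cmap c m" and dP_0 [simp]: "dP 0 a = a" and pt_0 [simp]: "pt 0 = m"
  using bilinear_lzero[OF bilinear_\<Gamma>0] by (simp_all add: P_def dP_def pt_def cinv_cmap c m)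

lemma iP_0 [simp]: "iP 0 a = a"
  using iP_dP[of 0 a] \<rho> by simp

lemma G_0 [simp]: "G 0 a b = 0"
  by (simp add: G_def cinv_cmap c m)

lemma G_differentiable: "norm z < \<rho> \<Longrightarrow> (\<lambda>y. G y a b) differentiable (at z)"
  by (rule smooth_on_differentiable[OF smooth_G]) simp

lemma G'_differentiable: "norm z < \<rho> \<Longrightarrow> (\<lambda>y. FD (\<lambda>y. G y a b) y h) differentiable (at z)"
  by (rule smooth_on_differentiable[OF smooth_on_FD[OF smooth_G]]) simp

lemma linear_DG:
  assumes "norm z < \<rho>"
  shows "linear (FD (\<lambda>y. G y a b) z)" "linear (\<lambda>a. FD (\<lambda>y. G y a b) z h)" "linear (\<lambda>b. FD (\<lambda>y. G y a b) z h)"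
proof -
  show "linear (FD (\<lambda>y. G y a b) z)" by (rule linear_FD[OF G_differentiable[OF assms]])
  show "linear (\<lambda>a. FD (\<lambda>y. G y a b) z h)"
    by (rule linear_FD_arg[where S = "ball 0 \<rho>" and L = "\<lambda>y a. G y a b"])
      (use assms G_differentiable linear_G in auto)
  show "linear (\<lambda>b. FD (\<lambda>y. G y a b) z h)"
    by (rule linear_FD_arg[where S = "ball 0 \<rho>" and L = "\<lambda>y b. G y a b"])
      (use assms G_differentiable linear_G in auto)
qed

text \<open>All bounds are taken on the closed ball of half the radius, where compactness applies.
  The linear bound of \<open>G\<close> is its Lipschitz bound against the origin, and
  \<open>?K\<close> dominates the four separate constants.\<close>

lemma small_connection_G: "\<exists>K. small_connection G D S (\<rho> / 2) K"
proof -
  let ?B = "cball (0::'e) (\<rho> / 2)"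
  have B: "norm z < \<rho>" if "norm z \<le> \<rho> / 2" for z :: 'e using that \<rho> by simp
  have sub: "?B \<subseteq> ball 0 \<rho>" using B by (auto simp: subset_iff)
  have D_lin: "linear (\<lambda>z. D z a b)" "linear (\<lambda>a. D z a b)" "linear (D z a)" for z a b
    unfolding D_def[abs_def] using linear_DG[of 0] \<rho> by auto
  have S_lin: "linear (\<lambda>w. S w z a b)" "linear (\<lambda>z. S w z a b)" "linear (\<lambda>a. S w z a b)" "linear (S w z a)" for w z a b
  proof -
    show "linear (\<lambda>w. S w z a b)" unfolding S_def using G'_differentiable \<rho> by (intro linear_FD) simp
    show "linear (\<lambda>z. S w z a b)" unfolding S_def
      by (rule linear_FD_arg[where S = "ball 0 \<rho>" and L = "\<lambda>y z. FD (\<lambda>y. G y a b) y z"])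
        (use \<rho> G'_differentiable linear_DG in auto)
    show "linear (\<lambda>a. S w z a b)" unfolding S_def
      by (rule linear_FD_arg[where S = "ball 0 \<rho>" and L = "\<lambda>y a. FD (\<lambda>y. G y a b) y z"])
        (use \<rho> G'_differentiable linear_DG in auto)
    show "linear (S w z a)" unfolding S_def[abs_def]
      by (rule linear_FD_arg[where S = "ball 0 \<rho>" and L = "\<lambda>y b. FD (\<lambda>y. G y a b) y z"])
        (use \<rho> G'_differentiable linear_DG in auto)
  qed
  have S_sym1: "S w z a b = S z w a b" for w z a b
    unfolding S_def by (rule symmetric_second_derivative[OF smooth_on_Ck[OF smooth_G]]) (use \<rho> in auto)
  have S_sym2: "S w z a b = S w z b a" for w z a b
  proof -
    have "FD (\<lambda>y. G y a b) y = FD (\<lambda>y. G y b a) y" if "y \<in> ball 0 \<rho>" for y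
      by (rule FD_cong[OF open_ball that]) (use G_sym in auto)
    then show ?thesis unfolding S_def
      by (subst FD_cong[where S = "ball 0 \<rho>" and g = "\<lambda>y. FD (\<lambda>y. G y b a) y z"]) (use \<rho> in auto)
  qed
  have "\<exists>C\<ge>0. \<forall>p\<in>?B \<times> ?B. \<forall>a b. norm (G (fst p) a b - G (snd p) a b) \<le> C * norm (fst p - snd p) * norm a * norm b"
  proof (rule bilinear_family_bound)
    show "bilinear (\<lambda>a b. G (fst p) a b - G (snd p) a b)" if "p \<in> ?B \<times> ?B" for p
      using that linear_G[OF B] unfolding bilinear_def by (auto intro!: linear_compose_sub)
    show "\<exists>C. \<forall>p\<in>?B \<times> ?B. norm (G (fst p) a b - G (snd p) a b) \<le> C * norm (fst p - snd p)" for a b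
      using Ck_on_Lipschitz[OF smooth_on_Ck[OF smooth_G] compact_cball sub convex_cball, of a b] by auto
  qed auto
  then obtain C1 where C1: "C1 \<ge> 0" "\<And>y z a b. norm y \<le> \<rho> / 2 \<Longrightarrow> norm z \<le> \<rho> / 2 \<Longrightarrow>
      norm (G y a b - G z a b) \<le> C1 * norm (y - z) * norm a * norm b" by force
  have "\<exists>C\<ge>0. \<forall>z\<in>?B. \<forall>a b. norm (G z a b - D z a b - (1/2) *\<^sub>R S z z a b) \<le> C * norm z ^ 3 * norm a * norm b"
  proof (rule bilinear_family_bound)
    show "bilinear (\<lambda>a b. G z a b - D z a b - (1/2) *\<^sub>R S z z a b)" if "z \<in> ?B" for z
      using that linear_G[OF B] D_lin S_lin unfolding bilinear_def
      by (auto intro!: linear_compose_sub linear_compose_scale_right)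
    show "\<exists>C. \<forall>z\<in>?B. norm (G z a b - D z a b - (1/2) *\<^sub>R S z z a b) \<le> C * norm z ^ 3" for a b
    proof -
      obtain C where "\<forall>z. norm z \<le> \<rho> / 2 \<longrightarrow> norm (G z a b - G 0 a b - FD (\<lambda>z. G z a b) 0 z -
          (1/2) *\<^sub>R FD (\<lambda>y. FD (\<lambda>z. G z a b) y z) 0 z) \<le> C * norm z ^ 3"
        using Taylor_third_order[OF smooth_G[of a b], of "\<rho> / 2"] \<rho> by auto
      then show ?thesis unfolding D_def S_def by (intro exI[of _ C]) simp
    qed
  qed auto
  then obtain C2 where C2: "C2 \<ge> 0" "\<And>z a b. norm z \<le> \<rho> / 2 \<Longrightarrow>
      norm (G z a b - D z a b - (1/2) *\<^sub>R S z z a b) \<le> C2 * norm z ^ 3 * norm a * norm b" by auto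
  have "\<exists>C\<ge>0. \<forall>z\<in>UNIV. \<forall>a b. norm (D z a b) \<le> C * norm z * norm a * norm b"
  proof (rule bilinear_family_bound)
    show "bilinear (D z)" for z using D_lin unfolding bilinear_def by auto
    show "\<exists>C. \<forall>z\<in>UNIV. norm (D z a b) \<le> C * norm z" for a b
      using bounded_linear.bounded[OF D_lin(1)[of a b, unfolded linear_conv_bounded_linear]]
      by (auto simp: mult.commute)
  qed auto
  then obtain C3 where C3: "C3 \<ge> 0" "\<And>z a b. norm (D z a b) \<le> C3 * norm z * norm a * norm b" by auto
  have "\<exists>C\<ge>0. \<forall>p\<in>UNIV. \<forall>a b. norm (S (fst p) (snd p) a b) \<le> C * (norm (fst p) * norm (snd p)) * norm a * norm b"
  proof (rule bilinear_family_bound)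
    show "bilinear (\<lambda>a b. S (fst p) (snd p) a b)" for p using S_lin unfolding bilinear_def by auto
    show "\<exists>C. \<forall>p\<in>UNIV. norm (S (fst p) (snd p) a b) \<le> C * (norm (fst p) * norm (snd p))" for a b
    proof -
      have "bilinear (\<lambda>w z. S w z a b)" using S_lin unfolding bilinear_def by auto
      then obtain C where "\<And>w z. norm (S w z a b) \<le> norm w * norm z * C"
        using bounded_bilinear.bounded by (metis bilinear_conv_bounded_bilinear)
      then show ?thesis by (intro exI[of _ C]) (auto simp: mult_ac)
    qed
  qed auto
  then obtain C4 where C4: "C4 \<ge> 0" "\<And>w z a b. norm (S w z a b) \<le> C4 * (norm w * norm z) * norm a * norm b" by force
  let ?K = "1 + C1 + C2 + C3 + C4"
  have "small_connection G D S (\<rho> / 2) ?K"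
  proof (rule small_connection.intro)
    show "0 < \<rho> / 2" "1 \<le> ?K" using \<rho> C1 C2 C3 C4 by auto
    show "bilinear (G z)" if "norm z \<le> \<rho> / 2" for z by (rule bilinear_G[OF B[OF that]])
    show "continuous_on ?B (\<lambda>z. G z a b)" for a b
      using continuous_on_subset[OF smooth_on_continuous[OF smooth_G] sub] .
    fix w y z a b :: 'e
    have k: "x \<le> ?K * t * norm a * norm b" if "x \<le> C * t * norm a * norm b" "C \<le> ?K" "0 \<le> t" for x C t
    proof -
      have "C * t * norm a * norm b \<le> ?K * t * norm a * norm b" using that by (intro mult_right_mono) auto
      then show ?thesis using that by linarith
    qed
    show l: "norm (G y a b - G z a b) \<le> ?K * norm (y - z) * norm a * norm b" if "norm y \<le> \<rho> / 2" "norm z \<le> \<rho> / 2"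
      by (rule k[OF C1(2)[OF that]]) (use C2 C3 C4 in auto)
    show "norm (G z a b) \<le> ?K * norm z * norm a * norm b" if "norm z \<le> \<rho> / 2"
      using k[OF C1(2)[OF that, of 0 a b]] \<rho> C2 C3 C4 by simp
    show "norm (G z a b - D z a b - (1/2) *\<^sub>R S z z a b) \<le> ?K * norm z ^ 3 * norm a * norm b" if "norm z \<le> \<rho> / 2"
      by (rule k[OF C2(2)[OF that]]) (use C1 C3 C4 in auto)
    show "norm (D z a b) \<le> ?K * norm z * norm a * norm b"
      by (rule k[OF C3(2)]) (use C1 C2 C4 in auto)
    show "norm (S w z a b) \<le> ?K * norm w * norm z * norm a * norm b"
      using k[OF C4(2)[of w z a b]] C1 C2 C3 by (simp add: mult.assoc)
  qed (fact D_lin S_lin S_sym1 S_sym2)+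
  then show ?thesis by blast
qed

section \<open>Exponential map, logarithm and transport in adapted coordinates\<close>

lemma tvz_apply: "norm z < \<rho> \<Longrightarrow> tvz z a c = dP z a"
  unfolding tvz_def by (simp add: c pt_in)

lemma tvz_neg: "norm z < \<rho> \<Longrightarrow> tvz z (- a) = - tvz z a"
  using tv_scaleR[OF c pt_in, of z "-1" "dP z a"] linear_neg[OF linear_dP] by (simp add: tvz_def)

lemma tvz_0: "tvz 0 a = tv c m a"
  by (simp add: tvz_def)

lemma tangent_tvz_0: "v \<in> tangent_space A m \<Longrightarrow> tvz 0 (v c) = v"
  unfolding tvz_0 by (rule tangent_tv[OF _ c m])

text \<open>Position and velocity come with uniform bounds; the one on the velocity is passed on to
  \<open>parallel_unique\<close> through \<open>zcurve_bound\<close>.\<close>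

definition zcurve :: "(real \<Rightarrow> 'e) \<Rightarrow> (real \<Rightarrow> 'e) \<Rightarrow> bool" where
  "zcurve z z' \<longleftrightarrow> (\<exists>s<\<rho>. \<exists>M. \<forall>t\<in>{0..1}. (z has_vector_derivative z' t) (at t within {0..1}) \<and> norm (z t) \<le> s \<and> norm (z' t) \<le> M)"

text \<open>The equation of parallel transport in adapted coordinates; \<open>zpar z z' z'\<close>
  is the geodesic equation.\<close>

definition zpar :: "(real \<Rightarrow> 'e) \<Rightarrow> (real \<Rightarrow> 'e) \<Rightarrow> (real \<Rightarrow> 'e) \<Rightarrow> bool" where
  "zpar z z' w \<longleftrightarrow> (\<forall>t\<in>{0..1}. (w has_vector_derivative - G (z t) (z' t) (w t)) (at t within {0..1}))"

lemma zcurve_chart: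
  assumes z: "zcurve z z'"
  shows zcurve_small: "\<And>t. t \<in> {0..1} \<Longrightarrow> norm (z t) < \<rho>"
    and zcurve_in: "\<And>t. t \<in> {0..1} \<Longrightarrow> P (z t) \<in> cimage c"
    and zcurve_deriv: "\<And>t. t \<in> {0..1} \<Longrightarrow> ((\<lambda>t. P (z t)) has_vector_derivative dP (z t) (z' t)) (at t within {0..1})"
    and zcurve_bound: "\<exists>M. \<forall>t\<in>{0..1}. norm (dP (z t) (z' t)) \<le> M"
proof -
  obtain s M where *: "s < \<rho>" "\<And>t. t \<in> {0..1} \<Longrightarrow> (z has_vector_derivative z' t) (at t within {0..1}) \<and> norm (z t) \<le> s \<and> norm (z' t) \<le> M"
    using z unfolding zcurve_def by blast
  show sm: "norm (z t) < \<rho>" if "t \<in> {0..1}" for t using * that by fastforce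
  then show "P (z t) \<in> cimage c" if "t \<in> {0..1}" for t using P_in that by blast
  show "((\<lambda>t. P (z t)) has_vector_derivative dP (z t) (z' t)) (at t within {0..1})" if "t \<in> {0..1}" for t
    using has_vector_derivative_compose_at[of z "z' t" t "{0..1}" P] *(2)[OF that] P_derivative
    by (metis FD_I differentiableI)
  have "norm (dP (z t) (z' t)) \<le> 2 * M" if "t \<in> {0..1}" for t
  proof -
    have "norm (dP (z t) (z' t)) \<le> norm (z' t) + norm (z' t) / 2"
      unfolding dP_def using norm_diff_le[OF order_refl small[OF sm[OF that]]] .
    then show ?thesis using *(2)[OF that] norm_ge_zero[of "z' t"] by linarith
  qed
  then show "\<exists>M. \<forall>t\<in>{0..1}. norm (dP (z t) (z' t)) \<le> M" by blast
qed

text \<open>The product rule for \<open>dP (z t) (w t)\<close> produces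
  \<open>- \<Gamma>0 (z' t) (w t)\<close>, which cancels the correction term built into
  \<open>G\<close>.\<close>

lemma zpar_chart:
  assumes z: "zcurve z z'" and w: "zpar z z' w" and t: "t \<in> {0..1}"
  shows "((\<lambda>t. dP (z t) (w t)) has_vector_derivative - chr c (P (z t)) (dP (z t) (z' t)) (dP (z t) (w t))) (at t within {0..1})"
proof -
  have n: "norm (z t) < \<rho>" by (rule zcurve_small[OF z t])
  have Dz: "(z has_vector_derivative z' t) (at t within {0..1})" using z t unfolding zcurve_def by blast
  have Dw: "(w has_vector_derivative - G (z t) (z' t) (w t)) (at t within {0..1})" using w t unfolding zpar_def by blast
  have "((\<lambda>t. dP (z t) (w t)) has_vector_derivative - G (z t) (z' t) (w t) - (\<Gamma>0 (z t) (- G (z t) (z' t) (w t)) + \<Gamma>0 (z' t) (w t))) (at t within {0..1})"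
    unfolding dP_def
    by (intro has_vector_derivative_diff Dw bounded_bilinear.has_vector_derivative[OF bounded_\<Gamma>0 Dz Dw])
  also have "- G (z t) (z' t) (w t) - (\<Gamma>0 (z t) (- G (z t) (z' t) (w t)) + \<Gamma>0 (z' t) (w t)) = dP (z t) (- G (z t) (z' t) (w t)) - \<Gamma>0 (z' t) (w t)"
    by (simp add: dP_def)
  also have "\<dots> = - chr c (P (z t)) (dP (z t) (z' t)) (dP (z t) (w t))"
    by (simp add: G_def linear_neg[OF linear_dP] dP_iP[OF n])
  finally show ?thesis .
qed

lemma zpar_parallel:
  assumes z: "zcurve z z'" and w: "zpar z z' w"
  shows "parallel_along A nabla {0..1} (\<lambda>t. pt (z t)) (\<lambda>t. tvz (z t) (w t))"
  unfolding pt_def[abs_def] tvz_def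
  by (rule lift_parallel[OF c zcurve_in[OF z] zcurve_deriv[OF z] zpar_chart[OF z w]])

lemma zgeo_geodesic:
  assumes z: "zcurve z z'" and w: "zpar z z' z'"
  shows "geodesic A nabla {0..1} (\<lambda>t. pt (z t))"
  unfolding pt_def[abs_def]
  by (rule lift_geodesic[OF c zcurve_in[OF z] zcurve_deriv[OF z] zpar_chart[OF z w]])

lemma z_velocity:
  assumes z: "zcurve z z'" and t: "t \<in> {0..1}"
  shows "velocity A {0..1} (\<lambda>t. pt (z t)) t = tvz (z t) (z' t)"
  unfolding pt_def[abs_def] tvz_def
  by (rule lift_velocity[OF c zcurve_in[OF z] zcurve_deriv[OF z] t])

text \<open>\<open>exp_map\<close> refers to all geodesics of the manifold with the given initial
  vector; \<open>geodesic_unique\<close> shows that they share the end point.\<close>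

lemma z_exp:
  assumes z: "zcurve z z'" and w: "zpar z z' z'"
  shows z_exp_domain: "tvz (z 0) (z' 0) \<in> exp_domain A nabla (pt (z 0))"
    and z_exp_map: "exp_map A nabla (pt (z 0)) (tvz (z 0) (z' 0)) = pt (z 1)"
proof -
  have 0: "(0::real) \<in> {0..1}" "(1::real) \<in> {0..1}" by auto
  have ex: "geodesic A nabla {0..1} (\<lambda>t. pt (z t)) \<and> pt (z 0) = pt (z 0) \<and> velocity A {0..1} (\<lambda>t. pt (z t)) 0 = tvz (z 0) (z' 0)"
    using zgeo_geodesic[OF z w] z_velocity[OF z 0(1)] by blast
  then show "tvz (z 0) (z' 0) \<in> exp_domain A nabla (pt (z 0))" unfolding exp_domain_def by blast
  show "exp_map A nabla (pt (z 0)) (tvz (z 0) (z' 0)) = pt (z 1)"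
    unfolding exp_map_def
  proof (rule the_equality)
    show "\<exists>\<gamma>. geodesic A nabla {0..1} \<gamma> \<and> \<gamma> 0 = pt (z 0) \<and> velocity A {0..1} \<gamma> 0 = tvz (z 0) (z' 0) \<and> \<gamma> 1 = pt (z 1)"
      using ex by blast
    fix y assume "\<exists>\<gamma>. geodesic A nabla {0..1} \<gamma> \<and> \<gamma> 0 = pt (z 0) \<and> velocity A {0..1} \<gamma> 0 = tvz (z 0) (z' 0) \<and> \<gamma> 1 = y"
    then obtain \<gamma> where \<gamma>: "geodesic A nabla {0..1} \<gamma>" "\<gamma> 0 = pt (z 0)" "velocity A {0..1} \<gamma> 0 = tvz (z 0) (z' 0)" "\<gamma> 1 = y"
      by blast
    have "\<gamma> 1 = cinv c (P (z 1))"
      by (rule geodesic_unique[OF c zcurve_in[OF z] zcurve_deriv[OF z] zpar_chart[OF z w] \<gamma>(1)])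
        (use \<gamma>(2,3) tvz_apply[OF zcurve_small[OF z 0(1)]] in \<open>auto simp: pt_def\<close>)
    then show "y = pt (z 1)" using \<gamma>(4) by (simp add: pt_def)
  qed
qed

lemma z_segment:
  assumes z: "zcurve z z'" and w: "zpar z z' z'" and U: "\<And>t. t \<in> {0..1} \<Longrightarrow> pt (z t) \<in> U"
  shows "geodesic_segment A nabla U (pt (z 0)) (pt (z 1)) (\<lambda>t. pt (z t))"
  using zgeo_geodesic[OF z w] U unfolding geodesic_segment_def by auto

lemma segment_unique:
  assumes cn: "convex_neighborhood A nabla m' U" and g: "geodesic_segment A nabla U x y \<gamma>" "geodesic_segment A nabla U x y \<gamma>'"
    and t: "t \<in> {0..1}"
  shows "\<gamma> t = \<gamma>' t"
proof -
  have "x \<in> U" "y \<in> U" using g(1) unfolding geodesic_segment_def by auto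
  then show ?thesis using cn g t unfolding convex_neighborhood_def by blast
qed

text \<open>\<open>U\<close> may be much larger than the chart, so uniqueness of the segment comes
  from \<open>convex_neighborhood\<close>. The coordinate curve only has to lie in \<open>U\<close>
  to be that segment.\<close>

lemma z_log:
  assumes z: "zcurve z z'" and w: "zpar z z' z'" and U: "\<And>t. t \<in> {0..1} \<Longrightarrow> pt (z t) \<in> U"
    and cn: "convex_neighborhood A nabla m' U"
  shows "log_map A nabla U (pt (z 0)) (pt (z 1)) = tvz (z 0) (z' 0)"
  unfolding log_map_def
proof (rule the_equality)
  have 0: "(0::real) \<in> {0..1}" by auto
  note seg = z_segment[OF z w U]
  show "\<exists>\<gamma>. geodesic_segment A nabla U (pt (z 0)) (pt (z 1)) \<gamma> \<and> velocity A {0..1} \<gamma> 0 = tvz (z 0) (z' 0)"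
    using seg z_velocity[OF z 0] by blast
  fix v assume "\<exists>\<gamma>. geodesic_segment A nabla U (pt (z 0)) (pt (z 1)) \<gamma> \<and> velocity A {0..1} \<gamma> 0 = v"
  then obtain \<gamma> where \<gamma>: "geodesic_segment A nabla U (pt (z 0)) (pt (z 1)) \<gamma>" "velocity A {0..1} \<gamma> 0 = v" by blast
  have "velocity A {0..1} \<gamma> 0 = velocity A {0..1} (\<lambda>t. pt (z t)) 0"
    by (rule velocity_cong[OF segment_unique[OF cn \<gamma>(1) seg] 0])
  then show "v = tvz (z 0) (z' 0)" using \<gamma>(2) z_velocity[OF z 0] by simp
qed

text \<open>First the segment is unique by convexity, then the parallel field along it by
  \<open>parallel_unique\<close>.\<close>

lemma z_transport:
  assumes z: "zcurve z z'" and w: "zpar z z' z'" and U: "\<And>t. t \<in> {0..1} \<Longrightarrow> pt (z t) \<in> U"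
    and cn: "convex_neighborhood A nabla m' U" and V: "zpar z z' V"
  shows "transport A nabla U (pt (z 0)) (pt (z 1)) (tvz (z 0) (V 0)) = tvz (z 1) (V 1)"
  unfolding transport_def
proof (rule the_equality)
  note seg = z_segment[OF z w U]
  note par = zpar_parallel[OF z V]
  show "\<exists>\<gamma> W. geodesic_segment A nabla U (pt (z 0)) (pt (z 1)) \<gamma> \<and> parallel_along A nabla {0..1} \<gamma> W \<and> W 0 = tvz (z 0) (V 0) \<and> W 1 = tvz (z 1) (V 1)"
    using seg par by blast
  fix v assume "\<exists>\<gamma> W. geodesic_segment A nabla U (pt (z 0)) (pt (z 1)) \<gamma> \<and> parallel_along A nabla {0..1} \<gamma> W \<and> W 0 = tvz (z 0) (V 0) \<and> W 1 = v"
  then obtain \<gamma> W where \<gamma>: "geodesic_segment A nabla U (pt (z 0)) (pt (z 1)) \<gamma>" "parallel_along A nabla {0..1} \<gamma> W"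
    "W 0 = tvz (z 0) (V 0)" "W 1 = v" by blast
  have pw: "parallel_along A nabla {0..1} (\<lambda>t. cinv c (P (z t))) W"
    unfolding pt_def[symmetric] by (rule parallel_along_cong[OF segment_unique[OF cn \<gamma>(1) seg] refl \<gamma>(2)])
  obtain M where M: "\<And>t. t \<in> {0..1} \<Longrightarrow> norm (dP (z t) (z' t)) \<le> M" using zcurve_bound[OF z] by blast
  have "W 1 = tvz (z 1) (V 1)"
    by (rule parallel_unique[OF c zcurve_in[OF z] zcurve_deriv[OF z] M pw par[unfolded pt_def]]) (use \<gamma>(3) in auto)
  then show "v = tvz (z 1) (V 1)" using \<gamma>(4) by simp
qed

end

section \<open>Curvature in adapted coordinates\<close>

lemma has_derivative_family2:
  fixes X :: "'e::real_normed_vector \<Rightarrow> 'b::euclidean_space" and Y :: "'e \<Rightarrow> 'c::euclidean_space"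
  assumes S: "open S" "x \<in> S" and lin: "\<And>z b. z \<in> S \<Longrightarrow> linear (\<lambda>a. L z a b)" "\<And>z a. z \<in> S \<Longrightarrow> linear (L z a)"
    and L: "\<And>a b. (\<lambda>z. L z a b) differentiable (at x)"
    and X: "(X has_derivative X') (at x)" and Y: "(Y has_derivative Y') (at x)"
  shows "((\<lambda>z. L z (X z) (Y z)) has_derivative
    (\<lambda>h. FD (\<lambda>z. L z (X x) (Y x)) x h + L x (X' h) (Y x) + L x (X x) (Y' h))) (at x)"
proof -
  have 1: "((\<lambda>z. L z (X z) b) has_derivative (\<lambda>h. FD (\<lambda>z. L z (X x) b) x h + L x (X' h) b)) (at x)" for b
    by (rule has_derivative_family[where L = "\<lambda>z a. L z a b", OF S lin(1) L X])
  have "((\<lambda>z. L z (X z) (Y z)) has_derivative (\<lambda>h. FD (\<lambda>z. L z (X z) (Y x)) x h + L x (X x) (Y' h))) (at x)"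
    by (rule has_derivative_family[where L = "\<lambda>z. L z (X z)", OF S lin(2) differentiableI[OF 1] Y])
  then show ?thesis unfolding FD_I[OF 1] .
qed

lemma has_derivative_family3:
  fixes X :: "'e::real_normed_vector \<Rightarrow> 'b::euclidean_space" and Y :: "'e \<Rightarrow> 'c::euclidean_space"
    and Z :: "'e \<Rightarrow> 'd::euclidean_space"
  assumes S: "open S" "x \<in> S" and lin: "\<And>z b d. z \<in> S \<Longrightarrow> linear (\<lambda>a. L z a b d)"
      "\<And>z a d. z \<in> S \<Longrightarrow> linear (\<lambda>b. L z a b d)" "\<And>z a b. z \<in> S \<Longrightarrow> linear (L z a b)"
    and L: "\<And>a b d. (\<lambda>z. L z a b d) differentiable (at x)"
    and X: "(X has_derivative X') (at x)" and Y: "(Y has_derivative Y') (at x)" and Z: "(Z has_derivative Z') (at x)"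
  shows "((\<lambda>z. L z (X z) (Y z) (Z z)) has_derivative
    (\<lambda>h. FD (\<lambda>z. L z (X x) (Y x) (Z x)) x h + L x (X' h) (Y x) (Z x) + L x (X x) (Y' h) (Z x) + L x (X x) (Y x) (Z' h))) (at x)"
proof -
  have 1: "((\<lambda>z. L z (X z) (Y z) d) has_derivative
     (\<lambda>h. FD (\<lambda>z. L z (X x) (Y x) d) x h + L x (X' h) (Y x) d + L x (X x) (Y' h) d)) (at x)" for d
    by (rule has_derivative_family2[where L = "\<lambda>z a b. L z a b d", OF S lin(1,2) L X Y])
  have "((\<lambda>z. L z (X z) (Y z) (Z z)) has_derivative (\<lambda>h. FD (\<lambda>z. L z (X z) (Y z) (Z x)) x h + L x (X x) (Y x) (Z' h))) (at x)"
    by (rule has_derivative_family[where L = "\<lambda>z. L z (X z) (Y z)", OF S lin(3) differentiableI[OF 1] Z])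
  then show ?thesis unfolding FD_I[OF 1] .
qed

context adapted_chart
begin

text \<open>The components of \<open>X\<close> in the adapted coordinates.\<close>

definition til :: "('a, 'e) vfield \<Rightarrow> 'e \<Rightarrow> 'e" where
  "til X z = iP z (vrep c X (P z))"

lemma vrep_til: "norm z < \<rho> \<Longrightarrow> vrep c X (P z) = dP z (til X z)"
  by (simp add: til_def dP_iP)

lemma smooth_til:
  assumes "X \<in> smooth_vfields A"
  shows "smooth_on (ball 0 \<rho>) (til X)"
  unfolding til_def[abs_def]
proof (rule smooth_on_family[OF open_ball _ smooth_iP])
  show "linear (iP z)" if "z \<in> ball 0 \<rho>" for z using linear_iP that by simp
  show "smooth_on (ball 0 \<rho>) (\<lambda>z. vrep c X (P z))"
    by (rule smooth_on_comp[OF open_ball _ smooth_vfieldsD(2)[OF assms c] smooth_P]) (use P_in in auto)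
qed

lemma til_differentiable: "X \<in> smooth_vfields A \<Longrightarrow> norm z < \<rho> \<Longrightarrow> til X differentiable (at z)"
  by (rule smooth_on_differentiable[OF smooth_til]) auto

lemma til_0: "til X 0 = X m c"
  by (simp add: til_def vrep_def cinv_cmap c m)

lemma til_diff: "norm z < \<rho> \<Longrightarrow> til (X - Y) z = til X z - til Y z"
  by (simp add: til_def vrep_def fun_diff_def linear_diff[OF linear_iP])

text \<open>\<open>nabla_chart\<close> concerns atlas charts only; this is its analogue in the
  adapted coordinates, obtained by differentiating \<open>vrep c Y (P z) = dP z (til Y z)\<close> in
  two ways.\<close>

lemma til_nabla:
  assumes X: "X \<in> smooth_vfields A" and Y: "Y \<in> smooth_vfields A" and z: "norm z < \<rho>"
  shows "til (nabla X Y) z = FD (til Y) z (til X z) + G z (til X z) (til Y z)"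
proof -
  let ?x = "til X z" and ?y = "til Y z"
  have zb: "z \<in> ball 0 \<rho>" using z by simp
  have dd: "(\<lambda>z. dP z b) differentiable (at z)" for b
    by (rule smooth_on_differentiable[OF smooth_dP zb])
  have D0: "((\<lambda>z. dP z b) has_derivative (\<lambda>h. - \<Gamma>0 h b)) (at z)" for b
    unfolding dP_def
    using has_derivative_diff[OF has_derivative_const bounded_linear_imp_has_derivative[OF bounded_bilinear.bounded_linear_left[OF bounded_\<Gamma>0]]]
    by simp
  have D1: "((\<lambda>z. dP z (til Y z)) has_derivative (\<lambda>h. FD (\<lambda>z. dP z ?y) z h + dP z (FD (til Y) z h))) (at z)"
    by (rule has_derivative_family[OF open_ball zb linear_dP dd FD_has_derivative[OF til_differentiable[OF Y z]]])
  have dP': "P differentiable (at z)" using P_derivative by (rule differentiableI)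
  have D2: "((\<lambda>z. vrep c Y (P z)) has_derivative (\<lambda>h. FD (vrep c Y) (P z) (FD P z h))) (at z)"
    by (rule FD_comp[OF dP' vrep_differentiable[OF Y c P_in[OF z]]])
  have "((\<lambda>z. dP z (til Y z)) has_derivative (\<lambda>h. FD (vrep c Y) (P z) (FD P z h))) (at z)"
    by (rule has_derivative_transform_within_open[OF D2 open_ball zb]) (simp add: vrep_til)
  from has_derivative_unique[OF this D1]
  have e: "FD (vrep c Y) (P z) (dP z h) = - \<Gamma>0 h ?y + dP z (FD (til Y) z h)" for h
    unfolding FD_I[OF P_derivative] FD_I[OF D0] by (simp add: fun_eq_iff)
  have v: "vrep c V (P z) = V (pt z) c" for V by (simp add: vrep_def pt_def)
  have "nabla X Y (pt z) c = FD (vrep c Y) (P z) (X (pt z) c) + chr c (P z) (X (pt z) c) (Y (pt z) c)"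
    using nabla_chart[OF c pt_in[OF z] X Y] unfolding cmap_pt[OF z] by (simp add: pt_def)
  then have "vrep c (nabla X Y) (P z) = - \<Gamma>0 ?x ?y + dP z (FD (til Y) z ?x) + chr c (P z) (dP z ?x) (dP z ?y)"
    unfolding v[symmetric] vrep_til[OF z, of X] vrep_til[OF z, of Y] e .
  then have "vrep c (nabla X Y) (P z) = dP z (FD (til Y) z ?x) + (chr c (P z) (dP z ?x) (dP z ?y) - \<Gamma>0 ?x ?y)"
    by simp
  then have "til (nabla X Y) z = iP z (dP z (FD (til Y) z ?x) + (chr c (P z) (dP z ?x) (dP z ?y) - \<Gamma>0 ?x ?y))"
    by (simp only: til_def[of "nabla X Y"])
  then show ?thesis by (simp add: linear_add[OF linear_iP[OF z]] iP_dP[OF z] G_def)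
qed

lemma lie_bracket_nabla:
  "X \<in> smooth_vfields A \<Longrightarrow> Y \<in> smooth_vfields A \<Longrightarrow> lie_bracket A X Y = nabla X Y - nabla Y X"
  using torsion_free unfolding torsion_free_def by simp

lemma lie_bracket_closed:
  "X \<in> smooth_vfields A \<Longrightarrow> Y \<in> smooth_vfields A \<Longrightarrow> lie_bracket A X Y \<in> smooth_vfields A"
  by (simp add: lie_bracket_nabla vfields_diff nabla_closed)

lemma curvature_closed:
  "X \<in> smooth_vfields A \<Longrightarrow> Y \<in> smooth_vfields A \<Longrightarrow> Z \<in> smooth_vfields A \<Longrightarrow> curvature A nabla X Y Z \<in> smooth_vfields A"
  unfolding curvature_def by (intro vfields_diff nabla_closed lie_bracket_closed)

lemma til_nabla_nabla:
  assumes X: "X \<in> smooth_vfields A" and Y: "Y \<in> smooth_vfields A" and Z: "Z \<in> smooth_vfields A" and z: "norm z < \<rho>"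
  shows "til (nabla X (nabla Y Z)) z = FD (\<lambda>w. FD (til Z) w (til Y z)) z (til X z) + FD (til Z) z (FD (til Y) z (til X z))
    + (FD (\<lambda>w. G w (til Y z) (til Z z)) z (til X z) + G z (FD (til Y) z (til X z)) (til Z z) + G z (til Y z) (FD (til Z) z (til X z)))
    + G z (til X z) (FD (til Z) z (til Y z) + G z (til Y z) (til Z z))"
proof -
  have zb: "z \<in> ball 0 \<rho>" using z by simp
  note d = til_differentiable[OF _ z]
  have D1: "((\<lambda>w. FD (til Z) w (til Y w)) has_derivative
     (\<lambda>h. FD (\<lambda>w. FD (til Z) w (til Y z)) z h + FD (til Z) z (FD (til Y) z h))) (at z)"
    by (rule has_derivative_family[OF open_ball zb _ _ FD_has_derivative[OF d[OF Y]]])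
      (auto intro!: linear_FD til_differentiable Z smooth_on_differentiable[OF smooth_on_FD[OF smooth_til[OF Z]] zb])
  have D2: "((\<lambda>w. G w (til Y w) (til Z w)) has_derivative
     (\<lambda>h. FD (\<lambda>w. G w (til Y z) (til Z z)) z h + G z (FD (til Y) z h) (til Z z) + G z (til Y z) (FD (til Z) z h))) (at z)"
    by (rule has_derivative_family2[OF open_ball zb _ _ _ FD_has_derivative[OF d[OF Y]] FD_has_derivative[OF d[OF Z]]])
      (auto intro!: linear_G G_differentiable z)
  have "FD (til (nabla Y Z)) z = FD (\<lambda>w. FD (til Z) w (til Y w) + G w (til Y w) (til Z w)) z"
    by (rule FD_cong[OF open_ball zb]) (simp add: til_nabla[OF Y Z])
  also have "\<dots> = (\<lambda>h. (FD (\<lambda>w. FD (til Z) w (til Y z)) z h + FD (til Z) z (FD (til Y) z h)) +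
     (FD (\<lambda>w. G w (til Y z) (til Z z)) z h + G z (FD (til Y) z h) (til Z z) + G z (til Y z) (FD (til Z) z h)))"
    by (rule FD_I[OF has_derivative_add[OF D1 D2]])
  finally show ?thesis
    unfolding til_nabla[OF X nabla_closed[OF Y Z] z] til_nabla[OF Y Z z] by simp
qed

text \<open>The classical coordinate expression of the curvature tensor in terms of
  \<open>G\<close>.\<close>

definition R :: "'e \<Rightarrow> 'e \<Rightarrow> 'e \<Rightarrow> 'e \<Rightarrow> 'e" where
  "R z a b d = FD (\<lambda>y. G y b d) z a - FD (\<lambda>y. G y a d) z b + G z a (G z b d) - G z b (G z a d)"

text \<open>The second derivatives of \<open>Z\<close> cancel by symmetry, and the terms with
  derivatives of \<open>X\<close> and \<open>Y\<close> cancel against the bracket; what remains is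
  tensorial.\<close>

lemma til_curvature:
  assumes X: "X \<in> smooth_vfields A" and Y: "Y \<in> smooth_vfields A" and Z: "Z \<in> smooth_vfields A" and z: "norm z < \<rho>"
  shows "til (curvature A nabla X Y Z) z = R z (til X z) (til Y z) (til Z z)"
proof -
  note lg = linear_G[OF z] and lz = linear_FD[OF til_differentiable[OF Z z]]
  have lie: "til (lie_bracket A X Y) z = FD (til Y) z (til X z) - FD (til X) z (til Y z)"
    unfolding lie_bracket_nabla[OF X Y] til_diff[OF z] til_nabla[OF X Y z] til_nabla[OF Y X z]
    using G_sym[OF z, of "til X z" "til Y z"] by simp
  have sym: "FD (\<lambda>w. FD (til Z) w (til Y z)) z (til X z) = FD (\<lambda>w. FD (til Z) w (til X z)) z (til Y z)"
    by (rule symmetric_second_derivative[OF smooth_on_Ck[OF smooth_til[OF Z]] open_ball]) (use z in simp)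
  show ?thesis
    unfolding curvature_def til_diff[OF z] til_nabla_nabla[OF X Y Z z] til_nabla_nabla[OF Y X Z z]
      til_nabla[OF lie_bracket_closed[OF X Y] Z z] lie sym R_def
    by (simp add: linear_diff[OF lz] linear_diff[OF lg(2)] linear_add[OF lg(1)] algebra_simps)
qed

lemma R_differentiable:
  assumes z: "norm z < \<rho>"
  shows "(\<lambda>z. R z a b d) differentiable (at z)"
proof -
  have zb: "z \<in> ball 0 \<rho>" using z by simp
  have 1: "smooth_on (ball 0 \<rho>) (\<lambda>z. G z a (G z b d))" for a b d
    by (rule smooth_on_family[where L = "\<lambda>z. G z a", OF open_ball _ smooth_G smooth_G]) (use linear_G in auto)
  have "smooth_on (ball 0 \<rho>) (\<lambda>z. R z a b d)"
    unfolding R_def by (intro smooth_on_diff smooth_on_add smooth_on_FD smooth_G 1 open_ball)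
  then show ?thesis using zb by (rule smooth_on_differentiable)
qed

lemma linear_R:
  assumes z: "norm z < \<rho>"
  shows "linear (\<lambda>a. R z a b d)" "linear (\<lambda>b. R z a b d)" "linear (R z a b)"
proof -
  note lg = linear_G[OF z] and ld = linear_DG[OF z]
  have c: "linear (\<lambda>x. f (g x))" if "linear f" "linear g" for f g :: "'e \<Rightarrow> 'e"
    using linear_compose[OF that(2,1)] by (simp add: o_def)
  show "linear (\<lambda>a. R z a b d)" "linear (\<lambda>b. R z a b d)" "linear (R z a b)"
    unfolding R_def[abs_def]
    by (intro linear_compose_sub linear_compose_add ld lg c[OF lg(1)] c[OF lg(2)])+
qed

text \<open>The terms quadratic in \<open>G\<close> have derivative 0 at the origin because both
  factors vanish there.\<close>

lemma FD_R_0: "FD (\<lambda>z. R z a b d) 0 w = S w a b d - S w b a d"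
proof -
  have 0: "norm (0::'e) < \<rho>" "(0::'e) \<in> ball 0 \<rho>" using \<rho> by auto
  have G2: "((\<lambda>z. G z a (G z b d)) has_derivative (\<lambda>h. 0)) (at 0)" for a b d
  proof -
    have "((\<lambda>z. G z a (G z b d)) has_derivative
       (\<lambda>h. FD (\<lambda>z. G z a (G 0 b d)) 0 h + G 0 a (FD (\<lambda>z. G z b d) 0 h))) (at 0)"
      by (rule has_derivative_family[where L = "\<lambda>z. G z a", OF open_ball 0(2) _ G_differentiable[OF 0(1)] FD_has_derivative[OF G_differentiable[OF 0(1)]]])
        (use linear_G in auto)
    then show ?thesis using linear_0[OF linear_DG(3)[OF 0(1)]] by simp
  qed
  have "((\<lambda>z. R z a b d) has_derivative (\<lambda>h. S h a b d - S h b a d + 0 - 0)) (at 0)"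
    unfolding R_def S_def
    by (intro has_derivative_diff has_derivative_add G2 FD_has_derivative G'_differentiable 0)
  then show ?thesis by (simp add: FD_I)
qed

text \<open>At the origin \<open>G\<close> vanishes, so \<open>nabla W\<close> is plain
  differentiation. The derivatives of \<open>X\<close>, \<open>Y\<close> and \<open>Z\<close> coming
  from the product rule cancel against the correction terms of \<open>cov_curvature\<close>.\<close>

lemma cov_curvature_m:
  assumes W: "W \<in> smooth_vfields A" and X: "X \<in> smooth_vfields A" and Y: "Y \<in> smooth_vfields A" and Z: "Z \<in> smooth_vfields A"
  shows "cov_curvature A nabla W X Y Z m c = S (W m c) (X m c) (Y m c) (Z m c) - S (W m c) (Y m c) (X m c) (Z m c)"
proof -
  have 0: "norm (0::'e) < \<rho>" "(0::'e) \<in> ball 0 \<rho>" using \<rho> by auto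
  note d = FD_has_derivative[OF til_differentiable[OF _ 0(1)]]
  have n: "til (nabla W V) 0 = FD (til V) 0 (til W 0)" if "V \<in> smooth_vfields A" for V
    using til_nabla[OF W that 0(1)] by simp
  have D: "((\<lambda>z. R z (til X z) (til Y z) (til Z z)) has_derivative
    (\<lambda>h. FD (\<lambda>z. R z (til X 0) (til Y 0) (til Z 0)) 0 h + R 0 (FD (til X) 0 h) (til Y 0) (til Z 0)
       + R 0 (til X 0) (FD (til Y) 0 h) (til Z 0) + R 0 (til X 0) (til Y 0) (FD (til Z) 0 h))) (at 0)"
    by (rule has_derivative_family3[OF open_ball 0(2) _ _ _ R_differentiable[OF 0(1)] d[OF X] d[OF Y] d[OF Z]])
      (use linear_R in auto)
  have "FD (til (curvature A nabla X Y Z)) 0 = FD (\<lambda>z. R z (til X z) (til Y z) (til Z z)) 0"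
    by (rule FD_cong[OF open_ball 0(2)]) (simp add: til_curvature[OF X Y Z])
  then have "til (nabla W (curvature A nabla X Y Z)) 0 = FD (\<lambda>z. R z (til X 0) (til Y 0) (til Z 0)) 0 (til W 0)
     + R 0 (FD (til X) 0 (til W 0)) (til Y 0) (til Z 0)
     + R 0 (til X 0) (FD (til Y) 0 (til W 0)) (til Z 0) + R 0 (til X 0) (til Y 0) (FD (til Z) 0 (til W 0))"
    unfolding n[OF curvature_closed[OF X Y Z]] FD_I[OF D] by simp
  then have "til (cov_curvature A nabla W X Y Z) 0 = FD (\<lambda>z. R z (til X 0) (til Y 0) (til Z 0)) 0 (til W 0)"
    unfolding cov_curvature_def til_diff[OF 0(1)]
      til_curvature[OF nabla_closed[OF W X] Y Z 0(1)] til_curvature[OF X nabla_closed[OF W Y] Z 0(1)]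
      til_curvature[OF X Y nabla_closed[OF W Z] 0(1)] n[OF X] n[OF Y] n[OF Z] by simp
  then show ?thesis unfolding FD_R_0 til_0 .
qed

text \<open>The value in \<open>cov_curvature_m\<close> depends on the four vectors alone, which
  resolves the \<open>THE\<close>; fields through given vectors come from
  \<open>extend_vector\<close>.\<close>

lemma cov_curvature_at_m:
  assumes T: "a \<in> tangent_space A m" "b \<in> tangent_space A m" "d \<in> tangent_space A m" "e \<in> tangent_space A m"
  shows "cov_curvature_at A nabla m a b d e = tv c m (S (a c) (b c) (d c) (e c) - S (a c) (d c) (b c) (e c))"
  unfolding cov_curvature_at_def
proof (rule the_equality)
  have cc: "cov_curvature A nabla W X Y Z m = tv c m (S (a c) (b c) (d c) (e c) - S (a c) (d c) (b c) (e c))"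
    if V: "W \<in> smooth_vfields A" "X \<in> smooth_vfields A" "Y \<in> smooth_vfields A" "Z \<in> smooth_vfields A"
      and at: "W m = a" "X m = b" "Y m = d" "Z m = e" for W X Y Z
  proof -
    have "cov_curvature A nabla W X Y Z \<in> smooth_vfields A"
      unfolding cov_curvature_def by (intro vfields_diff nabla_closed curvature_closed V)
    then have "cov_curvature A nabla W X Y Z m \<in> tangent_space A m" by (rule smooth_vfieldsD(1))
    then show ?thesis using tangent_tv[OF _ c m] cov_curvature_m[OF V] unfolding at by metis
  qed
  have ex: "\<exists>X\<in>smooth_vfields A. X m = w" if "w \<in> tangent_space A m" for w
    using extend_vector[OF c m, of "w c"] tangent_tv[OF that c m] by metis
  obtain W X Y Z where V: "W \<in> smooth_vfields A" "X \<in> smooth_vfields A" "Y \<in> smooth_vfields A" "Z \<in> smooth_vfields A"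
      "W m = a" "X m = b" "Y m = d" "Z m = e" using ex[OF T(1)] ex[OF T(2)] ex[OF T(3)] ex[OF T(4)] by blast
  show "\<exists>W\<in>smooth_vfields A. \<exists>X\<in>smooth_vfields A. \<exists>Y\<in>smooth_vfields A. \<exists>Z\<in>smooth_vfields A.
      W m = a \<and> X m = b \<and> Y m = d \<and> Z m = e \<and>
      tv c m (S (a c) (b c) (d c) (e c) - S (a c) (d c) (b c) (e c)) = cov_curvature A nabla W X Y Z m"
    using V cc[OF V] by (intro bexI[of _ W] bexI[of _ X] bexI[of _ Y] bexI[of _ Z]) auto
  show "z = tv c m (S (a c) (b c) (d c) (e c) - S (a c) (d c) (b c) (e c))"
    if "\<exists>W\<in>smooth_vfields A. \<exists>X\<in>smooth_vfields A. \<exists>Y\<in>smooth_vfields A. \<exists>Z\<in>smooth_vfields A.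
      W m = a \<and> X m = b \<and> Y m = d \<and> Z m = e \<and> z = cov_curvature A nabla W X Y Z m" for z
    using that cc by blast
qed

end

section \<open>The pole ladder\<close>

text \<open>The conclusion of the theorem with the error estimate replaced by a predicate
  \<open>Q\<close>: it is proved for the norm of components in a chart and then transferred to
  \<open>N\<close>.\<close>

definition ladder_step ::
    "('a::topological_space, 'e::euclidean_space) chart set \<Rightarrow> ('a, 'e) connection \<Rightarrow> 'a \<Rightarrow> 'a set \<Rightarrow>
     ('a, 'e) tvec \<Rightarrow> ('a, 'e) tvec \<Rightarrow> (('a, 'e) tvec \<Rightarrow> bool) \<Rightarrow> bool" where
  "ladder_step A nabla m U u v Q \<longleftrightarrow>
    (let p = exp_map A nabla m (- v);
         q = exp_map A nabla m v;
         u\<^sub>p = transport A nabla U m p u;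
         p' = exp_map A nabla p u\<^sub>p;
         q' = exp_map A nabla m (- log_map A nabla U m p');
         u\<^sub>q = - log_map A nabla U q q';
         u' = transport A nabla U q m u\<^sub>q
     in - v \<in> exp_domain A nabla m \<and> v \<in> exp_domain A nabla m \<and>
        u\<^sub>p \<in> exp_domain A nabla p \<and> - log_map A nabla U m p' \<in> exp_domain A nabla m \<and>
        {p, q, p', q'} \<subseteq> U \<and>
        Q (u' - u - (1 / 12) *\<^sub>R
             (cov_curvature_at A nabla m v u v (5 *\<^sub>R u - 2 *\<^sub>R v)
              + cov_curvature_at A nabla m u u v (v - 2 *\<^sub>R u))))"

lemma ladder_step_mono: "ladder_step A nabla m U u v Q \<Longrightarrow> (\<And>Y. Q Y \<Longrightarrow> Q' Y) \<Longrightarrow> ladder_step A nabla m U u v Q'"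
  unfolding ladder_step_def Let_def by blast

lemma has_vector_derivative_reverse:
  fixes f :: "real \<Rightarrow> 'b::real_normed_vector"
  assumes "(f has_vector_derivative f') (at (1 - t) within {0..1})"
  shows "((\<lambda>t. f (1 - t)) has_vector_derivative - f') (at t within {0..1})"
proof -
  have i: "(\<lambda>t. 1 - t) ` {0..1} = {0..1::real}"
    by (auto simp: image_iff intro!: bexI[of _ "1 - _"])
  have "((\<lambda>t. 1 - t) has_vector_derivative - 1) (at t within {0..1::real})"
    by (auto intro!: derivative_eq_intros)
  from vector_diff_chain_within[OF this, of f f'] assms show ?thesis unfolding i o_def by simp
qed

context adapted_chart
begin

lemma zpar_neg: "zcurve z z' \<Longrightarrow> zpar z z' w \<Longrightarrow> zpar z z' (\<lambda>t. - w t)"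
  unfolding zpar_def
  using has_vector_derivative_minus linear_neg[OF linear_G(1)[OF zcurve_small]] by fastforce

lemma zcurve_reverse:
  assumes "zcurve z z'"
  shows "zcurve (\<lambda>t. z (1 - t)) (\<lambda>t. - z' (1 - t))"
proof -
  obtain s M where *: "s < \<rho>" "\<And>t. t \<in> {0..1} \<Longrightarrow> (z has_vector_derivative z' t) (at t within {0..1}) \<and> norm (z t) \<le> s \<and> norm (z' t) \<le> M"
    using assms unfolding zcurve_def by blast
  have "\<forall>t\<in>{0..1}. ((\<lambda>t. z (1 - t)) has_vector_derivative - z' (1 - t)) (at t within {0..1}) \<and> norm (z (1 - t)) \<le> s \<and> norm (- z' (1 - t)) \<le> M"
  proof
    fix t :: real assume "t \<in> {0..1}"
    then show "((\<lambda>t. z (1 - t)) has_vector_derivative - z' (1 - t)) (at t within {0..1}) \<and> norm (z (1 - t)) \<le> s \<and> norm (- z' (1 - t)) \<le> M"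
      using *(2)[of "1 - t"] by (auto intro: has_vector_derivative_reverse)
  qed
  then show ?thesis using *(1) unfolding zcurve_def by blast
qed

text \<open>The last step of the ladder transports from \<open>q\<close> back to \<open>m\<close>,
  while the solved curve and field run from \<open>m\<close> to \<open>q\<close>.\<close>

lemma zpar_reverse:
  assumes z: "zcurve z z'" and w: "zpar z z' w"
  shows "zpar (\<lambda>t. z (1 - t)) (\<lambda>t. - z' (1 - t)) (\<lambda>t. w (1 - t))"
  unfolding zpar_def
proof
  fix t :: real assume t: "t \<in> {0..1}"
  have s: "1 - t \<in> {0..1}" using t by auto
  have "((\<lambda>t. w (1 - t)) has_vector_derivative - (- G (z (1 - t)) (z' (1 - t)) (w (1 - t)))) (at t within {0..1})"
    using w s unfolding zpar_def by (intro has_vector_derivative_reverse) blast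
  then show "((\<lambda>t. w (1 - t)) has_vector_derivative - G (z (1 - t)) (- z' (1 - t)) (w (1 - t))) (at t within {0..1})"
    using linear_neg[OF linear_G(2)[OF zcurve_small[OF z s]]] by simp
qed

lemma continuous_pt: "continuous_on (ball 0 \<rho>) pt"
  unfolding pt_def[abs_def]
  by (rule continuous_on_compose2[OF cont_cinv[OF c] smooth_on_continuous[OF smooth_P]]) (use P_in in auto)

lemma pole_ladder_chart:
  assumes cn: "convex_neighborhood A nabla m U"
  shows "\<exists>\<delta>>0. \<exists>C\<ge>0. \<forall>u\<in>tangent_space A m. \<forall>v\<in>tangent_space A m. norm (u c) + norm (v c) < \<delta> \<longrightarrow>
    ladder_step A nabla m U u v (\<lambda>Y. \<exists>X. Y = tv c m X \<and> norm X \<le> C * (norm (u c) + norm (v c)) ^ 5)"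
proof -
  obtain K where "small_connection G D S (\<rho> / 2) K" using small_connection_G by blast
  then interpret sc: small_connection G D S "\<rho> / 2" K .
  have oU: "open U" "m \<in> U" using cn unfolding convex_neighborhood_def by auto
  have "open (ball 0 \<rho> \<inter> pt -` U)" by (rule continuous_open_preimage[OF continuous_pt open_ball oU(1)])
  moreover have "0 \<in> ball 0 \<rho> \<inter> pt -` U" using \<rho> oU by simp
  ultimately obtain \<delta>0 where \<delta>0: "\<delta>0 > 0" "ball 0 \<delta>0 \<subseteq> ball 0 \<rho> \<inter> pt -` U" using openE by blast
  \<comment> \<open>The three bounds keep points in \<open>U\<close>, keep them in the ball where
    \<open>small_connection\<close> holds, and provide the smallness needed for the contractions and
    for the absorption in \<open>ladder_error\<close>.\<close>
  define \<delta> where "\<delta> = min (min (\<delta>0 / 2) (\<rho> / 2)) (1 / (144 * K))"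
  have K1: "1 \<le> K" by (rule sc.K)
  have \<delta>: "\<delta> > 0" "\<delta> < \<delta>0" "\<delta> \<le> \<rho> / 2" "\<delta> \<le> 1 / (144 * K)" using \<delta>0 \<rho> K1 by (auto simp: \<delta>_def)
  have \<delta>1: "\<delta> \<le> 1" using order_trans[OF \<delta>(4), of 1] K1 by (simp add: field_simps)
  have "144 * K * \<delta> \<le> 1" using \<delta>(4) K1 by (simp add: field_simps)
  moreover have "144 * K * \<delta>\<^sup>2 \<le> 144 * K * \<delta>"
    using \<delta>(1) \<delta>1 K1 by (intro mult_left_mono) (auto simp: power2_eq_square mult_le_one)
  ultimately have \<delta>K: "144 * K * \<delta>\<^sup>2 \<le> 1" by linarith
  then have \<delta>K': "32 * K * \<delta>\<^sup>2 \<le> 1" using K1 zero_le_power2[of \<delta>] mult_nonneg_nonneg[of K "\<delta>\<^sup>2"] by linarith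
  have inU: "pt z \<in> U" if "norm z \<le> \<delta>" for z
  proof -
    have "z \<in> ball 0 \<delta>0" using that \<delta>(2) by simp
    then show ?thesis using \<delta>0(2) by blast
  qed
  define C0 where "C0 = 1000 * K\<^sup>2"
  \<comment> \<open>The bracket is the constant of \<open>ladder_error\<close>; the power converts
    from \<open>\<sigma>\<close> to the sum of the two norms.\<close>
  define C where "C = (72 * K * (192 * K + 4 * C0) + 2 * C0) * 300 ^ 5"
  have C0: "C0 \<ge> 0" by (simp add: C0_def)
  show ?thesis
  proof (rule exI[of _ "\<delta> / 300"], rule conjI[rotated], rule exI[of _ C], rule conjI[rotated], intro ballI impI)
    show "\<delta> / 300 > 0" using \<delta> by simp
    show "C \<ge> 0" using C0 K1 by (simp add: C_def)
    fix u' v' assume T: "u' \<in> tangent_space A m" "v' \<in> tangent_space A m" and sm: "norm (u' c) + norm (v' c) < \<delta> / 300"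
    \<comment> \<open>A single scale \<open>\<sigma>\<close> bounds every curve and field below.
      Each solution may double its data, and the largest bound reached is 104 times
      \<open>s\<close>, for \<open>W\<close>; 300 leaves a margin.\<close>
    define u v s \<sigma> where "u = u' c" and "v = v' c" and "s = norm (u' c) + norm (v' c)" and "\<sigma> = 300 * s"
    have uv: "norm u \<le> s" "norm v \<le> s" "0 \<le> s" by (auto simp: u_def v_def s_def)
    have tv: "u' = tvz 0 u" "v' = tvz 0 v" using T tangent_tvz_0 by (auto simp: u_def v_def)
    have \<sigma>: "\<sigma> \<le> \<delta>" "\<sigma> = 300 * s" "\<sigma> \<le> 1" "\<sigma> \<le> \<rho> / 2" using sm \<delta> \<delta>1 by (auto simp: \<sigma>_def s_def)
    have \<sigma>K: "144 * K * \<sigma>\<^sup>2 \<le> 1"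
    proof -
      have "\<sigma>\<^sup>2 \<le> \<delta>\<^sup>2" using \<sigma>(1,2) uv(3) by (intro power_mono) auto
      then have "144 * K * \<sigma>\<^sup>2 \<le> 144 * K * \<delta>\<^sup>2" using K1 by (intro mult_left_mono) auto
      then show ?thesis using \<delta>K by linarith
    qed
    have ex: "\<exists>z z'. z 0 = x \<and> (\<kappa> = 0 \<longrightarrow> z' 0 = e) \<and> (\<kappa> = 1 \<longrightarrow> z 1 = x + e) \<and> sc.geo z z' \<sigma> \<and>
        (\<forall>t\<in>{0..1}. norm (z t) \<le> norm x + 2 * e0 \<and> norm (z' t) \<le> 2 * e0)"
      if k: "\<kappa> = 0 \<or> \<kappa> = (1::real)" and e: "norm e \<le> e0" and b: "norm x + 2 * e0 \<le> \<sigma>" for \<kappa> x e e0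
    proof -
      have e1: "norm x + 2 * e0 \<le> \<delta>" using b \<sigma> by linarith
      have e2: "2 * e0 \<le> \<sigma>" using b norm_ge_zero[of x] by linarith
      show ?thesis
      proof (rule sc.geodesic_exists[OF k e e1 \<delta>(3) \<delta>K'])
        fix z z'
        assume ends: "z 0 = x" "\<kappa> = 0 \<longrightarrow> z' 0 = e" "\<kappa> = 1 \<longrightarrow> z 1 = x + e"
          and bd: "\<And>t. t \<in> {0..1} \<Longrightarrow> norm (z t) \<le> norm x + 2 * e0" "\<And>t. t \<in> {0..1} \<Longrightarrow> norm (z' t) \<le> 2 * e0"
          and ode: "\<And>t. t \<in> {0..1} \<Longrightarrow> (z has_vector_derivative z' t) (at t within {0..1})"
            "\<And>t. t \<in> {0..1} \<Longrightarrow> (z' has_vector_derivative - G (z t) (z' t) (z' t)) (at t within {0..1})"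
        have "sc.geo z z' \<sigma>"
          unfolding sc.geo_def by (intro ballI conjI ode order_trans[OF bd(1) b] order_trans[OF bd(2) e2])
        then show ?thesis using ends bd by (intro exI[of _ z] exI[of _ z'] conjI ballI) auto
      qed
    qed
    have zc: "zcurve z z'" "zpar z z' z'" "\<And>t. t \<in> {0..1} \<Longrightarrow> pt (z t) \<in> U" if g: "sc.geo z z' \<sigma>" for z z'
    proof -
      have "\<sigma> < \<rho>" using \<sigma> \<rho> by linarith
      then show "zcurve z z'" "zpar z z' z'" using g unfolding sc.geo_def zcurve_def zpar_def by blast+
      show "pt (z t) \<in> U" if "t \<in> {0..1}" for t
        using g that \<sigma>(1) unfolding sc.geo_def by (intro inU) fastforce
    qed
    have cont: "continuous_on {0..1} z" "continuous_on {0..1} z'" if g: "sc.geo z z' \<sigma>" for z z'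
      using g unfolding sc.geo_def by (auto intro!: continuous_on_vector_derivative)
    have pex: "\<exists>V. (\<kappa> = 0 \<longrightarrow> V 0 = w) \<and> (\<kappa> = 1 \<longrightarrow> V 1 = w) \<and> sc.par z z' V \<sigma> \<and> (\<forall>t\<in>{0..1}. norm (V t) \<le> 2 * norm w)"
      if k: "\<kappa> = 0 \<or> \<kappa> = (1::real)" and g: "sc.geo z z' \<sigma>" and w: "2 * norm w \<le> \<sigma>" for \<kappa> w z z'
    proof -
      have b: "norm (z t) \<le> \<delta>" "norm (z' t) \<le> \<delta>" if "t \<in> {0..1}" for t
        using g that \<sigma>(1) unfolding sc.geo_def by fastforce+
      show ?thesis
      proof (rule sc.parallel_exists[OF k \<delta>(3) \<delta>K' cont[OF g] b, where u = w])
        fix V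
        assume ends: "\<kappa> = 0 \<longrightarrow> V 0 = w" "\<kappa> = 1 \<longrightarrow> V 1 = w"
          and bd: "\<And>t. t \<in> {0..1} \<Longrightarrow> norm (V t) \<le> 2 * norm w"
          and ode: "\<And>t. t \<in> {0..1} \<Longrightarrow> (V has_vector_derivative - G (z t) (z' t) (V t)) (at t within {0..1})"
        have "sc.par z z' V \<sigma>" unfolding sc.par_def by (intro ballI conjI ode order_trans[OF bd w])
        then show ?thesis using ends bd by (intro exI[of _ V] conjI ballI) auto
      qed
    qed
    have zp: "zpar z z' V" if "sc.par z z' V \<sigma>" for z z' V
      using that unfolding sc.par_def zpar_def by blast
    have I: "(0::real) \<in> {0..1}" "(1::real) \<in> {0..1}" by auto
    \<comment> \<open>The geodesics \<open>a\<close> and \<open>b\<close> run from \<open>m\<close>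
      to \<open>p\<close> and \<open>q\<close>, \<open>f\<close> from \<open>p\<close> to
      \<open>p'\<close>, \<open>g\<close> from \<open>m\<close> to \<open>p'\<close>,
      \<open>k\<close> from \<open>m\<close> to \<open>q'\<close> and \<open>d\<close> from
      \<open>q\<close> to \<open>q'\<close>; \<open>V\<close> and \<open>W\<close> are parallel
      along \<open>a\<close> and \<open>b\<close>.\<close>
    obtain a a' where a: "a 0 = 0" "a' 0 = - v" "sc.geo a a' \<sigma>" and ab: "\<And>t. t \<in> {0..1} \<Longrightarrow> norm (a t) \<le> 2 * s"
      using ex[of 0 "- v" s 0] uv \<sigma>(2) by auto
    obtain b b' where b: "b 0 = 0" "b' 0 = v" "sc.geo b b' \<sigma>" and bb: "\<And>t. t \<in> {0..1} \<Longrightarrow> norm (b t) \<le> 2 * s"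
      using ex[of 0 v s 0] uv \<sigma>(2) by auto
    obtain V where V: "V 0 = u" "sc.par a a' V \<sigma>" and Vb: "\<And>t. t \<in> {0..1} \<Longrightarrow> norm (V t) \<le> 2 * norm u"
      using pex[of 0 a a' u] a(3) uv \<sigma>(2) by auto
    have V1: "norm (V 1) \<le> 2 * s" using Vb[OF I(2)] uv by linarith
    have a1: "norm (a 1) \<le> 2 * s" using ab I by blast
    have b1: "norm (b 1) \<le> 2 * s" using bb I by blast
    obtain f f' where f: "f 0 = a 1" "f' 0 = V 1" "sc.geo f f' \<sigma>" and fb: "\<And>t. t \<in> {0..1} \<Longrightarrow> norm (f t) \<le> norm (a 1) + 2 * (2 * s)"
      using ex[of 0 "V 1" "2 * s" "a 1"] V1 a1 \<sigma>(2) uv by auto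
    have f1: "norm (f 1) \<le> 6 * s" using fb[OF I(2)] a1 by linarith
    \<comment> \<open>A boundary value problem: its initial velocity \<open>h\<close> is the
      logarithm of \<open>p'\<close> at \<open>m\<close>.\<close>
    obtain g g' where g: "g 0 = 0" "g 1 = f 1" "sc.geo g g' \<sigma>" and gb: "\<And>t. t \<in> {0..1} \<Longrightarrow> norm (g' t) \<le> 2 * (6 * s)"
      using ex[of 1 "f 1" "6 * s" 0] f1 \<sigma>(2) uv by auto
    define h where "h = g' 0"
    have h: "norm (- h) \<le> 12 * s" using gb[OF I(1)] by (simp add: h_def)
    obtain k k' where k: "k 0 = 0" "k' 0 = - h" "sc.geo k k' \<sigma>" and kb: "\<And>t. t \<in> {0..1} \<Longrightarrow> norm (k t) \<le> 2 * (12 * s)"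
      using ex[of 0 "- h" "12 * s" 0] h \<sigma>(2) uv by auto
    have kb1: "norm (k 1 - b 1) \<le> 26 * s" using norm_diff_le[OF kb[OF I(2)] b1] by simp
    obtain d d' where d: "d 0 = b 1" "d 1 = k 1" "sc.geo d d' \<sigma>" and db: "\<And>t. t \<in> {0..1} \<Longrightarrow> norm (d' t) \<le> 2 * (26 * s)"
      using ex[of 1 "k 1 - b 1" "26 * s" "b 1"] kb1 b1 \<sigma>(2) uv by auto
    define w where "w = d' 0"
    have w: "norm w \<le> 52 * s" using db[OF I(1)] by (simp add: w_def)
    \<comment> \<open>The logarithm \<open>w\<close> of \<open>q'\<close> is prescribed at the far
      end \<open>q\<close>; since the ladder takes \<open>- w\<close>, the transported result at
      \<open>m\<close> is \<open>- W 0\<close>.\<close>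
    obtain W where W: "W 1 = w" "sc.par b b' W \<sigma>" and Wb: "\<And>t. t \<in> {0..1} \<Longrightarrow> norm (W t) \<le> 2 * norm w"
      using pex[of 1 b b' w] b(3) w uv \<sigma>(2) by auto
    note za = zc[OF a(3)] and zb = zc[OF b(3)] and zf = zc[OF f(3)] and zg = zc[OF g(3)] and zk = zc[OF k(3)] and zd = zc[OF d(3)]
    note small0 = \<rho> zcurve_small[OF za(1) I(2)] zcurve_small[OF zb(1) I(2)]
    have n0: "norm (0::'e) < \<rho>" using \<rho> by simp
    have neg_v: "- v' = tvz 0 (- v)" using tvz_neg[OF n0] tv by simp
    have p: "exp_map A nabla m (- v') = pt (a 1)" "- v' \<in> exp_domain A nabla m"
      using z_exp[OF za(1,2)] unfolding a neg_v by simp_all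
    have q: "exp_map A nabla m v' = pt (b 1)" "v' \<in> exp_domain A nabla m"
      using z_exp[OF zb(1,2)] unfolding b tv by simp_all
    have up: "transport A nabla U m (pt (a 1)) u' = tvz (a 1) (V 1)"
      using z_transport[OF za cn zp[OF V(2)]] unfolding a V tv by simp
    have p': "exp_map A nabla (pt (a 1)) (tvz (a 1) (V 1)) = pt (f 1)" "tvz (a 1) (V 1) \<in> exp_domain A nabla (pt (a 1))"
      using z_exp[OF zf(1,2)] unfolding f by simp_all
    have lg: "log_map A nabla U m (pt (f 1)) = tvz 0 h"
      using z_log[OF zg cn] unfolding g h_def by simp
    have neg_h: "- tvz 0 h = tvz 0 (- h)" using tvz_neg[OF n0] by simp
    have q': "exp_map A nabla m (tvz 0 (- h)) = pt (k 1)" "tvz 0 (- h) \<in> exp_domain A nabla m"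
      using z_exp[OF zk(1,2)] unfolding k by simp_all
    have uq: "log_map A nabla U (pt (b 1)) (pt (k 1)) = tvz (b 1) w"
      using z_log[OF zd cn] unfolding d w_def by simp
    have neg_w: "- tvz (b 1) w = tvz (b 1) (- W 1)" using tvz_neg[OF zcurve_small[OF zb(1) I(2)]] W by simp
    have u'': "transport A nabla U (pt (b 1)) m (tvz (b 1) (- W 1)) = tvz 0 (- W 0)"
    proof -
      note r = zcurve_reverse[OF zb(1)]
      have rp: "zpar (\<lambda>t. b (1 - t)) (\<lambda>t. - b' (1 - t)) (\<lambda>t. - b' (1 - t))"
        using zpar_neg[OF r zpar_reverse[OF zb(1,2)]] .
      have rW: "zpar (\<lambda>t. b (1 - t)) (\<lambda>t. - b' (1 - t)) (\<lambda>t. - W (1 - t))"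
        using zpar_neg[OF r zpar_reverse[OF zb(1) zp[OF W(2)]]] .
      have "pt (b (1 - t)) \<in> U" if "t \<in> {0..1}" for t using zb(3)[of "1 - t"] that by simp
      from z_transport[OF r rp this cn rW] show ?thesis using b(1) by simp
    qed
    have inUs: "{pt (a 1), pt (b 1), pt (f 1), pt (k 1)} \<subseteq> U"
      using za(3) zb(3) zf(3) zk(3) I by auto
    \<comment> \<open>The geodesic triangle with vertices \<open>m\<close>, \<open>p\<close> and
      \<open>p'\<close>.\<close>
    have E1: "norm (h - (- v + u + sc.h3 (- v) u + sc.h4 (- v) u)) \<le> C0 * \<sigma> ^ 5"
      using sc.double_exponential[OF a(3,1) V(2) f(3,1,2) g(3,1,2) \<sigma>(3,4)] unfolding C0_def a V h_def .
    \<comment> \<open>The triangle with vertices \<open>m\<close>, \<open>q\<close> and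
      \<open>q'\<close>, whose third side starts with \<open>- h\<close> because \<open>m\<close> is
      the midpoint of \<open>p'\<close> and \<open>q'\<close>.\<close>
    have E2: "norm (- h - (v + - (- W 0) + sc.h3 v (- (- W 0)) + sc.h4 v (- (- W 0)))) \<le> C0 * \<sigma> ^ 5"
      using sc.double_exponential[OF b(3,1) W(2) d(3,1) _ k(3,1) _ \<sigma>(3,4)] W(1) d(2) unfolding C0_def b k w_def by simp
    have nW: "norm (- W 0) \<le> \<sigma>" using Wb[OF I(1)] w \<sigma>(2) uv(3) by simp
    have nu: "norm v \<le> \<sigma>" "norm u \<le> \<sigma>" using uv \<sigma>(2) by auto
    have main: "norm (- W 0 - u - 2 *\<^sub>R sc.h4 v (- u)) \<le> C * s ^ 5"
      using sc.ladder_error[OF E1 E2 nu nW \<sigma>(3) \<sigma>K C0] unfolding C_def \<sigma>(2) by (simp only: power_mult_distrib mult.assoc)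
    have T5: "5 *\<^sub>R u' - 2 *\<^sub>R v' \<in> tangent_space A m" "v' - 2 *\<^sub>R u' \<in> tangent_space A m"
      using T by (auto intro!: tangent_diff tangent_scaleR)
    have cc: "cov_curvature_at A nabla m v' u' v' (5 *\<^sub>R u' - 2 *\<^sub>R v') + cov_curvature_at A nabla m u' u' v' (v' - 2 *\<^sub>R u') =
       tv c m (S v u v (5 *\<^sub>R u - 2 *\<^sub>R v) - S v v u (5 *\<^sub>R u - 2 *\<^sub>R v) + (S u u v (v - 2 *\<^sub>R u) - S u v u (v - 2 *\<^sub>R u)))"
      unfolding cov_curvature_at_m[OF T(2,1,2) T5(1)] cov_curvature_at_m[OF T(1,1,2) T5(2)]
      by (simp add: tv_add[OF c m] fun_diff_def scaleR_fun_def flip: u_def v_def)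
    have tvd: "tv c m (x - y) = tv c m x - tv c m y" for x y
      using tv_add[OF c m, of x "(-1) *\<^sub>R y"] tv_scaleR[OF c m, of "-1" y] by simp
    have res: "tvz 0 (- W 0) - u' - (1 / 12) *\<^sub>R (cov_curvature_at A nabla m v' u' v' (5 *\<^sub>R u' - 2 *\<^sub>R v')
        + cov_curvature_at A nabla m u' u' v' (v' - 2 *\<^sub>R u')) = tv c m (- W 0 - u - 2 *\<^sub>R sc.h4 v (- u))"
      unfolding cc unfolding tv(1) tvz_0 sc.twice_h4 tvd tv_scaleR[OF c m, of "1/12"] ..
    show "ladder_step A nabla m U u' v' (\<lambda>Y. \<exists>X. Y = tv c m X \<and> norm X \<le> C * (norm (u' c) + norm (v' c)) ^ 5)"
      unfolding ladder_step_def Let_def p(1) q(1) up p'(1) lg neg_h q'(1) uq neg_w u'' res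
      using p(2) q(2) p'(2) q'(2) inUs main unfolding s_def by blast
  qed
qed

end

section \<open>Choice of the coordinates and passage to an arbitrary norm\<close>

lemma exists_adapted_chart:
  fixes A :: "('a::{t2_space, second_countable_topology}, 'e::euclidean_space) chart set"
  assumes "affine_manifold A nabla" "torsion_free A nabla" "c \<in> A" "m \<in> cdom c"
  shows "\<exists>\<rho>. adapted_chart A nabla c m \<rho>"
proof -
  interpret affine_manifold A nabla by fact
  let ?\<Gamma> = "christoffel A nabla c m"
  have bb: "bounded_bilinear ?\<Gamma>"
    using bilinear_christoffel[OF assms(3,4)] by (simp add: bilinear_conv_bounded_bilinear)
  let ?P = "\<lambda>z. cmap c m + z - (1/2) *\<^sub>R ?\<Gamma> z z"
  have "continuous_on UNIV ?P"
    by (intro continuous_intros bounded_bilinear.continuous_on[OF bb])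
  then have "open (?P -` cimage c)" using open_cimage[OF assms(3)] by (simp add: continuous_on_open_vimage)
  moreover have "0 \<in> ?P -` cimage c"
    using assms(4) bounded_bilinear.zero_left[OF bb] by simp
  ultimately obtain r where r: "r > 0" "ball 0 r \<subseteq> ?P -` cimage c" using openE by blast
  obtain K where K: "K > 0" "\<And>a b. norm (?\<Gamma> a b) \<le> norm a * norm b * K"
    using bounded_bilinear.pos_bounded[OF bb] by blast
  have "adapted_chart A nabla c m (min r (1 / (2 * K)))"
  proof (unfold_locales)
    fix z h :: 'e assume z: "norm z < min r (1 / (2 * K))"
    have "norm z * K \<le> 1 / 2" using z K(1) by (simp add: field_simps)
    then have "norm z * K * norm h \<le> 1 / 2 * norm h" by (intro mult_right_mono) auto
    then show "norm (?\<Gamma> z h) \<le> norm h / 2" using K(2)[of z h] by (simp add: mult_ac)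
  next
    fix z :: 'e assume "norm z < min r (1 / (2 * K))"
    then show "cmap c m + z - (1 / 2) *\<^sub>R ?\<Gamma> z z \<in> cimage c" using r(2) by auto
  qed (use assms r K in auto)
  then show ?thesis by blast
qed

text \<open>\<open>n\<close> is continuous with respect to the Euclidean norm and attains a positive
  minimum on the unit sphere. One constant, the sum of the two one-sided ones, serves both
  directions.\<close>

lemma norm_equivalence:
  fixes n :: "'e::euclidean_space \<Rightarrow> real"
  assumes nn: "\<And>a. 0 \<le> n a" and z: "\<And>a. n a = 0 \<longleftrightarrow> a = 0" and sc: "\<And>r a. n (r *\<^sub>R a) = \<bar>r\<bar> * n a"
    and tri: "\<And>a b. n (a + b) \<le> n a + n b"
  obtains \<kappa> where "\<kappa> > 0" "\<And>a. n a \<le> \<kappa> * norm a" "\<And>a. norm a \<le> \<kappa> * n a"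
proof -
  define C where "C = (\<Sum>b\<in>Basis. n b)"
  have C0: "C \<ge> 0" unfolding C_def by (intro sum_nonneg nn)
  have sum: "n (\<Sum>i\<in>I. f i) \<le> (\<Sum>i\<in>I. n (f i))" for I :: "'e set" and f
  proof (induction I rule: infinite_finite_induct)
    case (insert i I)
    then show ?case using tri[of "f i" "\<Sum>i\<in>I. f i"] by simp
  qed (use z[of 0] in auto)
  have up: "n a \<le> C * norm a" for a
  proof -
    have "n a = n (\<Sum>b\<in>Basis. (a \<bullet> b) *\<^sub>R b)" by (simp add: euclidean_representation)
    also have "\<dots> \<le> (\<Sum>b\<in>Basis. \<bar>a \<bullet> b\<bar> * n b)" using sum[of "\<lambda>b. (a \<bullet> b) *\<^sub>R b" Basis] by (simp add: sc)
    also have "\<dots> \<le> (\<Sum>b\<in>Basis. norm a * n b)" by (intro sum_mono mult_right_mono Basis_le_norm nn)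
    finally show ?thesis by (simp add: C_def sum_distrib_left mult.commute sum_distrib_right)
  qed
  have "\<bar>n a - n b\<bar> \<le> C * norm (a - b)" for a b
    using tri[of "a - b" b] tri[of "b - a" a] up[of "a - b"] sc[of "-1" "a - b"] by (simp add: abs_le_iff)
  then have "continuous_on (sphere 0 1) n"
    using C0 by (intro lipschitz_on_continuous_on[of C] lipschitz_onI) (auto simp: dist_norm)
  moreover have "sphere (0::'e) 1 \<noteq> {}" using norm_some_Basis by (metis mem_sphere_0 empty_iff)
  ultimately obtain a0 where a0: "a0 \<in> sphere 0 1" "\<And>a. a \<in> sphere 0 1 \<Longrightarrow> n a0 \<le> n a"
    using continuous_attains_inf[OF compact_sphere] by blast
  have "a0 \<noteq> 0" using a0(1) by auto
  then have \<mu>: "n a0 > 0" using nn[of a0] z[of a0] by linarith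
  have low: "n a0 * norm a \<le> n a" for a
  proof (cases "a = 0")
    case True
    then show ?thesis using nn by simp
  next
    case False
    have "n a0 \<le> n ((1 / norm a) *\<^sub>R a)" using False by (intro a0(2)) simp
    also have "\<dots> = n a / norm a" by (simp add: sc)
    finally show ?thesis using False by (simp add: field_simps)
  qed
  show ?thesis
  proof (rule that[of "C + 1 / n a0"])
    show "0 < C + 1 / n a0" using C0 \<mu> by (simp add: add_nonneg_pos)
    show "n a \<le> (C + 1 / n a0) * norm a" for a
    proof -
      have "C * norm a \<le> (C + 1 / n a0) * norm a" using \<mu> by (intro mult_right_mono) auto
      then show ?thesis using up[of a] by linarith
    qed
    show "norm a \<le> (C + 1 / n a0) * n a" for a
    proof -
      have "norm a \<le> (1 / n a0) * n a" using low[of a] \<mu> by (simp add: field_simps)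
      also have "\<dots> \<le> (C + 1 / n a0) * n a" using C0 nn by (intro mult_right_mono) auto
      finally show ?thesis .
    qed
  qed
qed

theorem theorem2:
  fixes A :: "('a::{t2_space, second_countable_topology}, 'e::euclidean_space) chart set"
    and nabla :: "('a, 'e) connection"
    and m :: 'a and U :: "'a set"
    and N :: "('a, 'e) tvec \<Rightarrow> real"
  assumes "smooth_atlas A"
    and "affine_connection A nabla"
    and "torsion_free A nabla"
    and "convex_neighborhood A nabla m U"
    and "norm_on (tangent_space A m) N"
  shows "\<exists>\<epsilon>>0. \<exists>C. \<forall>u\<in>tangent_space A m. \<forall>v\<in>tangent_space A m. N u + N v < \<epsilon> \<longrightarrow>
    (let p = exp_map A nabla m (- v);
         q = exp_map A nabla m v;
         u\<^sub>p = transport A nabla U m p u;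
         p' = exp_map A nabla p u\<^sub>p;
         q' = exp_map A nabla m (- log_map A nabla U m p');
         u\<^sub>q = - log_map A nabla U q q';
         u' = transport A nabla U q m u\<^sub>q
     in - v \<in> exp_domain A nabla m \<and> v \<in> exp_domain A nabla m \<and>
        u\<^sub>p \<in> exp_domain A nabla p \<and> - log_map A nabla U m p' \<in> exp_domain A nabla m \<and>
        {p, q, p', q'} \<subseteq> U \<and>
        N (u' - u - (1 / 12) *\<^sub>R
             (cov_curvature_at A nabla m v u v (5 *\<^sub>R u - 2 *\<^sub>R v)
              + cov_curvature_at A nabla m u u v (v - 2 *\<^sub>R u)))
          \<le> C * (N u + N v) ^ 5)"
proof -
  interpret affine_manifold A nabla using assms(1,2) by unfold_locales
  obtain c where cm: "c \<in> A" "m \<in> cdom c" using assms(1) unfolding smooth_atlas_def by blast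
  obtain \<rho> where "adapted_chart A nabla c m \<rho>"
    using exists_adapted_chart[OF affine_manifold_axioms assms(3) cm] by blast
  then interpret adapted_chart A nabla c m \<rho> .
  \<comment> \<open>\<open>N\<close> pulled back along the linear parametrization of the tangent
    space by its components in \<open>c\<close>, hence a norm on the model space.\<close>
  let ?n = "\<lambda>a. N (tv c m a)"
  note T = tv_tangent[OF cm]
  have N0: "\<And>v. v \<in> tangent_space A m \<Longrightarrow> 0 \<le> N v \<and> (N v = 0 \<longleftrightarrow> v = 0)"
    and N1: "\<And>r v. v \<in> tangent_space A m \<Longrightarrow> N (r *\<^sub>R v) = \<bar>r\<bar> * N v"
    and N2: "\<And>v w. v \<in> tangent_space A m \<Longrightarrow> w \<in> tangent_space A m \<Longrightarrow> N (v + w) \<le> N v + N w"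
    using assms(5) unfolding norm_on_def by auto
  have tv0: "tv c m a = 0 \<longleftrightarrow> a = 0" for a
    using tv_scaleR[OF cm, of 0 a] tv_apply[OF cm, of a] by (auto simp: zero_fun_def)
  obtain \<kappa> where \<kappa>: "\<kappa> > 0" "\<And>a. ?n a \<le> \<kappa> * norm a" "\<And>a. norm a \<le> \<kappa> * ?n a"
  proof (rule norm_equivalence[of ?n])
    show "0 \<le> ?n a" "?n a = 0 \<longleftrightarrow> a = 0" for a using N0[OF T] tv0 by auto
    show "?n (r *\<^sub>R a) = \<bar>r\<bar> * ?n a" for r a by (simp add: tv_scaleR[OF cm] N1[OF T])
    show "?n (a + b) \<le> ?n a + ?n b" for a b by (simp add: tv_add[OF cm] N2[OF T T])
  qed blast
  have low: "norm (v c) \<le> \<kappa> * N v" if "v \<in> tangent_space A m" for v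
    using \<kappa>(3)[of "v c"] tangent_tv[OF that cm] by simp
  obtain \<delta> C where \<delta>: "\<delta> > 0" and C: "C \<ge> 0" and main: "\<And>u v. u \<in> tangent_space A m \<Longrightarrow> v \<in> tangent_space A m \<Longrightarrow>
      norm (u c) + norm (v c) < \<delta> \<Longrightarrow>
      ladder_step A nabla m U u v (\<lambda>Y. \<exists>X. Y = tv c m X \<and> norm X \<le> C * (norm (u c) + norm (v c)) ^ 5)"
    using pole_ladder_chart[OF assms(4)] by blast
  have "\<exists>\<epsilon>>0. \<exists>C. \<forall>u\<in>tangent_space A m. \<forall>v\<in>tangent_space A m. N u + N v < \<epsilon> \<longrightarrow>
      ladder_step A nabla m U u v (\<lambda>Y. N Y \<le> C * (N u + N v) ^ 5)"
  \<comment> \<open>One factor \<open>\<kappa>\<close> converts the error back to \<open>N\<close>;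
    the fifth power converts the sizes of \<open>u\<close> and \<open>v\<close>.\<close>
  proof (rule exI[of _ "\<delta> / \<kappa>"], rule conjI[rotated], rule exI[of _ "\<kappa> * C * \<kappa> ^ 5"], intro ballI impI)
    show "\<delta> / \<kappa> > 0" using \<delta> \<kappa> by simp
    fix u v assume uv: "u \<in> tangent_space A m" "v \<in> tangent_space A m" and sm: "N u + N v < \<delta> / \<kappa>"
    have s: "norm (u c) + norm (v c) \<le> \<kappa> * (N u + N v)" using low[OF uv(1)] low[OF uv(2)] by (simp add: distrib_left)
    also have "\<dots> < \<delta>" using sm \<kappa>(1) by (simp add: field_simps)
    finally have lt: "norm (u c) + norm (v c) < \<delta>" .
    have bound: "N Y \<le> \<kappa> * C * \<kappa> ^ 5 * (N u + N v) ^ 5" if X: "Y = tv c m X \<and> norm X \<le> C * (norm (u c) + norm (v c)) ^ 5" for X Y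
    proof -
      have "N Y \<le> \<kappa> * norm X" using \<kappa>(2) X by blast
      also have "\<dots> \<le> \<kappa> * (C * (norm (u c) + norm (v c)) ^ 5)" using X \<kappa>(1) by (intro mult_left_mono) auto
      also have "\<dots> \<le> \<kappa> * (C * (\<kappa> * (N u + N v)) ^ 5)" using s \<kappa>(1) C by (intro mult_left_mono power_mono) auto
      finally show ?thesis by (simp add: power_mult_distrib mult_ac)
    qed
    show "ladder_step A nabla m U u v (\<lambda>Y. N Y \<le> \<kappa> * C * \<kappa> ^ 5 * (N u + N v) ^ 5)"
      by (rule ladder_step_mono[OF main[OF uv lt]]) (use bound in blast)
  qed
  then show ?thesis unfolding ladder_step_def .
qed

end
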